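(* Let $\mathcal G$ be a finite connected groupoid, $x\in\mathcal G_0$, $\tau(x)=\{\tau_y\}_{y\in\mathcal G_0}$ a transversal for $x$, $A$ a ring, and $\beta=(B_g,\beta_g)_{g\in\mathcal G}$ the lifted partial action of $\mathcal G$ on $A$ coming from a datum $(I,\gamma_{\tau(x)},\gamma_{(x)})\in\mathcal D_{\tau(x)}(A)$. Assume that $\beta$ is $\tau(x)$-global and $\gamma$-unital, and that $A=\bigoplus_{y\in\mathcal G_0}I_y=\bigoplus_{y\in\mathcal G_0}B_y$. Then the following statements are equivalent: (i) $A$ is a $\beta$-partial Galois extension of $A^\beta$ and $t_\beta:A\to A^\beta$ is onto. (ii) The Morita context $(A^\beta,\ A\star_\beta\mathcal G,\ A,\ A,\ \Gamma,\ \Gamma')$ is strict. (iii) The Morita context $(B_x^{\beta_{(x)}},\ B_x\star_{\beta_{(x)}}\mathcal G(x),\ B_x,\ B_x,\ \Gamma_x,\ \Gamma'_x)$ is strict. (iv) $B_x$ is a $\beta_{(x)}$-partial Galois extension of $B_x^{\beta_{(x)}}$ and $t_{\beta_{(x)}}:B_x\to B_x^{\beta_{(x)}}$ is onto.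
   Context: Conventions. Rings are associative, not necessarily unital; ideals are two-sided. A groupoid $\mathcal G$ is a small category in which every morphism is invertible; it is identified with its set of morphisms, and its set of objects $\mathcal G_0$ is identified with the set of identity morphisms. For $g\in\mathcal G$, $s(g)=g^{-1}g$ and $t(g)=gg^{-1}$; $gh$ is defined iff $s(g)=t(h)$. Put $\mathcal G(y,z)=\{g: s(g)=y,\ t(g)=z\}$ and $\mathcal G(x)=\mathcal G(x,x)$ (a group). $\mathcal G$ is connected if $\mathcal G(y,z)\neq\emptyset$ for all $y,z\in\mathcal G_0$. A transversal for $x$ is a family $\tau(x)=\{\tau_y: y\in\mathcal G_0\}$ with $\tau_y\in\mathcal G(x,y)$ and $\tau_x=x$. Put $g_x=\tau_{t(g)}^{-1}g\tau_{s(g)}\in\mathcal G(x)$. For partial bijections, $u\circ v$ has domain $v^{-1}(\mathrm{dom}(u)\cap\mathrm{ran}(v))$ and range $u(\mathrm{dom}(u)\cap\mathrm{ran}(v))$. A partial action of a groupoid $\mathcal G$ on a ring $A$ is a family $\alpha=(A_g,\alpha_g)_{g\in\mathcal G}$ where, for each $g$, $A_{t(g)}$ is an ideal of $A$, $A_g$ is an ideal of $A_{t(g)}$, $\alpha_g:A_{g^{-1}}\to A_g$ is a ring isomorphism, $\alpha_y=\mathrm{id}_{A_y}$ for $y\in\mathcal G_0$, and $\alpha_{gh}$ extends $\alpha_g\circ\alpha_h$ whenever $s(g)=t(h)$. A partial action of a group $H$ on a ring $R$ is the one-object case with the ideal attached to the identity equal to $R$; it is unital if each of its ideals is a unital ring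 whose identity is a central idempotent of $R$. The partial action $\alpha$ is $\tau(x)$-global if $A_{\tau_y^{-1}}=A_x$ and $A_{\tau_y}=A_y$ for all $y\in\mathcal G_0$. An object of $\mathcal D_{\tau(x)}(A)$ is a datum $(I,\gamma_{\tau(x)},\gamma_{(x)})$ consisting of: (a) a family $I=\{I_y\}_{y\in\mathcal G_0}$ of ideals of $A$; (b) ring isomorphisms $\gamma_{\tau(x)}=\{\gamma_{\tau_y}:I_{\tau_y^{-1}}\to I_{\tau_y}\}_{y\in\mathcal G_0}$; (c) a partial action $\gamma_{(x)}=(I_h,\gamma_h)_{h\in\mathcal G(x)}$ of the group $\mathcal G(x)$ on $I_x$; such that (d) $\gamma_x=\gamma_{\tau_x}$ is the identity map of $I_x=I_{\tau_x}$; (e) $I_{\tau_y}$ is an ideal of $I_y$ and $I_{\tau_y^{-1}}$ is an ideal of $I_x$ for all $y$; (f) $\gamma_{\tau_{t(g)}}\big(I_{\tau_{t(g)}^{-1}}\cap\gamma_{g_x}(I_{\tau_{s(g)}^{-1}}\cap I_{g_x^{-1}})\big)$ is an ideal of $I_{t(g)}$ for all $g\in\mathcal G$. The lifted partial action coming from it is $\beta=(B_g,\beta_g)_{g\in\mathcal G}$ with $\beta_y=\mathrm{id}_{I_y}$ for $y\in\mathcal G_0$, $\beta_g=\gamma_{\tau_{t(g)}}\circ\gamma_{g_x}\circ\gamma_{\tau_{s(g)}}^{-1}$ for $g\notin\mathcal G_0$ (composition of partial bijections), and $B_g$ the range of $\beta_g$; it is a partial action of $\mathcal G$ on $A$. It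 is called $\gamma$-unital if $I_x$ is a unital ring and $\gamma_{(x)}$ is a unital partial group action. When $\beta$ is $\tau(x)$-global and $\gamma$-unital, $B_g=\gamma_{\tau_{t(g)}}(I_{g_x})=A1_g$ for all $g\in\mathcal G$, where $1_h$ is the identity of $I_h$ for $h\in\mathcal G(x)$ and $1_g=\gamma_{\tau_{t(g)}}(1_{g_x})$ is the identity of $B_g$, a central idempotent of $A$. The restriction $\beta_{(x)}=(B_h,\beta_h)_{h\in\mathcal G(x)}$ is a partial action of $\mathcal G(x)$ on $B_x$; it equals $\gamma_{(x)}$. The partial skew groupoid ring is $A\star_\beta\mathcal G=\bigoplus_{g\in\mathcal G}B_g\delta_g$ ($\delta_g$ placeholder symbols), with multiplication determined by $(a\delta_g)(b\delta_h)=a\beta_g(b1_{g^{-1}})\delta_{gh}$ if $s(g)=t(h)$ and $0$ otherwise ($a\in B_g$, $b\in B_h$); its identity is $\sum_{y\in\mathcal G_0}1_y\delta_y$. Similarly $B_x\star_{\beta_{(x)}}\mathcal G(x)=\bigoplus_{h\in\mathcal G(x)}B_h\delta_h$. $A^\beta=\{a\in A:\beta_g(a1_{g^{-1}})=a1_g\ \forall g\in\mathcal G\}$ and $t_\beta:A\to A^\beta$, $t_\beta(a)=\sum_{g\in\mathcal G}\beta_g(a1_{g^{-1}})$. $A$ is an $(A^\beta,A\star_\beta\mathcal G)$-bimodule and an $(A\star_\beta\mathcal G,A^\beta)$-bimodule: $A^\beta$ acts by multiplication, and $a\delta_g\cdot b=a\beta_g(b1_{g^{-1}})$, $b\cdot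 a\delta_g=\beta_{g^{-1}}(ba)$ for $a\in B_g$, $b\in A$. The bimodule maps are $\Gamma:A\otimes_{A\star_\beta\mathcal G}A\to A^\beta$, $a\otimes b\mapsto t_\beta(ab)$, and $\Gamma':A\otimes_{A^\beta}A\to A\star_\beta\mathcal G$, $a\otimes b\mapsto\sum_{g\in\mathcal G}a\beta_g(b1_{g^{-1}})\delta_g$; $(A^\beta,A\star_\beta\mathcal G,A,A,\Gamma,\Gamma')$ is a Morita context. $B_x^{\beta_{(x)}}$, $t_{\beta_{(x)}}$, $\Gamma_x$ and $\Gamma'_x$ are defined by the same formulas with $(\mathcal G,A,\beta)$ replaced by $(\mathcal G(x),B_x,\beta_{(x)})$, and also give a Morita context. A Morita context $(R,S,U,V,\mu,\nu)$ (unital rings $R,S$, bimodules ${}_RU_S$, ${}_SV_R$, bimodule maps $\mu:U\otimes_SV\to R$, $\nu:V\otimes_RU\to S$ with $u\nu(v\otimes u')=\mu(u\otimes v)u'$ and $v\mu(u\otimes v')=\nu(v\otimes u)v'$) is strict if $\mu$ and $\nu$ are isomorphisms. $A$ is a $\beta$-partial Galois extension of $A^\beta$ if there exist $r\ge1$ and $a_i,b_i\in A$, $1\le i\le r$, such that $\sum_{i=1}^ra_i\beta_g(b_i1_{g^{-1}})$ equals $1_y$ if $g=y\in\mathcal G_0$ and equals $0$ if $g\in\mathcal G\setminus\mathcal G_0$. Likewise $B_x$ is a $\beta_{(x)}$-partial Galois extension of $B_x^{\beta_{(x)}}$ if there exist $a_i,b_i\in B_x$ such that $\sum_ia_i\beta_h(b_i1_{h^{-1}})$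 equals $1_x$ if $h=x$ and $0$ if $h\in\mathcal G(x)$, $h\neq x$. *)

theory Defs
  imports
    "HOL-Algebra.Ring"
    "HOL-Algebra.Generated_Groups"
    "HOL-Algebra.Free_Abelian_Groups"
begin

section \<open>Groupoids\<close>

text \<open>
  A groupoid is given by its set of morphisms; an object is identified with its identity
  morphism, so sources and targets are morphisms. The composite \<open>cmp G g h\<close> (first \<open>h\<close>,
  then \<open>g\<close>) is only meaningful when \<open>src G g = tgt G h\<close>.
\<close>

record 'g groupoid = "'g partial_object" +
  src :: "'g \<Rightarrow> 'g"
  tgt :: "'g \<Rightarrow> 'g"
  cmp :: "'g \<Rightarrow> 'g \<Rightarrow> 'g"

locale groupoid =
  fixes G :: "('g, 'm) groupoid_scheme"
  assumes src_closed: "g \<in> carrier G \<Longrightarrow> src G g \<in> carrier G"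
    and tgt_closed: "g \<in> carrier G \<Longrightarrow> tgt G g \<in> carrier G"
    and src_src: "g \<in> carrier G \<Longrightarrow> src G (src G g) = src G g"
    and tgt_src: "g \<in> carrier G \<Longrightarrow> tgt G (src G g) = src G g"
    and src_tgt: "g \<in> carrier G \<Longrightarrow> src G (tgt G g) = tgt G g"
    and tgt_tgt: "g \<in> carrier G \<Longrightarrow> tgt G (tgt G g) = tgt G g"
    and cmp_closed: "\<lbrakk>g \<in> carrier G; h \<in> carrier G; src G g = tgt G h\<rbrakk>
      \<Longrightarrow> cmp G g h \<in> carrier G"
    and src_cmp: "\<lbrakk>g \<in> carrier G; h \<in> carrier G; src G g = tgt G h\<rbrakk>
      \<Longrightarrow> src G (cmp G g h) = src G h"
    and tgt_cmp: "\<lbrakk>g \<in> carrier G; h \<in> carrier G; src G g = tgt G h\<rbrakk>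
      \<Longrightarrow> tgt G (cmp G g h) = tgt G g"
    and cmp_src: "g \<in> carrier G \<Longrightarrow> cmp G g (src G g) = g"
    and tgt_cmp_id: "g \<in> carrier G \<Longrightarrow> cmp G (tgt G g) g = g"
    and cmp_assoc: "\<lbrakk>g \<in> carrier G; h \<in> carrier G; k \<in> carrier G;
      src G g = tgt G h; src G h = tgt G k\<rbrakk>
      \<Longrightarrow> cmp G (cmp G g h) k = cmp G g (cmp G h k)"
    and inverse_ex: "g \<in> carrier G \<Longrightarrow> \<exists>h\<in>carrier G. src G h = tgt G g \<and> tgt G h = src G g \<and>
      cmp G h g = src G g \<and> cmp G g h = tgt G g"

definition ginv :: "('g, 'm) groupoid_scheme \<Rightarrow> 'g \<Rightarrow> 'g" where
  "ginv G g = (THE h. h \<in> carrier G \<and> src G h = tgt G g \<and> tgt G h = src G g \<and>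
     cmp G h g = src G g \<and> cmp G g h = tgt G g)"

definition objs :: "('g, 'm) groupoid_scheme \<Rightarrow> 'g set" where
  "objs G = {y \<in> carrier G. src G y = y \<and> tgt G y = y}"

definition homset :: "('g, 'm) groupoid_scheme \<Rightarrow> 'g \<Rightarrow> 'g \<Rightarrow> 'g set" where
  "homset G y z = {g \<in> carrier G. src G g = y \<and> tgt G g = z}"

text \<open>The isotropy group at \<open>x\<close>, as a groupoid whose only object is \<open>x\<close>.\<close>

definition isotropy :: "('g, 'm) groupoid_scheme \<Rightarrow> 'g \<Rightarrow> ('g, 'm) groupoid_scheme" where
  "isotropy G x = G\<lparr>carrier := homset G x x\<rparr>"

definition connected_groupoid :: "('g, 'm) groupoid_scheme \<Rightarrow> bool" where
  "connected_groupoid G \<longleftrightarrow> (\<forall>y\<in>objs G. \<forall>z\<in>objs G. homset G y z \<noteq> {})"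

definition transversal :: "('g, 'm) groupoid_scheme \<Rightarrow> 'g \<Rightarrow> ('g \<Rightarrow> 'g) \<Rightarrow> bool" where
  "transversal G x \<tau> \<longleftrightarrow> (\<forall>y\<in>objs G. \<tau> y \<in> homset G x y) \<and> \<tau> x = x"

definition loop_at :: "('g, 'm) groupoid_scheme \<Rightarrow> ('g \<Rightarrow> 'g) \<Rightarrow> 'g \<Rightarrow> 'g" where
  "loop_at G \<tau> g = cmp G (cmp G (ginv G (\<tau> (tgt G g))) g) (\<tau> (src G g))"


section \<open>Rings, ideals, direct sums\<close>

text \<open>
  All rings acted upon live inside one type of sort \<^class>\<open>ring\<close> (associative, not
  necessarily unital) and are represented by their underlying sets.
\<close>

definition is_ideal :: "'a::ring set \<Rightarrow> 'a set \<Rightarrow> bool" where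
  "is_ideal J R \<longleftrightarrow> J \<subseteq> R \<and> 0 \<in> J \<and> (\<forall>a\<in>J. \<forall>b\<in>J. a - b \<in> J) \<and>
     (\<forall>r\<in>R. \<forall>a\<in>J. r * a \<in> J \<and> a * r \<in> J)"

definition is_unity :: "'a::ring set \<Rightarrow> 'a \<Rightarrow> bool" where
  "is_unity R e \<longleftrightarrow> e \<in> R \<and> (\<forall>a\<in>R. e * a = a \<and> a * e = a)"

definition unity :: "'a::ring set \<Rightarrow> 'a" where
  "unity R = (THE e. is_unity R e)"

definition unital_ring :: "'a::ring set \<Rightarrow> bool" where
  "unital_ring R \<longleftrightarrow> (\<exists>e. is_unity R e)"

text \<open>\<open>A\<close> is the internal direct sum of the family \<open>X\<close> over the finite index set \<open>J\<close>.\<close>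

definition direct_sum :: "'i set \<Rightarrow> ('i \<Rightarrow> 'a::ring set) \<Rightarrow> 'a set \<Rightarrow> bool" where
  "direct_sum J X A \<longleftrightarrow> bij_betw (\<lambda>f. \<Sum>j\<in>J. f j) (Pi\<^sub>E J X) A"


section \<open>Partial actions\<close>

text \<open>
  A partial bijection is a map \<open>f :: 'a \<rightharpoonup> 'a\<close> with domain \<^term>\<open>dom f\<close> and range
  \<^term>\<open>ran f\<close>; \<open>\<circ>\<^sub>m\<close> is composition of partial maps on the largest possible domain, and
  \<open>f \<subseteq>\<^sub>m g\<close> says that \<open>g\<close> extends \<open>f\<close>.
\<close>

definition pinv :: "('a \<rightharpoonup> 'a) \<Rightarrow> ('a \<rightharpoonup> 'a)" where
  "pinv f b = (if b \<in> ran f then Some (THE a. f a = Some b) else None)"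

definition pid :: "'a set \<Rightarrow> ('a \<rightharpoonup> 'a)" where
  "pid R = Some |` R"

definition pimage :: "('a \<rightharpoonup> 'a) \<Rightarrow> 'a set \<Rightarrow> 'a set" where
  "pimage f X = ran (f |` X)"

definition prng_iso :: "('a::ring \<rightharpoonup> 'a) \<Rightarrow> 'a set \<Rightarrow> 'a set \<Rightarrow> bool" where
  "prng_iso f R S \<longleftrightarrow> dom f = R \<and> bij_betw (\<lambda>a. the (f a)) R S \<and>
     (\<forall>a\<in>R. \<forall>b\<in>R. the (f (a + b)) = the (f a) + the (f b) \<and>
                   the (f (a * b)) = the (f a) * the (f b))"

text \<open>
  In a partial action \<open>(A\<^sub>g, \<alpha>\<^sub>g)\<close> the ideal \<open>A\<^sub>g\<close> is the range of \<open>\<alpha>\<^sub>g\<close>, so the family of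
  partial maps determines the partial action.
\<close>

definition partial_action ::
  "('g, 'm) groupoid_scheme \<Rightarrow> 'a::ring set \<Rightarrow> ('g \<Rightarrow> 'a \<rightharpoonup> 'a) \<Rightarrow> bool" where
  "partial_action G A \<alpha> \<longleftrightarrow>
     (\<forall>g\<in>carrier G. is_ideal (ran (\<alpha> (tgt G g))) A \<and>
        is_ideal (ran (\<alpha> g)) (ran (\<alpha> (tgt G g))) \<and>
        prng_iso (\<alpha> g) (ran (\<alpha> (ginv G g))) (ran (\<alpha> g))) \<and>
     (\<forall>y\<in>objs G. \<alpha> y = pid (ran (\<alpha> y))) \<and>
     (\<forall>g\<in>carrier G. \<forall>h\<in>carrier G. src G g = tgt G h \<longrightarrow>
        (\<alpha> g \<circ>\<^sub>m \<alpha> h) \<subseteq>\<^sub>m \<alpha> (cmp G g h))"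

text \<open>Here \<open>H\<close> is a group, i.e. a groupoid with a single object.\<close>

definition group_partial_action ::
  "('g, 'm) groupoid_scheme \<Rightarrow> 'a::ring set \<Rightarrow> ('g \<Rightarrow> 'a \<rightharpoonup> 'a) \<Rightarrow> bool" where
  "group_partial_action H R \<alpha> \<longleftrightarrow> partial_action H R \<alpha> \<and> (\<forall>e\<in>objs H. ran (\<alpha> e) = R)"

definition unital_partial_action ::
  "('g, 'm) groupoid_scheme \<Rightarrow> 'a::ring set \<Rightarrow> ('g \<Rightarrow> 'a \<rightharpoonup> 'a) \<Rightarrow> bool" where
  "unital_partial_action H R \<alpha> \<longleftrightarrow> (\<forall>h\<in>carrier H. \<exists>e. is_unity (ran (\<alpha> h)) e \<and>
     e * e = e \<and> (\<forall>r\<in>R. e * r = r * e))"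

definition tau_global ::
  "('g, 'm) groupoid_scheme \<Rightarrow> 'g \<Rightarrow> ('g \<Rightarrow> 'g) \<Rightarrow> ('g \<Rightarrow> 'a \<rightharpoonup> 'a) \<Rightarrow> bool" where
  "tau_global G x \<tau> \<alpha> \<longleftrightarrow>
     (\<forall>y\<in>objs G. ran (\<alpha> (ginv G (\<tau> y))) = ran (\<alpha> x) \<and> ran (\<alpha> (\<tau> y)) = ran (\<alpha> y))"


section \<open>Lifted partial actions\<close>

text \<open>
  A datum \<open>(I, \<gamma>\<^bsub>\<tau>(x)\<^esub>, \<gamma>\<^bsub>(x)\<^esub>)\<close>: the ideals \<open>I\<^sub>y\<close> are \<open>I y\<close>, the isomorphism \<open>\<gamma>\<^bsub>\<tau>\<^sub>y\<^esub>\<close> is \<open>\<gamma>\<tau> y\<close>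
  (so \<open>I\<^bsub>\<tau>\<^sub>y\<^esub>\<close> is its range and \<open>I\<^bsub>\<tau>\<^sub>y\<inverse>\<^esub>\<close> its domain), and \<open>\<gamma>\<^sub>h\<close>, for \<open>h\<close> in the isotropy
  group of \<open>x\<close>, is \<open>\<gamma>x h\<close> (so \<open>I\<^sub>h\<close> is its range).
\<close>

definition datum ::
  "('g, 'm) groupoid_scheme \<Rightarrow> 'g \<Rightarrow> ('g \<Rightarrow> 'g) \<Rightarrow> 'a::ring set \<Rightarrow> ('g \<Rightarrow> 'a set) \<Rightarrow>
   ('g \<Rightarrow> 'a \<rightharpoonup> 'a) \<Rightarrow> ('g \<Rightarrow> 'a \<rightharpoonup> 'a) \<Rightarrow> bool" where
  "datum G x \<tau> A I \<gamma>\<tau> \<gamma>x \<longleftrightarrow>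
     (\<forall>y\<in>objs G. is_ideal (I y) A) \<and>
     (\<forall>y\<in>objs G. prng_iso (\<gamma>\<tau> y) (dom (\<gamma>\<tau> y)) (ran (\<gamma>\<tau> y))) \<and>
     group_partial_action (isotropy G x) (I x) \<gamma>x \<and>
     \<gamma>x x = pid (I x) \<and> \<gamma>\<tau> x = pid (I x) \<and>
     (\<forall>y\<in>objs G. is_ideal (ran (\<gamma>\<tau> y)) (I y) \<and> is_ideal (dom (\<gamma>\<tau> y)) (I x)) \<and>
     (\<forall>g\<in>carrier G.
        is_ideal
          (pimage (\<gamma>\<tau> (tgt G g))
            (dom (\<gamma>\<tau> (tgt G g)) \<inter>
             pimage (\<gamma>x (loop_at G \<tau> g))
               (dom (\<gamma>\<tau> (src G g)) \<inter> ran (\<gamma>x (ginv G (loop_at G \<tau> g))))))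
          (I (tgt G g)))"

definition lifted ::
  "('g, 'm) groupoid_scheme \<Rightarrow> ('g \<Rightarrow> 'g) \<Rightarrow> ('g \<Rightarrow> 'a set) \<Rightarrow>
   ('g \<Rightarrow> 'a \<rightharpoonup> 'a) \<Rightarrow> ('g \<Rightarrow> 'a \<rightharpoonup> 'a) \<Rightarrow> 'g \<Rightarrow> 'a \<rightharpoonup> 'a" where
  "lifted G \<tau> I \<gamma>\<tau> \<gamma>x g =
     (if g \<in> objs G then pid (I g)
      else \<gamma>\<tau> (tgt G g) \<circ>\<^sub>m \<gamma>x (loop_at G \<tau> g) \<circ>\<^sub>m pinv (\<gamma>\<tau> (src G g)))"

definition gamma_unital ::
  "('g, 'm) groupoid_scheme \<Rightarrow> 'g \<Rightarrow> ('g \<Rightarrow> 'a::ring set) \<Rightarrow> ('g \<Rightarrow> 'a \<rightharpoonup> 'a) \<Rightarrow> bool" where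
  "gamma_unital G x I \<gamma>x \<longleftrightarrow>
     unital_ring (I x) \<and> unital_partial_action (isotropy G x) (I x) \<gamma>x"


section \<open>Invariants, trace, partial Galois extensions\<close>

text \<open>
  The definitions of this and the following section are meant for a finite groupoid \<open>G\<close> acting
  partially on \<open>A\<close> such that each \<open>A\<^sub>g\<close> has an identity \<open>1\<^sub>g\<close> that is central in \<open>A\<close>.
\<close>

definition idem :: "('g \<Rightarrow> 'a::ring \<rightharpoonup> 'a) \<Rightarrow> 'g \<Rightarrow> 'a" where
  "idem \<alpha> g = unity (ran (\<alpha> g))"

text \<open>\<open>\<alpha>\<^sub>g(a 1\<^bsub>g\<inverse>\<^esub>)\<close>\<close>

definition act :: "('g, 'm) groupoid_scheme \<Rightarrow> ('g \<Rightarrow> 'a::ring \<rightharpoonup> 'a) \<Rightarrow> 'g \<Rightarrow> 'a \<Rightarrow> 'a" where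
  "act G \<alpha> g a = the (\<alpha> g (a * idem \<alpha> (ginv G g)))"

definition invariants ::
  "('g, 'm) groupoid_scheme \<Rightarrow> 'a::ring set \<Rightarrow> ('g \<Rightarrow> 'a \<rightharpoonup> 'a) \<Rightarrow> 'a set" where
  "invariants G A \<alpha> = {a \<in> A. \<forall>g\<in>carrier G. act G \<alpha> g a = a * idem \<alpha> g}"

definition tr :: "('g, 'm) groupoid_scheme \<Rightarrow> ('g \<Rightarrow> 'a::ring \<rightharpoonup> 'a) \<Rightarrow> 'a \<Rightarrow> 'a" where
  "tr G \<alpha> a = (\<Sum>g\<in>carrier G. act G \<alpha> g a)"

definition partial_galois ::
  "('g, 'm) groupoid_scheme \<Rightarrow> 'a::ring set \<Rightarrow> ('g \<Rightarrow> 'a \<rightharpoonup> 'a) \<Rightarrow> bool" where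
  "partial_galois G A \<alpha> \<longleftrightarrow>
     (\<exists>r\<ge>(1::nat). \<exists>a b. (\<forall>i\<in>{1..r}. a i \<in> A \<and> b i \<in> A) \<and>
        (\<forall>g\<in>carrier G. (\<Sum>i=1..r. a i * act G \<alpha> g (b i)) =
           (if g \<in> objs G then idem \<alpha> g else 0)))"


section \<open>Bimodules, tensor products, Morita contexts\<close>

text \<open>
  As for modules in HOL-Algebra, the carrier group is the additive group of a \<open>ring\<close> record,
  whose multiplicative fields play no role.
\<close>

record ('r, 's, 'u) bimodule = "'u ring" +
  lact :: "'r \<Rightarrow> 'u \<Rightarrow> 'u"
  ract :: "'u \<Rightarrow> 's \<Rightarrow> 'u"

locale bimodule = R: ring R + S: ring S + M: abelian_group M
  for R :: "('r, 'm1) ring_scheme" and S :: "('s, 'm2) ring_scheme"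
    and M :: "('r, 's, 'u, 'm3) bimodule_scheme" +
  assumes lact_closed: "\<lbrakk>r \<in> carrier R; u \<in> carrier M\<rbrakk> \<Longrightarrow> lact M r u \<in> carrier M"
    and lact_add_left: "\<lbrakk>r \<in> carrier R; r' \<in> carrier R; u \<in> carrier M\<rbrakk> \<Longrightarrow>
      lact M (r \<oplus>\<^bsub>R\<^esub> r') u = lact M r u \<oplus>\<^bsub>M\<^esub> lact M r' u"
    and lact_add_right: "\<lbrakk>r \<in> carrier R; u \<in> carrier M; u' \<in> carrier M\<rbrakk> \<Longrightarrow>
      lact M r (u \<oplus>\<^bsub>M\<^esub> u') = lact M r u \<oplus>\<^bsub>M\<^esub> lact M r u'"
    and lact_assoc: "\<lbrakk>r \<in> carrier R; r' \<in> carrier R; u \<in> carrier M\<rbrakk> \<Longrightarrow>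
      lact M (r \<otimes>\<^bsub>R\<^esub> r') u = lact M r (lact M r' u)"
    and lact_one: "u \<in> carrier M \<Longrightarrow> lact M \<one>\<^bsub>R\<^esub> u = u"
    and ract_closed: "\<lbrakk>s \<in> carrier S; u \<in> carrier M\<rbrakk> \<Longrightarrow> ract M u s \<in> carrier M"
    and ract_add_right: "\<lbrakk>s \<in> carrier S; s' \<in> carrier S; u \<in> carrier M\<rbrakk> \<Longrightarrow>
      ract M u (s \<oplus>\<^bsub>S\<^esub> s') = ract M u s \<oplus>\<^bsub>M\<^esub> ract M u s'"
    and ract_add_left: "\<lbrakk>s \<in> carrier S; u \<in> carrier M; u' \<in> carrier M\<rbrakk> \<Longrightarrow>
      ract M (u \<oplus>\<^bsub>M\<^esub> u') s = ract M u s \<oplus>\<^bsub>M\<^esub> ract M u' s"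
    and ract_assoc: "\<lbrakk>s \<in> carrier S; s' \<in> carrier S; u \<in> carrier M\<rbrakk> \<Longrightarrow>
      ract M u (s \<otimes>\<^bsub>S\<^esub> s') = ract M (ract M u s) s'"
    and ract_one: "u \<in> carrier M \<Longrightarrow> ract M u \<one>\<^bsub>S\<^esub> = u"
    and lact_ract: "\<lbrakk>r \<in> carrier R; s \<in> carrier S; u \<in> carrier M\<rbrakk> \<Longrightarrow>
      ract M (lact M r u) s = lact M r (ract M u s)"

text \<open>
  \<open>M \<otimes>\<^sub>S N\<close>, for a right \<open>S\<close>-module \<open>M\<close> and a left \<open>S\<close>-module \<open>N\<close>: the free abelian group on
  \<open>M \<times> N\<close> modulo the subgroup generated by biadditivity and balancedness.
\<close>

definition tensor_rels ::
  "('s, 'm) ring_scheme \<Rightarrow> ('r, 's, 'u, 'm1) bimodule_scheme \<Rightarrow>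
   ('s, 'q, 'v, 'm2) bimodule_scheme \<Rightarrow> ('u \<times> 'v \<Rightarrow>\<^sub>0 int) set" where
  "tensor_rels S M N =
     {frag_of (u \<oplus>\<^bsub>M\<^esub> u', v) - frag_of (u, v) - frag_of (u', v) | u u' v.
        u \<in> carrier M \<and> u' \<in> carrier M \<and> v \<in> carrier N} \<union>
     {frag_of (u, v \<oplus>\<^bsub>N\<^esub> v') - frag_of (u, v) - frag_of (u, v') | u v v'.
        u \<in> carrier M \<and> v \<in> carrier N \<and> v' \<in> carrier N} \<union>
     {frag_of (ract M u s, v) - frag_of (u, lact N s v) | u s v.
        u \<in> carrier M \<and> s \<in> carrier S \<and> v \<in> carrier N}"

definition tensor_kernel ::
  "('s, 'm) ring_scheme \<Rightarrow> ('r, 's, 'u, 'm1) bimodule_scheme \<Rightarrow>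
   ('s, 'q, 'v, 'm2) bimodule_scheme \<Rightarrow> ('u \<times> 'v \<Rightarrow>\<^sub>0 int) set" where
  "tensor_kernel S M N =
     generate (free_Abelian_group (carrier M \<times> carrier N)) (tensor_rels S M N)"

definition tensor ::
  "('s, 'm) ring_scheme \<Rightarrow> ('r, 's, 'u, 'm1) bimodule_scheme \<Rightarrow>
   ('s, 'q, 'v, 'm2) bimodule_scheme \<Rightarrow> ('u \<times> 'v \<Rightarrow>\<^sub>0 int) set monoid" where
  "tensor S M N = free_Abelian_group (carrier M \<times> carrier N) Mod tensor_kernel S M N"

text \<open>The elementary tensor \<open>u \<otimes> v\<close>.\<close>

definition tens ::
  "('s, 'm) ring_scheme \<Rightarrow> ('r, 's, 'u, 'm1) bimodule_scheme \<Rightarrow>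
   ('s, 'q, 'v, 'm2) bimodule_scheme \<Rightarrow> 'u \<Rightarrow> 'v \<Rightarrow> ('u \<times> 'v \<Rightarrow>\<^sub>0 int) set" where
  "tens S M N u v =
     tensor_kernel S M N #>\<^bsub>free_Abelian_group (carrier M \<times> carrier N)\<^esub> frag_of (u, v)"

text \<open>
  The additive map to \<open>P\<close> on a tensor product given by \<open>u \<otimes> v \<mapsto> f u v\<close>; it is well defined
  whenever \<open>f\<close> is biadditive and balanced.
\<close>

definition tensor_map ::
  "('p, 'm) ring_scheme \<Rightarrow> ('u \<Rightarrow> 'v \<Rightarrow> 'p) \<Rightarrow> ('u \<times> 'v \<Rightarrow>\<^sub>0 int) set \<Rightarrow> 'p" where
  "tensor_map P f X =
     the_elem ((\<lambda>c. \<Oplus>\<^bsub>P\<^esub>k\<in>Poly_Mapping.keys c.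
       [Poly_Mapping.lookup c k] \<cdot>\<^bsub>P\<^esub> f (fst k) (snd k)) ` X)"

text \<open>
  Bilinearity of \<open>\<mu>\<close> and \<open>\<nu>\<close> is stated on elementary tensors, which generate the tensor
  product and on which the actions are \<open>r(u \<otimes> v) = ru \<otimes> v\<close> and \<open>(u \<otimes> v)r = u \<otimes> vr\<close>.
\<close>

locale morita_context =
  U: bimodule R S U + V: bimodule S R V
  for R :: "('r, 'm1) ring_scheme" and S :: "('s, 'm2) ring_scheme"
    and U :: "('r, 's, 'u, 'm3) bimodule_scheme" and V :: "('s, 'r, 'v, 'm4) bimodule_scheme" +
  fixes \<mu> :: "('u \<times> 'v \<Rightarrow>\<^sub>0 int) set \<Rightarrow> 'r"
    and \<nu> :: "('v \<times> 'u \<Rightarrow>\<^sub>0 int) set \<Rightarrow> 's"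
  assumes mu_hom: "\<mu> \<in> hom (tensor S U V) (add_monoid R)"
    and mu_left: "\<lbrakk>r \<in> carrier R; u \<in> carrier U; v \<in> carrier V\<rbrakk> \<Longrightarrow>
      \<mu> (tens S U V (lact U r u) v) = r \<otimes>\<^bsub>R\<^esub> \<mu> (tens S U V u v)"
    and mu_right: "\<lbrakk>r \<in> carrier R; u \<in> carrier U; v \<in> carrier V\<rbrakk> \<Longrightarrow>
      \<mu> (tens S U V u (ract V v r)) = \<mu> (tens S U V u v) \<otimes>\<^bsub>R\<^esub> r"
    and nu_hom: "\<nu> \<in> hom (tensor R V U) (add_monoid S)"
    and nu_left: "\<lbrakk>s \<in> carrier S; u \<in> carrier U; v \<in> carrier V\<rbrakk> \<Longrightarrow>
      \<nu> (tens R V U (lact V s v) u) = s \<otimes>\<^bsub>S\<^esub> \<nu> (tens R V U v u)"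
    and nu_right: "\<lbrakk>s \<in> carrier S; u \<in> carrier U; v \<in> carrier V\<rbrakk> \<Longrightarrow>
      \<nu> (tens R V U v (ract U u s)) = \<nu> (tens R V U v u) \<otimes>\<^bsub>S\<^esub> s"
    and mu_nu: "\<lbrakk>u \<in> carrier U; v \<in> carrier V; u' \<in> carrier U\<rbrakk> \<Longrightarrow>
      ract U u (\<nu> (tens R V U v u')) = lact U (\<mu> (tens S U V u v)) u'"
    and nu_mu: "\<lbrakk>v \<in> carrier V; u \<in> carrier U; v' \<in> carrier V\<rbrakk> \<Longrightarrow>
      ract V v (\<mu> (tens S U V u v')) = lact V (\<nu> (tens R V U v u)) v'"

locale strict_morita_context = morita_context +
  assumes mu_iso: "\<mu> \<in> iso (tensor S U V) (add_monoid R)"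
    and nu_iso: "\<nu> \<in> iso (tensor R V U) (add_monoid S)"


section \<open>The partial skew groupoid ring and its Morita context\<close>

definition inv_ring ::
  "('g, 'm) groupoid_scheme \<Rightarrow> 'a::ring set \<Rightarrow> ('g \<Rightarrow> 'a \<rightharpoonup> 'a) \<Rightarrow> 'a ring" where
  "inv_ring G A \<alpha> = \<lparr>carrier = invariants G A \<alpha>, monoid.mult = (*), one = unity (invariants G A \<alpha>),
     ring.zero = 0, ring.add = (+)\<rparr>"

text \<open>The element \<open>\<Sum>\<^sub>g f(g) \<delta>\<^sub>g\<close> is represented by the function \<open>f\<close>, extended by \<open>0\<close>.\<close>

definition skew_ring ::
  "('g, 'm) groupoid_scheme \<Rightarrow> ('g \<Rightarrow> 'a::ring \<rightharpoonup> 'a) \<Rightarrow> ('g \<Rightarrow> 'a) ring" where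
  "skew_ring G \<alpha> =
     \<lparr>carrier = {f. (\<forall>g\<in>carrier G. f g \<in> ran (\<alpha> g)) \<and> (\<forall>g. g \<notin> carrier G \<longrightarrow> f g = 0)},
      monoid.mult = (\<lambda>f f' k. \<Sum>(g, h) \<in> {(g, h). g \<in> carrier G \<and> h \<in> carrier G \<and>
                 src G g = tgt G h \<and> cmp G g h = k}. f g * act G \<alpha> g (f' h)),
      one = (\<lambda>g. if g \<in> objs G then idem \<alpha> g else 0),
      ring.zero = (\<lambda>g. 0),
      ring.add = (\<lambda>f f' g. f g + f' g)\<rparr>"

text \<open>\<open>A\<close> as a bimodule over \<open>(A\<^sup>\<alpha>, A \<star> G)\<close> and over \<open>(A \<star> G, A\<^sup>\<alpha>)\<close>.\<close>

definition left_inv_bimodule ::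
  "('g, 'm) groupoid_scheme \<Rightarrow> 'a::ring set \<Rightarrow> ('g \<Rightarrow> 'a \<rightharpoonup> 'a) \<Rightarrow> ('a, 'g \<Rightarrow> 'a, 'a) bimodule" where
  "left_inv_bimodule G A \<alpha> =
     \<lparr>carrier = A, monoid.mult = (*), one = unity A, ring.zero = 0, ring.add = (+),
      lact = (*),
      ract = (\<lambda>b f. \<Sum>g\<in>carrier G. the (\<alpha> (ginv G g) (b * f g)))\<rparr>"

definition right_inv_bimodule ::
  "('g, 'm) groupoid_scheme \<Rightarrow> 'a::ring set \<Rightarrow> ('g \<Rightarrow> 'a \<rightharpoonup> 'a) \<Rightarrow> ('g \<Rightarrow> 'a, 'a, 'a) bimodule" where
  "right_inv_bimodule G A \<alpha> =
     \<lparr>carrier = A, monoid.mult = (*), one = unity A, ring.zero = 0, ring.add = (+),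
      lact = (\<lambda>f b. \<Sum>g\<in>carrier G. f g * act G \<alpha> g b),
      ract = (*)\<rparr>"

definition Gamma_map ::
  "('g, 'm) groupoid_scheme \<Rightarrow> 'a::ring set \<Rightarrow> ('g \<Rightarrow> 'a \<rightharpoonup> 'a) \<Rightarrow>
   ('a \<times> 'a \<Rightarrow>\<^sub>0 int) set \<Rightarrow> 'a" where
  "Gamma_map G A \<alpha> = tensor_map (inv_ring G A \<alpha>) (\<lambda>a b. tr G \<alpha> (a * b))"

definition Gamma'_map ::
  "('g, 'm) groupoid_scheme \<Rightarrow> ('g \<Rightarrow> 'a::ring \<rightharpoonup> 'a) \<Rightarrow>
   ('a \<times> 'a \<Rightarrow>\<^sub>0 int) set \<Rightarrow> 'g \<Rightarrow> 'a" where
  "Gamma'_map G \<alpha> = tensor_map (skew_ring G \<alpha>)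
     (\<lambda>a b g. if g \<in> carrier G then a * act G \<alpha> g b else 0)"

definition galois_morita_strict ::
  "('g, 'm) groupoid_scheme \<Rightarrow> 'a::ring set \<Rightarrow> ('g \<Rightarrow> 'a \<rightharpoonup> 'a) \<Rightarrow> bool" where
  "galois_morita_strict G A \<alpha> \<longleftrightarrow>
     strict_morita_context (inv_ring G A \<alpha>) (skew_ring G \<alpha>)
       (left_inv_bimodule G A \<alpha>) (right_inv_bimodule G A \<alpha>)
       (Gamma_map G A \<alpha>) (Gamma'_map G \<alpha>)"

end

theory Submission
  imports Defs
begin

text \<open>
  For a Morita context of unital rings, surjectivity of a structure map already implies its
  injectivity, and its image is an ideal; so strictness only says that both identities are hit. For the
  Galois context, \<open>1 \<in> im \<Gamma>\<close> means that the trace is onto and \<open>1 \<in> im \<Gamma>'\<close> is the existence of Galois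
  coordinates. This gives (i) \<open>\<longleftrightarrow>\<close> (ii), and (iii) \<open>\<longleftrightarrow>\<close> (iv) is the same equivalence for the isotropy
  group. For (i) \<open>\<longleftrightarrow>\<close> (iv), the action is conjugate along the transversal to that of the isotropy group:
  if \<open>g\<close> goes from \<open>y\<close> to \<open>z\<close>, then \<open>\<beta>\<^sub>g \<circ> \<beta>\<^bsub>\<tau> y\<^esub> = \<beta>\<^bsub>\<tau> z\<^esub> \<circ> \<beta>\<^bsub>h\<^esub>\<close> with \<open>h = loop_at G \<tau> g\<close>.
  Galois coordinates over \<open>x\<close> are transported by all \<open>\<beta>\<^bsub>\<tau> y\<^esub>\<close>,
  those over \<open>A\<close> are cut down by \<open>1\<^sub>x\<close>, and an invariant of \<open>A\<close> is determined by its component at \<open>x\<close>.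
\<close>

section \<open>Tensor products and Morita contexts\<close>

text \<open>The action is handled through the total maps \<open>\<phi> g\<close>, which first
  multiply by the identity of the domain of \<open>\<alpha> g\<close>. The obstacle is that they
  compose only up to an idempotent:
  \<open>\<phi> g (\<phi> h a) = \<phi> (cmp G g h) a * e g\<close>. The factor \<open>e g\<close>
  is disposed of in two ways. In the skew ring it is absorbed by a coefficient lying in
  \<open>B g\<close>. Along the transversal, globality gives
  \<open>e (cmp G g (\<tau> y)) = e g\<close>, so the factor disappears and conjugation to the
  isotropy group is strict although the action is only partial. The decomposition of
  \<open>A\<close> has two tasks. It makes the idempotents of different objects orthogonal, so that
  terms with non-composable indices vanish and sums may range over the whole groupoid; and it gives
  \<open>A\<close> the identity \<open>\<Sum>y\<in>objs G. e y\<close>. On the tensor side, the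
  quotient of the free abelian group is only a group. Multiplication by a ring element therefore has
  to be obtained from the universal property, with the tensor product itself as the target.\<close>

lemma (in comm_group) frag_finprod_hom:
  assumes f: "\<And>k. k \<in> S \<Longrightarrow> f k \<in> carrier G"
  shows "(\<lambda>c. \<Otimes>k\<in>Poly_Mapping.keys c. f k [^] Poly_Mapping.lookup c k)
    \<in> hom (free_Abelian_group S) G"
proof (rule homI)
  let ?p = "\<lambda>T c. \<Otimes>k\<in>T. f k [^] Poly_Mapping.lookup c k"
  \<comment> \<open>The supports of \<open>c\<close>, \<open>d\<close> and \<open>c + d\<close>
    differ; all three products are extended to one finite index set, where the additional exponents
    are 0.\<close>
  have ext: "?p (Poly_Mapping.keys c) c = ?p T c"
    if "Poly_Mapping.keys c \<subseteq> T" "finite T" "T \<subseteq> S" for T and c :: "_ \<Rightarrow>\<^sub>0 int"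
    by (rule finprod_mono_neutral_cong_left) (use that f in \<open>auto simp: in_keys_iff subset_eq int_pow_0\<close>)
  fix c d
  assume "c \<in> carrier (free_Abelian_group S)" "d \<in> carrier (free_Abelian_group S)"
  then have cd: "Poly_Mapping.keys c \<subseteq> S" "Poly_Mapping.keys d \<subseteq> S"
    by simp_all
  then show "?p (Poly_Mapping.keys c) c \<in> carrier G"
    using f by (intro finprod_closed) auto
  let ?T = "Poly_Mapping.keys c \<union> Poly_Mapping.keys d"
  have "?p (Poly_Mapping.keys (c + d)) (c + d) = ?p ?T (c + d)"
    using cd Poly_Mapping.keys_add[of c d] by (intro ext) auto
  also have "\<dots> = (\<Otimes>k\<in>?T. (f k [^] Poly_Mapping.lookup c k) \<otimes> (f k [^] Poly_Mapping.lookup d k))"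
    using f cd by (intro finprod_cong') (auto simp: lookup_add int_pow_mult)
  also have "\<dots> = ?p ?T c \<otimes> ?p ?T d"
    using f cd by (intro finprod_multf) auto
  also have "\<dots> = ?p (Poly_Mapping.keys c) c \<otimes> ?p (Poly_Mapping.keys d) d"
    using cd by (simp add: ext[of c ?T] ext[of d ?T])
  finally show "?p (Poly_Mapping.keys (c \<otimes>\<^bsub>free_Abelian_group S\<^esub> d)) (c \<otimes>\<^bsub>free_Abelian_group S\<^esub> d)
      = ?p (Poly_Mapping.keys c) c \<otimes> ?p (Poly_Mapping.keys d) d"
    by simp
qed

text \<open>The version of \<open>tensor_map\<close> for a multiplicative group as target. It is
  needed because one target below is a tensor product, which is a plain monoid record without a ring
  structure.\<close>

definition tensor_lift ::
  "('p, 'm) monoid_scheme \<Rightarrow> ('u \<Rightarrow> 'v \<Rightarrow> 'p) \<Rightarrow> ('u \<times> 'v \<Rightarrow>\<^sub>0 int) set \<Rightarrow> 'p" where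
  "tensor_lift H f X = the_elem ((\<lambda>c. \<Otimes>\<^bsub>H\<^esub>k\<in>Poly_Mapping.keys c.
     f (fst k) (snd k) [^]\<^bsub>H\<^esub> Poly_Mapping.lookup c k) ` X)"

lemma tensor_map_eq_lift: "tensor_map P f = tensor_lift (add_monoid P) f"
  by (simp add: fun_eq_iff tensor_map_def tensor_lift_def finsum_def add_pow_def)

section \<open>Tensor products as quotients of a free abelian group\<close>

locale tensor_pair = M: abelian_group M + N: abelian_group N
  for S :: "('s, 'm) ring_scheme" and M :: "('r, 's, 'u, 'm1) bimodule_scheme"
    and N :: "('s, 'q, 'v, 'm2) bimodule_scheme" +
  assumes ract_closed': "\<lbrakk>s \<in> carrier S; u \<in> carrier M\<rbrakk> \<Longrightarrow> ract M u s \<in> carrier M"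
    and lact_closed': "\<lbrakk>s \<in> carrier S; v \<in> carrier N\<rbrakk> \<Longrightarrow> lact N s v \<in> carrier N"
begin

abbreviation "F \<equiv> free_Abelian_group (carrier M \<times> carrier N)"
abbreviation "K \<equiv> tensor_kernel S M N"
abbreviation "T \<equiv> tensor S M N"

lemma tensor_rels_subset: "tensor_rels S M N \<subseteq> carrier F"
proof -
  have "frag_of a - frag_of b - frag_of c \<in> carrier F"
    if "a \<in> carrier M \<times> carrier N" "b \<in> carrier M \<times> carrier N" "c \<in> carrier M \<times> carrier N" for a b c
    using that keys_diff[of "frag_of a - frag_of b" "frag_of c"] keys_diff[of "frag_of a" "frag_of b"]
    by (auto simp: keys_frag_of)
  moreover have "frag_of a - frag_of b \<in> carrier F"
    if "a \<in> carrier M \<times> carrier N" "b \<in> carrier M \<times> carrier N" for a b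
    using that keys_diff[of "frag_of a" "frag_of b"] by (auto simp: keys_frag_of)
  ultimately show ?thesis
    unfolding tensor_rels_def
    by (auto simp del: carrier_free_Abelian_group_iff simp: ract_closed' lact_closed')
qed

lemma subgroup_tensor_kernel: "subgroup K F"
  unfolding tensor_kernel_def
  by (rule group.generate_is_subgroup[OF group_free_Abelian_group tensor_rels_subset])

lemma normal_tensor_kernel: "K \<lhd> F"
  using comm_group.subgroup_imp_normal[OF abelian_free_Abelian_group subgroup_tensor_kernel] .

lemma comm_group_tensor: "comm_group T"
  unfolding tensor_def
  by (rule comm_group.abelian_FactGroup[OF abelian_free_Abelian_group subgroup_tensor_kernel])

lemma tensor_rels_in_kernel: "r \<in> tensor_rels S M N \<Longrightarrow> r \<in> K"
  unfolding tensor_kernel_def by (rule generate.incl)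

lemma proj_hom: "(\<lambda>c. K #>\<^bsub>F\<^esub> c) \<in> hom F T"
  unfolding tensor_def by (rule normal.r_coset_hom_Mod[OF normal_tensor_kernel])

lemma carrier_tensor: "carrier T = (\<lambda>c. K #>\<^bsub>F\<^esub> c) ` carrier F"
  unfolding tensor_def by (rule carrier_FactGroup)

lemma tens_closed: "\<lbrakk>u \<in> carrier M; v \<in> carrier N\<rbrakk> \<Longrightarrow> tens S M N u v \<in> carrier T"
  unfolding carrier_tensor tens_def by (intro imageI) simp

lemma coset_eqI:
  assumes "c \<in> carrier F" "d \<in> carrier F" "c - d \<in> K"
  shows "K #>\<^bsub>F\<^esub> c = K #>\<^bsub>F\<^esub> d"
proof -
  interpret F: comm_group F by (rule abelian_free_Abelian_group)
  have "c \<in> K #>\<^bsub>F\<^esub> d"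
    using assms(3) by (force simp: r_coset_def)
  then show ?thesis
    using F.repr_independence[OF _ _ subgroup_tensor_kernel] assms(2) by metis
qed

lemma tens_add_left:
  assumes "u \<in> carrier M" "u' \<in> carrier M" "v \<in> carrier N"
  shows "tens S M N (u \<oplus>\<^bsub>M\<^esub> u') v = tens S M N u v \<otimes>\<^bsub>T\<^esub> tens S M N u' v"
proof -
  have "tens S M N u v \<otimes>\<^bsub>T\<^esub> tens S M N u' v = K #>\<^bsub>F\<^esub> (frag_of (u, v) + frag_of (u', v))"
    using hom_mult[OF proj_hom, of "frag_of (u, v)" "frag_of (u', v)"] assms by (simp add: tens_def)
  also have "\<dots> = tens S M N (u \<oplus>\<^bsub>M\<^esub> u') v"
  proof -
    have "frag_of (u, v) + frag_of (u', v) \<in> carrier F" "frag_of (u \<oplus>\<^bsub>M\<^esub> u', v) \<in> carrier F"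
      using assms keys_add[of "frag_of (u, v)" "frag_of (u', v)"] by (auto simp: keys_frag_of)
    moreover have "frag_of (u \<oplus>\<^bsub>M\<^esub> u', v) - (frag_of (u, v) + frag_of (u', v)) \<in> K"
      by (rule tensor_rels_in_kernel) (use assms in \<open>auto simp: tensor_rels_def algebra_simps\<close>)
    ultimately show ?thesis
      unfolding tens_def by (metis coset_eqI)
  qed
  finally show ?thesis ..
qed

lemma tens_add_right:
  assumes "u \<in> carrier M" "v \<in> carrier N" "v' \<in> carrier N"
  shows "tens S M N u (v \<oplus>\<^bsub>N\<^esub> v') = tens S M N u v \<otimes>\<^bsub>T\<^esub> tens S M N u v'"
proof -
  have "tens S M N u v \<otimes>\<^bsub>T\<^esub> tens S M N u v' = K #>\<^bsub>F\<^esub> (frag_of (u, v) + frag_of (u, v'))"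
    using hom_mult[OF proj_hom, of "frag_of (u, v)" "frag_of (u, v')"] assms by (simp add: tens_def)
  also have "\<dots> = tens S M N u (v \<oplus>\<^bsub>N\<^esub> v')"
  proof -
    have "frag_of (u, v) + frag_of (u, v') \<in> carrier F" "frag_of (u, v \<oplus>\<^bsub>N\<^esub> v') \<in> carrier F"
      using assms keys_add[of "frag_of (u, v)" "frag_of (u, v')"] by (auto simp: keys_frag_of)
    moreover have "frag_of (u, v \<oplus>\<^bsub>N\<^esub> v') - (frag_of (u, v) + frag_of (u, v')) \<in> K"
      by (rule tensor_rels_in_kernel) (use assms in \<open>auto simp: tensor_rels_def algebra_simps\<close>)
    ultimately show ?thesis
      unfolding tens_def by (metis coset_eqI)
  qed
  finally show ?thesis ..
qed

lemma tens_balanced: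
  assumes "u \<in> carrier M" "s \<in> carrier S" "v \<in> carrier N"
  shows "tens S M N (ract M u s) v = tens S M N u (lact N s v)"
  unfolding tens_def
proof (rule coset_eqI)
  show "frag_of (ract M u s, v) - frag_of (u, lact N s v) \<in> K"
    by (rule tensor_rels_in_kernel) (use assms in \<open>auto simp: tensor_rels_def\<close>)
qed (use assms ract_closed' lact_closed' in auto)

text \<open>Composing with the projection gives two homomorphisms on the free abelian group, and
  these are compared on generators.\<close>

lemma tensor_hom_eqI:
  assumes h: "h \<in> hom T H" and k: "k \<in> hom T H" and H: "group H"
    and eq: "\<And>u v. \<lbrakk>u \<in> carrier M; v \<in> carrier N\<rbrakk> \<Longrightarrow> h (tens S M N u v) = k (tens S M N u v)"
    and X: "X \<in> carrier T"
  shows "h X = k X"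
proof -
  interpret H: group H by (rule H)
  interpret F: group F by simp
  have hh: "(\<lambda>c. h (K #>\<^bsub>F\<^esub> c)) \<in> hom F H" and kk: "(\<lambda>c. k (K #>\<^bsub>F\<^esub> c)) \<in> hom F H"
    using hom_compose[OF proj_hom h] hom_compose[OF proj_hom k] by (simp_all add: o_def)
  interpret hh: group_hom F H "\<lambda>c. h (K #>\<^bsub>F\<^esub> c)" by unfold_locales (rule hh)
  interpret kk: group_hom F H "\<lambda>c. k (K #>\<^bsub>F\<^esub> c)" by unfold_locales (rule kk)
  have "h (K #>\<^bsub>F\<^esub> c) = k (K #>\<^bsub>F\<^esub> c)" if "Poly_Mapping.keys c \<subseteq> carrier M \<times> carrier N" for c
    using that
  proof (induction c rule: free_Abelian_group_induct[consumes 1])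
    case 1
    then show ?case using hh.hom_one kk.hom_one by simp
  next
    case (2 c d)
    have "c - d = c \<otimes>\<^bsub>F\<^esub> inv\<^bsub>F\<^esub> d" using 2 by simp
    moreover have "inv\<^bsub>F\<^esub> d \<in> carrier F" using 2 by (intro F.inv_closed) simp
    ultimately show ?case
      using 2 by (simp only: hh.hom_mult kk.hom_mult hh.hom_inv kk.hom_inv carrier_free_Abelian_group_iff)
  next
    case (3 a)
    then show ?case using eq by (auto simp: tens_def)
  qed
  then show ?thesis
    using X by (auto simp: carrier_tensor)
qed

text \<open>Every tensor is a sum of elementary ones, the signs being absorbed by the first factor.\<close>

lemma tensor_induct [consumes 1, case_names tens mult]:
  assumes X: "X \<in> carrier T"
    and tens: "\<And>u v. \<lbrakk>u \<in> carrier M; v \<in> carrier N\<rbrakk> \<Longrightarrow> P (tens S M N u v)"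
    and mult: "\<And>X Y. \<lbrakk>X \<in> carrier T; Y \<in> carrier T; P X; P Y\<rbrakk> \<Longrightarrow> P (X \<otimes>\<^bsub>T\<^esub> Y)"
  shows "P X"
proof -
  interpret T: comm_group T by (rule comm_group_tensor)
  interpret F: comm_group F by (rule abelian_free_Abelian_group)
  interpret p: group_hom F T "\<lambda>c. K #>\<^bsub>F\<^esub> c" by unfold_locales (rule proj_hom)
  have zero: "tens S M N \<zero>\<^bsub>M\<^esub> v = \<one>\<^bsub>T\<^esub>" if "v \<in> carrier N" for v
    using tens_add_left[of "\<zero>\<^bsub>M\<^esub>" "\<zero>\<^bsub>M\<^esub>" v] tens_closed[of "\<zero>\<^bsub>M\<^esub>" v] that
    by (simp add: T.l_cancel_one')
  have neg: "tens S M N (\<ominus>\<^bsub>M\<^esub> u) v = inv\<^bsub>T\<^esub> (tens S M N u v)"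
    if "u \<in> carrier M" "v \<in> carrier N" for u v
    using tens_add_left[of "\<ominus>\<^bsub>M\<^esub> u" u v] zero[of v] tens_closed that
    by (metis M.a_inv_closed M.l_neg T.inv_equality)
  \<comment> \<open>The inverse is carried along because the induction rule for the free abelian
    group builds differences.\<close>
  have "P (K #>\<^bsub>F\<^esub> c) \<and> P (inv\<^bsub>T\<^esub> (K #>\<^bsub>F\<^esub> c))"
    if "Poly_Mapping.keys c \<subseteq> carrier M \<times> carrier N" for c
    using that
  proof (induction c rule: free_Abelian_group_induct[consumes 1])
    case 1
    have "P \<one>\<^bsub>T\<^esub>"
      using tens[of "\<zero>\<^bsub>M\<^esub>" "\<zero>\<^bsub>N\<^esub>"] zero by simp
    then show ?case using p.hom_one by simp
  next
    case (2 c d)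
    have "c - d = c \<otimes>\<^bsub>F\<^esub> inv\<^bsub>F\<^esub> d" using 2 by simp
    moreover have "inv\<^bsub>F\<^esub> d \<in> carrier F" "c \<in> carrier F" "d \<in> carrier F"
      using 2 by simp_all
    ultimately have "K #>\<^bsub>F\<^esub> (c - d) = (K #>\<^bsub>F\<^esub> c) \<otimes>\<^bsub>T\<^esub> inv\<^bsub>T\<^esub> (K #>\<^bsub>F\<^esub> d)"
      "inv\<^bsub>T\<^esub> (K #>\<^bsub>F\<^esub> (c - d)) = inv\<^bsub>T\<^esub> (K #>\<^bsub>F\<^esub> c) \<otimes>\<^bsub>T\<^esub> (K #>\<^bsub>F\<^esub> d)"
      by (simp_all only: p.hom_mult p.hom_inv T.inv_mult p.hom_closed T.inv_closed T.inv_inv)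
    then show ?case
      using 2 mult \<open>c \<in> carrier F\<close> \<open>d \<in> carrier F\<close>
      by (simp del: inv_free_Abelian_group carrier_free_Abelian_group_iff)
  next
    case (3 a)
    then obtain u v where a: "a = (u, v)" "u \<in> carrier M" "v \<in> carrier N" by auto
    then show ?case
      using tens[of u v] tens[of "\<ominus>\<^bsub>M\<^esub> u" v] neg[of u v] by (simp add: tens_def)
  qed
  then show ?thesis
    using X by (auto simp: carrier_tensor)
qed

text \<open>The universal property: the defining relations go to the identity of \<open>H\<close>,
  so the homomorphism from the free abelian group is constant on cosets of \<open>K\<close>.\<close>

lemma
  assumes H: "comm_group H"
    and closed: "\<And>u v. \<lbrakk>u \<in> carrier M; v \<in> carrier N\<rbrakk> \<Longrightarrow> f u v \<in> carrier H"
    and add_left: "\<And>u u' v. \<lbrakk>u \<in> carrier M; u' \<in> carrier M; v \<in> carrier N\<rbrakk> \<Longrightarrow>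
      f (u \<oplus>\<^bsub>M\<^esub> u') v = f u v \<otimes>\<^bsub>H\<^esub> f u' v"
    and add_right: "\<And>u v v'. \<lbrakk>u \<in> carrier M; v \<in> carrier N; v' \<in> carrier N\<rbrakk> \<Longrightarrow>
      f u (v \<oplus>\<^bsub>N\<^esub> v') = f u v \<otimes>\<^bsub>H\<^esub> f u v'"
    and balanced: "\<And>u s v. \<lbrakk>u \<in> carrier M; s \<in> carrier S; v \<in> carrier N\<rbrakk> \<Longrightarrow>
      f (ract M u s) v = f u (lact N s v)"
  shows tensor_lift_hom: "tensor_lift H f \<in> hom T H"
    and tensor_lift_tens:
      "\<lbrakk>u \<in> carrier M; v \<in> carrier N\<rbrakk> \<Longrightarrow> tensor_lift H f (tens S M N u v) = f u v"
proof -
  interpret H: comm_group H by (rule H)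
  interpret F: comm_group F by (rule abelian_free_Abelian_group)
  define \<phi> where "\<phi> c = (\<Otimes>\<^bsub>H\<^esub>k\<in>Poly_Mapping.keys c.
     f (fst k) (snd k) [^]\<^bsub>H\<^esub> Poly_Mapping.lookup c k)" for c :: "'u \<times> 'v \<Rightarrow>\<^sub>0 int"
  have hom: "\<phi> \<in> hom F H"
    unfolding \<phi>_def by (rule H.frag_finprod_hom) (use closed in auto)
  interpret \<phi>: group_hom F H \<phi> by unfold_locales (rule hom)
  have frag: "\<phi> (frag_of (u, v)) = f u v" if "u \<in> carrier M" "v \<in> carrier N" for u v
    using closed[OF that] by (simp add: \<phi>_def keys_frag_of H.finprod_singleton_swap)
  have diff: "\<phi> (c - d) = \<phi> c \<otimes>\<^bsub>H\<^esub> inv\<^bsub>H\<^esub> \<phi> d" if "c \<in> carrier F" "d \<in> carrier F" for c d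
    using \<phi>.hom_mult[of c "inv\<^bsub>F\<^esub> d"] \<phi>.hom_inv[of d] that by simp
  have diff_closed: "c - d \<in> carrier F" if "c \<in> carrier F" "d \<in> carrier F" for c d
    using that keys_diff[of c d] by auto
  have mult_inv4: "a \<otimes>\<^bsub>H\<^esub> (b \<otimes>\<^bsub>H\<^esub> (inv\<^bsub>H\<^esub> a \<otimes>\<^bsub>H\<^esub> inv\<^bsub>H\<^esub> b)) = \<one>\<^bsub>H\<^esub>"
    if "a \<in> carrier H" "b \<in> carrier H" for a b
    using that by (metis H.inv_closed H.inv_mult H.m_assoc H.m_closed H.r_inv)
  have "tensor_rels S M N \<subseteq> kernel F H \<phi>"
  proof
    fix r assume r: "r \<in> tensor_rels S M N"
    then have "r \<in> carrier F" using tensor_rels_subset by blast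
    moreover from r have "\<phi> r = \<one>\<^bsub>H\<^esub>"
      unfolding tensor_rels_def
      by (auto simp: diff diff_closed frag add_left add_right balanced closed ract_closed'
          lact_closed' H.m_assoc mult_inv4
          simp del: carrier_free_Abelian_group_iff)
    ultimately show "r \<in> kernel F H \<phi>" by (simp add: kernel_def)
  qed
  then have K: "K \<subseteq> kernel F H \<phi>"
    unfolding tensor_kernel_def
    by (rule F.generate_subgroup_incl) (rule \<phi>.subgroup_kernel)
  have lift: "tensor_lift H f (K #>\<^bsub>F\<^esub> c) = \<phi> c" if c: "c \<in> carrier F" for c
  proof -
    \<comment> \<open>The image of a coset is a singleton; this is what \<open>the_elem\<close> in
      the definition of \<open>tensor_lift\<close> reads off.\<close>
    have "\<phi> ` (K #>\<^bsub>F\<^esub> c) = {\<phi> c}"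
    proof -
      have "\<phi> (k \<otimes>\<^bsub>F\<^esub> c) = \<phi> c" if "k \<in> K" for k
        using that K c \<phi>.hom_mult[of k c] \<phi>.hom_closed[of c] by (auto simp: kernel_def)
      moreover have "\<one>\<^bsub>F\<^esub> \<in> K"
        by (rule subgroup.one_closed[OF subgroup_tensor_kernel])
      ultimately show ?thesis
        unfolding r_coset_def by (auto simp only: image_UN image_insert image_empty cong: SUP_cong_simp)
    qed
    then show ?thesis
      by (simp add: tensor_lift_def \<phi>_def[symmetric])
  qed
  show "tensor_lift H f \<in> hom T H"
  proof (rule homI)
    fix X Y assume "X \<in> carrier T" "Y \<in> carrier T"
    then obtain c d where c: "c \<in> carrier F" "X = K #>\<^bsub>F\<^esub> c" and d: "d \<in> carrier F" "Y = K #>\<^bsub>F\<^esub> d"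
      by (auto simp: carrier_tensor)
    show "tensor_lift H f X \<in> carrier H"
      using c lift[of c] \<phi>.hom_closed[of c] by simp
    have "X \<otimes>\<^bsub>T\<^esub> Y = K #>\<^bsub>F\<^esub> (c \<otimes>\<^bsub>F\<^esub> d)"
      using c d hom_mult[OF proj_hom, of c d] by simp
    then show "tensor_lift H f (X \<otimes>\<^bsub>T\<^esub> Y) = tensor_lift H f X \<otimes>\<^bsub>H\<^esub> tensor_lift H f Y"
      using c d lift[of c] lift[of d] lift[of "c \<otimes>\<^bsub>F\<^esub> d"] F.m_closed[of c d] \<phi>.hom_mult[of c d]
      by (simp del: mult_free_Abelian_group carrier_free_Abelian_group_iff)
  qed
  show "tensor_lift H f (tens S M N u v) = f u v" if "u \<in> carrier M" "v \<in> carrier N"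
    unfolding tens_def using that by (subst lift) (simp_all add: frag)
qed

end

section \<open>Strictness of a Morita context\<close>

context morita_context
begin

sublocale SUV: tensor_pair S U V
  by unfold_locales (auto intro: U.ract_closed V.lact_closed)

text \<open>The axioms are symmetric in the two rings, so each fact about \<mu> is also one about
  \<nu>.\<close>

lemma swap: "morita_context S R V U \<nu> \<mu>"
  by (intro morita_context.intro morita_context_axioms.intro U.bimodule_axioms V.bimodule_axioms;
      simp add: mu_hom mu_left mu_right nu_hom nu_left nu_right mu_nu nu_mu)

text \<open>
  If \<open>\<mu> W = 1\<close>, then \<open>X = X \<cdot> \<mu> W = \<mu> X \<cdot> W\<close> for every tensor \<open>X\<close>, where \<open>R\<close> acts on both ends of
  the tensor product; so \<open>\<mu> X\<close> determines \<open>X\<close>.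
\<close>

lemma mu_inj_if_surj:
  assumes "\<one>\<^bsub>R\<^esub> \<in> \<mu> ` carrier (tensor S U V)"
  shows "inj_on \<mu> (carrier (tensor S U V))"
proof -
  interpret T: comm_group "tensor S U V" by (rule SUV.comm_group_tensor)
  obtain W where W: "W \<in> carrier (tensor S U V)" "\<mu> W = \<one>\<^bsub>R\<^esub>"
    using assms by auto
  \<comment> \<open>The left action of \<open>R\<close> on the tensor product, through the first
    factor.\<close>
  define L where "L r = tensor_lift (tensor S U V) (\<lambda>u v. tens S U V (lact U r u) v)" for r
  have mu_closed: "\<mu> X \<in> carrier R" if "X \<in> carrier (tensor S U V)" for X
    using mu_hom that by (auto simp: hom_def)
  have L_hom: "L r \<in> hom (tensor S U V) (tensor S U V)"
    and L_tens: "\<lbrakk>u \<in> carrier U; v \<in> carrier V\<rbrakk> \<Longrightarrow> L r (tens S U V u v) = tens S U V (lact U r u) v"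
    if r: "r \<in> carrier R" for r u v
  proof -
    let ?f = "\<lambda>u v. tens S U V (lact U r u) v"
    have "?f u v \<in> carrier (tensor S U V)" if "u \<in> carrier U" "v \<in> carrier V" for u v
      using that r by (simp add: SUV.tens_closed U.lact_closed)
    moreover have "?f (u \<oplus>\<^bsub>U\<^esub> u') v = ?f u v \<otimes>\<^bsub>tensor S U V\<^esub> ?f u' v"
      if "u \<in> carrier U" "u' \<in> carrier U" "v \<in> carrier V" for u u' v
      using that r by (simp add: U.lact_add_right U.lact_closed SUV.tens_add_left)
    moreover have "?f u (v \<oplus>\<^bsub>V\<^esub> v') = ?f u v \<otimes>\<^bsub>tensor S U V\<^esub> ?f u v'"
      if "u \<in> carrier U" "v \<in> carrier V" "v' \<in> carrier V" for u v v'
      using that r by (simp add: U.lact_closed SUV.tens_add_right)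
    moreover have "?f (ract U u s) v = ?f u (lact V s v)"
      if "u \<in> carrier U" "s \<in> carrier S" "v \<in> carrier V" for u s v
      using that r U.lact_ract[of r s u, symmetric] by (simp add: U.lact_closed SUV.tens_balanced)
    ultimately show "L r \<in> hom (tensor S U V) (tensor S U V)"
      and "\<lbrakk>u \<in> carrier U; v \<in> carrier V\<rbrakk> \<Longrightarrow> L r (tens S U V u v) = tens S U V (lact U r u) v"
      unfolding L_def
      using SUV.tensor_lift_hom[OF SUV.comm_group_tensor, of ?f]
        SUV.tensor_lift_tens[OF SUV.comm_group_tensor, of ?f u v]
      by simp_all
  qed
  have L_closed: "L r X \<in> carrier (tensor S U V)" if "r \<in> carrier R" "X \<in> carrier (tensor S U V)" for r X
    using L_hom[OF that(1)] that(2) by (auto simp: hom_def)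
  have L_add: "L (r \<oplus>\<^bsub>R\<^esub> r') X = L r X \<otimes>\<^bsub>tensor S U V\<^esub> L r' X"
    if r: "r \<in> carrier R" "r' \<in> carrier R" and X: "X \<in> carrier (tensor S U V)" for r r' X
  proof (rule SUV.tensor_hom_eqI[OF _ _ T.is_group _ X])
    show "L (r \<oplus>\<^bsub>R\<^esub> r') \<in> hom (tensor S U V) (tensor S U V)"
      using r by (intro L_hom) auto
    show "(\<lambda>X. L r X \<otimes>\<^bsub>tensor S U V\<^esub> L r' X) \<in> hom (tensor S U V) (tensor S U V)"
      using r L_closed hom_mult[OF L_hom[OF r(1)]] hom_mult[OF L_hom[OF r(2)]]
      by (intro homI) (auto simp: T.m_ac)
  qed (use r in \<open>auto simp: L_tens U.lact_add_left SUV.tens_add_left U.lact_closed\<close>)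
  \<comment> \<open>For elementary \<open>X\<close> = u' (x) v' the computation is u (x) v \<mu>(u'
    (x) v') = u (x) \<nu>(v (x) u') v' = u \<nu>(v (x) u') (x) v' = \<mu>(u (x) v) u' (x) v', by
    both compatibility laws and balancedness.\<close>
  have elem: "tens S U V u (ract V v (\<mu> X)) = L (\<mu> (tens S U V u v)) X"
    if uv: "u \<in> carrier U" "v \<in> carrier V" and X: "X \<in> carrier (tensor S U V)" for u v X
  proof (rule SUV.tensor_hom_eqI[OF _ _ T.is_group _ X])
    show "(\<lambda>X. tens S U V u (ract V v (\<mu> X))) \<in> hom (tensor S U V) (tensor S U V)"
      using uv mu_closed hom_mult[OF mu_hom]
      by (intro homI) (auto simp: V.ract_closed V.ract_add_right SUV.tens_add_right SUV.tens_closed)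
    show "L (\<mu> (tens S U V u v)) \<in> hom (tensor S U V) (tensor S U V)"
      using uv by (intro L_hom mu_closed SUV.tens_closed)
    fix u' v' assume u'v': "u' \<in> carrier U" "v' \<in> carrier V"
    interpret M': morita_context S R V U \<nu> \<mu> by (rule swap)
    have nu: "\<nu> (tens R V U v u') \<in> carrier S"
      using nu_hom M'.SUV.tens_closed[of v u'] uv u'v' by (auto simp: hom_def)
    show "tens S U V u (ract V v (\<mu> (tens S U V u' v'))) = L (\<mu> (tens S U V u v)) (tens S U V u' v')"
      using uv u'v' nu mu_closed
      by (simp add: L_tens nu_mu SUV.tens_closed SUV.tens_balanced[symmetric] mu_nu)
  qed
  \<comment> \<open>Both sides are additive in \<open>X\<close>; on u (x) v the equation is
    \<open>elem\<close> for \<open>W\<close>, since v \<mu>(W) = v.\<close>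
  have eq: "X = L (\<mu> X) W" if X: "X \<in> carrier (tensor S U V)" for X
  proof (rule SUV.tensor_hom_eqI[OF _ _ T.is_group _ X, of "\<lambda>X. X"])
    show "(\<lambda>X. L (\<mu> X) W) \<in> hom (tensor S U V) (tensor S U V)"
      using W hom_mult[OF mu_hom] by (intro homI) (auto simp: L_add mu_closed L_closed)
  qed (use W elem in \<open>force simp: hom_def V.ract_one\<close>)+
  show ?thesis
    by (rule inj_onI) (metis eq)
qed

lemma mu_surj_if_one:
  assumes "\<one>\<^bsub>R\<^esub> \<in> \<mu> ` carrier (tensor S U V)"
  shows "\<mu> ` carrier (tensor S U V) = carrier R"
proof -
  interpret T: comm_group "tensor S U V" by (rule SUV.comm_group_tensor)
  have mu_closed: "\<mu> X \<in> carrier R" if "X \<in> carrier (tensor S U V)" for X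
    using mu_hom that by (auto simp: hom_def)
  \<comment> \<open>An elementary tensor takes \<open>r\<close> into its first entry, and sums
    follow by distributivity.\<close>
  have left: "r \<otimes>\<^bsub>R\<^esub> \<mu> X \<in> \<mu> ` carrier (tensor S U V)"
    if "X \<in> carrier (tensor S U V)" "r \<in> carrier R" for r X
    using that
  proof (induction rule: SUV.tensor_induct)
    case (tens u v)
    then show ?case
      using mu_left[of r u v] SUV.tens_closed[of "lact U r u" v] U.lact_closed[of r u]
      by (metis imageI)
  next
    case (mult X Y)
    then obtain X' Y' where XY': "X' \<in> carrier (tensor S U V)" "r \<otimes>\<^bsub>R\<^esub> \<mu> X = \<mu> X'"
      "Y' \<in> carrier (tensor S U V)" "r \<otimes>\<^bsub>R\<^esub> \<mu> Y = \<mu> Y'"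
      by (auto simp: image_iff)
    with mult have "r \<otimes>\<^bsub>R\<^esub> \<mu> (X \<otimes>\<^bsub>tensor S U V\<^esub> Y) = \<mu> (X' \<otimes>\<^bsub>tensor S U V\<^esub> Y')"
      using hom_mult[OF mu_hom] mu_closed by (simp add: U.R.r_distr)
    with XY' show ?case by auto
  qed
  obtain W where "W \<in> carrier (tensor S U V)" "\<mu> W = \<one>\<^bsub>R\<^esub>"
    using assms by auto
  then have "r \<in> \<mu> ` carrier (tensor S U V)" if "r \<in> carrier R" for r
    using left[of W r] that by simp
  then show ?thesis
    using mu_closed by blast
qed

lemma mu_iso_if_one:
  assumes "\<one>\<^bsub>R\<^esub> \<in> \<mu> ` carrier (tensor S U V)"
  shows "\<mu> \<in> iso (tensor S U V) (add_monoid R)"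
  using mu_hom mu_inj_if_surj[OF assms] mu_surj_if_one[OF assms] by (simp add: iso_def bij_betw_def)

lemma strict_iff:
  "strict_morita_context R S U V \<mu> \<nu> \<longleftrightarrow>
     \<one>\<^bsub>R\<^esub> \<in> \<mu> ` carrier (tensor S U V) \<and> \<one>\<^bsub>S\<^esub> \<in> \<nu> ` carrier (tensor R V U)"
proof -
  interpret M': morita_context S R V U \<nu> \<mu> by (rule swap)
  show ?thesis
    unfolding strict_morita_context_def strict_morita_context_axioms_def
    using mu_iso_if_one M'.mu_iso_if_one morita_context_axioms
    by (auto simp: iso_def bij_betw_def)
qed

end

section \<open>Unital partial actions of groupoids\<close>

context groupoid
begin

text \<open>\<open>ginv\<close> is a definite description. A left inverse h equals every right
  inverse k, since k = (hg)k = h(gk) = h, and this settles uniqueness.\<close>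

lemma ginv_unique:
  assumes g: "g \<in> carrier G" and h: "h \<in> carrier G" "src G h = tgt G g" "tgt G h = src G g"
    "cmp G h g = src G g"
  shows "ginv G g = h"
proof -
  have eq: "k = h" if k: "k \<in> carrier G" "src G k = tgt G g" "tgt G k = src G g" "cmp G g k = tgt G g" for k
  proof -
    have "k = cmp G (cmp G h g) k" using g h k by (metis tgt_cmp_id)
    also have "\<dots> = cmp G h (cmp G g k)" using g h(1,2,3) k(1-3) by (intro cmp_assoc) auto
    also have "\<dots> = h" using h k by (metis cmp_src)
    finally show ?thesis .
  qed
  obtain k where k: "k \<in> carrier G" "src G k = tgt G g" "tgt G k = src G g"
      "cmp G k g = src G g" "cmp G g k = tgt G g"
    using inverse_ex[OF g] by blast
  with eq[of k] have "h = k" by simp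
  with k show ?thesis
    unfolding ginv_def using eq by (intro the_equality) auto
qed

lemma
  assumes g: "g \<in> carrier G"
  shows ginv_closed [simp]: "ginv G g \<in> carrier G"
    and src_ginv [simp]: "src G (ginv G g) = tgt G g"
    and tgt_ginv [simp]: "tgt G (ginv G g) = src G g"
    and ginv_cmp_self: "cmp G (ginv G g) g = src G g"
    and cmp_ginv_self: "cmp G g (ginv G g) = tgt G g"
proof -
  obtain k where k: "k \<in> carrier G" "src G k = tgt G g" "tgt G k = src G g"
      "cmp G k g = src G g" "cmp G g k = tgt G g"
    using inverse_ex[OF g] by blast
  moreover from this have "ginv G g = k"
    using ginv_unique[OF g] by blast
  ultimately show "ginv G g \<in> carrier G" "src G (ginv G g) = tgt G g" "tgt G (ginv G g) = src G g"
    "cmp G (ginv G g) g = src G g" "cmp G g (ginv G g) = tgt G g"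
    by simp_all
qed

lemma ginv_ginv [simp]: "g \<in> carrier G \<Longrightarrow> ginv G (ginv G g) = g"
  by (rule ginv_unique) (simp_all add: cmp_ginv_self)

lemma objsD [simp]: "y \<in> objs G \<Longrightarrow> y \<in> carrier G" "y \<in> objs G \<Longrightarrow> src G y = y" "y \<in> objs G \<Longrightarrow> tgt G y = y"
  by (simp_all add: objs_def)

lemma src_in_objs [simp]: "g \<in> carrier G \<Longrightarrow> src G g \<in> objs G"
  and tgt_in_objs [simp]: "g \<in> carrier G \<Longrightarrow> tgt G g \<in> objs G"
  by (simp_all add: objs_def src_closed tgt_closed src_src src_tgt tgt_src tgt_tgt del: objsD)

lemma cmp_obj_left: "\<lbrakk>g \<in> carrier G; y \<in> objs G; y = tgt G g\<rbrakk> \<Longrightarrow> cmp G y g = g"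
  by (simp add: tgt_cmp_id)

lemma cmp_obj_right: "\<lbrakk>g \<in> carrier G; y \<in> objs G; src G g = y\<rbrakk> \<Longrightarrow> cmp G g y = g"
  using cmp_src by auto

lemma ginv_obj [simp]: "y \<in> objs G \<Longrightarrow> ginv G y = y"
  by (rule ginv_unique) (simp_all add: cmp_obj_left)

lemma cmp_ginv_cancel [simp]:
  "\<lbrakk>g \<in> carrier G; h \<in> carrier G; src G g = tgt G h\<rbrakk> \<Longrightarrow> cmp G (ginv G g) (cmp G g h) = h"
  by (simp add: cmp_assoc[symmetric] ginv_cmp_self tgt_cmp_id)

lemma cmp_cancel_ginv [simp]:
  "\<lbrakk>g \<in> carrier G; h \<in> carrier G; tgt G g = tgt G h\<rbrakk> \<Longrightarrow> cmp G g (cmp G (ginv G g) h) = h"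
  by (simp add: cmp_assoc[symmetric] cmp_ginv_self tgt_cmp_id)

lemma cmp_cmp_ginv [simp]:
  "\<lbrakk>g \<in> carrier G; h \<in> carrier G; src G g = tgt G h\<rbrakk> \<Longrightarrow> cmp G (cmp G g h) (ginv G h) = g"
  by (simp add: cmp_assoc cmp_ginv_self cmp_obj_right)

lemma cmp_ginv_cmp [simp]:
  "\<lbrakk>g \<in> carrier G; h \<in> carrier G; src G g = src G h\<rbrakk> \<Longrightarrow> cmp G (cmp G g (ginv G h)) h = g"
  by (simp add: cmp_assoc ginv_cmp_self cmp_obj_right)

lemma ginv_cmp:
  assumes "g \<in> carrier G" "h \<in> carrier G" "src G g = tgt G h"
  shows "ginv G (cmp G g h) = cmp G (ginv G h) (ginv G g)"
  by (rule ginv_unique)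
    (use assms in \<open>simp_all add: cmp_closed src_cmp tgt_cmp cmp_assoc ginv_cmp_self\<close>)

end

lemma is_unity_unique: "\<lbrakk>is_unity R e; is_unity R e'\<rbrakk> \<Longrightarrow> e = e'"
  unfolding is_unity_def by metis

lemma unity_eqI: "is_unity R e \<Longrightarrow> unity R = e"
  unfolding unity_def by (blast intro: is_unity_unique)

lemma is_ideal_addD: "\<lbrakk>is_ideal J R; a \<in> J; b \<in> J\<rbrakk> \<Longrightarrow> a + b \<in> J"
  unfolding is_ideal_def by (metis diff_0 diff_minus_eq_add)

text \<open>Being an ideal is not transitive in general. Here the identity \<open>e\<close> of
  \<open>J\<close> helps: \<open>r * k = (r * e) * k\<close> with \<open>r * e\<close> in
  \<open>J\<close>.\<close>

lemma is_ideal_unity_trans: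
  assumes J: "is_ideal J R" "is_unity J e" and K: "is_ideal K J"
  shows "is_ideal K R"
proof -
  have "r * k \<in> K \<and> k * r \<in> K" if "r \<in> R" "k \<in> K" for r k
  proof -
    have "k \<in> J" using K that by (auto simp: is_ideal_def)
    then have k: "e * k = k" "k * e = k" using J by (auto simp: is_unity_def)
    have "r * e \<in> J" "e * r \<in> J" using J that by (auto simp: is_ideal_def is_unity_def)
    then have "(r * e) * k \<in> K" "k * (e * r) \<in> K" using K that by (auto simp: is_ideal_def)
    moreover have "(r * e) * k = r * k" "k * (e * r) = k * r"
      by (simp add: mult.assoc k(1), simp add: mult.assoc[symmetric] k(2))
    ultimately show ?thesis by simp
  qed
  then show ?thesis using assms by (auto simp: is_ideal_def)
qed

text \<open>The common setting of \<open>G\<close> acting on \<open>A\<close> and of the isotropy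
  group acting on its ideal at \<open>x\<close>; the results are applied to both. Since
  \<open>A\<close> is a subset of a type, \<open>is_ideal A A\<close> says that it is a
  subring.\<close>

locale unital_action = groupoid G for G :: "('g, 'm) groupoid_scheme" +
  fixes A :: "'a::ring set" and \<alpha> :: "'g \<Rightarrow> 'a \<rightharpoonup> 'a"
  assumes finite_G: "finite (carrier G)"
    and subring_A: "is_ideal A A"
    and action: "partial_action G A \<alpha>"
    and unital: "g \<in> carrier G \<Longrightarrow> unital_ring (ran (\<alpha> g))"
    and sum_A: "direct_sum (objs G) (\<lambda>y. ran (\<alpha> y)) A"
begin

abbreviation "B g \<equiv> ran (\<alpha> g)"
abbreviation "e \<equiv> idem \<alpha>"
abbreviation "\<phi> \<equiv> act G \<alpha>"

lemma finite_objs [simp]: "finite (objs G)"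
  using finite_G by (rule finite_subset[rotated]) auto

lemma A_closed [simp]:
  "0 \<in> A" "\<lbrakk>a \<in> A; b \<in> A\<rbrakk> \<Longrightarrow> a - b \<in> A" "\<lbrakk>a \<in> A; b \<in> A\<rbrakk> \<Longrightarrow> a * b \<in> A"
  "\<lbrakk>a \<in> A; b \<in> A\<rbrakk> \<Longrightarrow> a + b \<in> A"
  using subring_A is_ideal_addD[OF subring_A] by (auto simp: is_ideal_def)

lemma uminus_closed [simp]: "a \<in> A \<Longrightarrow> - a \<in> A"
  using A_closed(2)[of 0 a] by simp

lemma sum_closed [simp]: "(\<And>i. i \<in> J \<Longrightarrow> f i \<in> A) \<Longrightarrow> sum f J \<in> A"
  by (induction J rule: infinite_finite_induct) auto

lemma e_unity: "g \<in> carrier G \<Longrightarrow> is_unity (B g) (e g)"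
  using unital[of g] unity_eqI by (auto simp: unital_ring_def idem_def)

lemma ideal_B:
  assumes "g \<in> carrier G"
  shows "is_ideal (B g) A"
  using action assms is_ideal_unity_trans[OF _ e_unity, of "tgt G g" A "B g"]
  by (simp add: partial_action_def)

lemma B_sub_A: "\<lbrakk>g \<in> carrier G; b \<in> B g\<rbrakk> \<Longrightarrow> b \<in> A"
  using ideal_B[of g] by (auto simp: is_ideal_def)

lemma e_in_B: "g \<in> carrier G \<Longrightarrow> e g \<in> B g"
  using e_unity by (auto simp: is_unity_def)

lemma e_closed [simp]: "g \<in> carrier G \<Longrightarrow> e g \<in> A"
  using e_in_B B_sub_A by blast

lemma mult_in_B:
  assumes "g \<in> carrier G" "a \<in> A" "b \<in> B g"
  shows "a * b \<in> B g" "b * a \<in> B g"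
  using ideal_B[of g] assms by (auto simp: is_ideal_def)

text \<open>Both products lie in the ideal \<open>B g\<close>, so both are equal to
  \<open>e g * a * e g\<close>.\<close>

lemma e_central:
  assumes "g \<in> carrier G" "a \<in> A"
  shows "e g * a = a * e g"
proof -
  have "e g * a \<in> B g" "a * e g \<in> B g"
    using assms mult_in_B e_in_B by auto
  then show ?thesis
    using e_unity[OF assms(1)] mult.assoc[of "e g" a "e g"] by (simp add: is_unity_def)
qed

lemma B_absorb: "\<lbrakk>g \<in> carrier G; b \<in> B g\<rbrakk> \<Longrightarrow> b * e g = b"
  using e_unity by (auto simp: is_unity_def)

lemma e_idem [simp]: "g \<in> carrier G \<Longrightarrow> e g * e g = e g"
  using B_absorb e_in_B by blast

lemma mult_e:
  assumes "g \<in> carrier G" "b \<in> A"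
  shows "a * e g * (b * e g) = a * b * e g"
proof -
  have "a * e g * (b * e g) = a * (e g * b) * e g" by (simp only: mult.assoc)
  also have "\<dots> = a * b * (e g * e g)" using assms by (simp only: e_central mult.assoc)
  finally show ?thesis using assms by simp
qed

lemma e_e_central:
  assumes "g \<in> carrier G" "h \<in> carrier G" "a \<in> A"
  shows "e g * e h * a = a * (e g * e h)"
proof -
  have "e g * e h * a = e g * (a * e h)" using assms by (simp only: e_central mult.assoc)
  also have "\<dots> = a * (e g * e h)"
    using e_central[of g a] assms by (simp only: mult.assoc[symmetric])
  finally show ?thesis .
qed

lemma e_tgt [simp]:
  assumes "g \<in> carrier G"
  shows "e g * e (tgt G g) = e g"
proof -
  have "B g \<subseteq> B (tgt G g)"
    using action assms by (auto simp: partial_action_def is_ideal_def)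
  then show ?thesis
    using assms B_absorb[of "tgt G g" "e g"] e_in_B[of g] by auto
qed

lemma iso: "g \<in> carrier G \<Longrightarrow> prng_iso (\<alpha> g) (B (ginv G g)) (B g)"
  using action by (simp add: partial_action_def)

lemma dom_eq: "g \<in> carrier G \<Longrightarrow> dom (\<alpha> g) = B (ginv G g)"
  using iso by (simp add: prng_iso_def)

lemma \<phi>_eq: "\<lbrakk>g \<in> carrier G; b \<in> B (ginv G g)\<rbrakk> \<Longrightarrow> \<phi> g b = the (\<alpha> g b)"
  by (simp add: act_def B_absorb)

lemma restrict_in_B: "\<lbrakk>g \<in> carrier G; a \<in> A\<rbrakk> \<Longrightarrow> a * e g \<in> B g"
  by (simp add: mult_in_B e_in_B)

lemma \<phi>_in_B: "\<lbrakk>g \<in> carrier G; a \<in> A\<rbrakk> \<Longrightarrow> \<phi> g a \<in> B g"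
  using iso[of g] restrict_in_B[of "ginv G g" a] by (auto simp: act_def prng_iso_def bij_betw_def)

lemma \<phi>_closed [simp]: "\<lbrakk>g \<in> carrier G; a \<in> A\<rbrakk> \<Longrightarrow> \<phi> g a \<in> A"
  using \<phi>_in_B B_sub_A by blast

lemma \<phi>_e [simp]: "\<lbrakk>g \<in> carrier G; a \<in> A\<rbrakk> \<Longrightarrow> \<phi> g a * e g = \<phi> g a"
  using \<phi>_in_B B_absorb by blast

lemma \<phi>_restrict: "g \<in> carrier G \<Longrightarrow> \<phi> g (a * e (ginv G g)) = \<phi> g a"
  by (simp add: act_def mult.assoc)

lemma \<phi>_add: "\<lbrakk>g \<in> carrier G; a \<in> A; b \<in> A\<rbrakk> \<Longrightarrow> \<phi> g (a + b) = \<phi> g a + \<phi> g b"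
  using iso[of g] by (simp add: act_def distrib_right prng_iso_def restrict_in_B)

lemma \<phi>_0 [simp]: "g \<in> carrier G \<Longrightarrow> \<phi> g 0 = 0"
  using \<phi>_add[of g 0 0] by simp

lemma \<phi>_sum:
  "\<lbrakk>g \<in> carrier G; \<And>i. i \<in> J \<Longrightarrow> f i \<in> A\<rbrakk> \<Longrightarrow> \<phi> g (sum f J) = (\<Sum>i\<in>J. \<phi> g (f i))"
  by (induction J rule: infinite_finite_induct) (auto simp: \<phi>_add)

lemma \<phi>_mult:
  assumes "g \<in> carrier G" "a \<in> A" "b \<in> A"
  shows "\<phi> g (a * b) = \<phi> g a * \<phi> g b"
proof -
  have "a * b * e (ginv G g) = (a * e (ginv G g)) * (b * e (ginv G g))"
    using assms by (simp add: mult_e)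
  then show ?thesis
    using iso[of g] assms by (simp add: act_def prng_iso_def restrict_in_B)
qed

text \<open>If \<open>a\<close> is a preimage of \<open>e g\<close>, then
  \<open>e g = \<phi> g (a * 1) = e g * \<phi> g 1\<close>, where 1 is the identity of the
  domain.\<close>

lemma \<phi>_unit:
  assumes g: "g \<in> carrier G"
  shows "\<phi> g (e (ginv G g)) = e g"
proof -
  obtain a where a: "a \<in> B (ginv G g)" "the (\<alpha> g a) = e g"
    using iso[OF g] e_in_B[OF g] by (force simp: prng_iso_def bij_betw_def)
  then have "a \<in> A" using g B_sub_A[of "ginv G g"] by simp
  have "e g = \<phi> g (a * e (ginv G g))"
    using a g by (simp add: \<phi>_restrict \<phi>_eq)
  also have "\<dots> = \<phi> g a * \<phi> g (e (ginv G g))"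
    using g \<open>a \<in> A\<close> by (simp add: \<phi>_mult)
  also have "\<dots> = \<phi> g (e (ginv G g))"
    using a g by (simp add: \<phi>_eq[of g a] e_central)
  finally show ?thesis ..
qed

lemma \<phi>_obj:
  assumes "y \<in> objs G" "a \<in> A"
  shows "\<phi> y a = a * e y"
proof -
  have "\<alpha> y = pid (B y)"
    using action assms by (simp add: partial_action_def)
  then have "\<alpha> y (a * e y) = Some (a * e y)"
    using restrict_in_B[of y a] assms by (metis objsD(1) pid_def restrict_in)
  then show ?thesis using assms by (simp add: act_def)
qed

text \<open>The extension axiom gives the value at the composite and also that \<open>b\<close> lies
  in its domain; this membership is the source of the idempotent formula
  \<open>\<phi>_idem\<close>.\<close>

lemma \<alpha>_comp:
  assumes "g \<in> carrier G" "h \<in> carrier G" "src G g = tgt G h"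
    and b: "b \<in> B (ginv G h)" "\<phi> h b \<in> B (ginv G g)"
  shows "b \<in> B (ginv G (cmp G g h))" "\<phi> (cmp G g h) b = \<phi> g (\<phi> h b)"
proof -
  obtain c where c: "\<alpha> h b = Some c"
    using b assms dom_eq[of h] by blast
  then have hb: "\<phi> h b = c" using b assms by (simp add: \<phi>_eq)
  obtain d where d: "\<alpha> g c = Some d"
    using b assms dom_eq[of g] hb by blast
  then have "\<phi> g c = d" using b assms hb by (simp add: \<phi>_eq)
  have "(\<alpha> g \<circ>\<^sub>m \<alpha> h) b = Some d" using c d by (simp add: map_comp_def)
  then have gh: "\<alpha> (cmp G g h) b = Some d"
    using action assms unfolding partial_action_def map_le_def by (metis domI)
  then show "b \<in> B (ginv G (cmp G g h))"
    using dom_eq[of "cmp G g h"] assms by (auto simp: cmp_closed)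
  then show "\<phi> (cmp G g h) b = \<phi> g (\<phi> h b)"
    using gh hb \<open>\<phi> g c = d\<close> assms by (simp add: \<phi>_eq cmp_closed)
qed

lemma \<phi>_ginv_B:
  assumes g: "g \<in> carrier G" and b: "b \<in> B (ginv G g)"
  shows "\<phi> (ginv G g) (\<phi> g b) = b"
proof -
  have "b \<in> A" using B_sub_A[of "ginv G g"] g b by simp
  have "\<phi> (cmp G (ginv G g) g) b = \<phi> (ginv G g) (\<phi> g b)"
    by (rule \<alpha>_comp) (use assms \<open>b \<in> A\<close> \<phi>_in_B in auto)
  then have "\<phi> (ginv G g) (\<phi> g b) = b * e (src G g)"
    using g \<open>b \<in> A\<close> by (simp add: ginv_cmp_self \<phi>_obj)
  also have "\<dots> = b"
    using e_tgt[of "ginv G g"] g B_absorb[of "ginv G g" b] b by (metis ginv_closed mult.assoc tgt_ginv)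
  finally show ?thesis .
qed

text \<open>
  As \<open>\<alpha>\<^bsub>k\<inverse>h\<inverse>\<^esub>\<close> extends \<open>\<alpha>\<^bsub>k\<inverse>\<^esub> \<circ> \<alpha>\<^bsub>h\<inverse>\<^esub>\<close>, the map \<open>\<alpha>\<^sub>h\<close> sends \<open>B\<^bsub>h\<inverse>\<^esub> \<inter> B\<^sub>k\<close> into \<open>B\<^sub>h \<inter> B\<^bsub>hk\<^esub>\<close>; the same
  for \<open>h\<inverse>\<close> shows that it is onto, so it matches the identities of these two rings.
\<close>

lemma \<phi>_idem:
  assumes h: "h \<in> carrier G" "k \<in> carrier G" "src G h = tgt G k"
  shows "\<phi> h (e k) = e h * e (cmp G h k)"
proof -
  have step: "\<phi> h b \<in> B (cmp G h k)"
    if h: "h \<in> carrier G" "k \<in> carrier G" "src G h = tgt G k" and b: "b \<in> B (ginv G h)" "b \<in> B k" for h k b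
  proof -
    have "\<phi> h b \<in> B (ginv G (cmp G (ginv G k) (ginv G h)))"
    proof (rule \<alpha>_comp)
      have "b \<in> A" using h b B_sub_A by blast
      then show "\<phi> h b \<in> B (ginv G (ginv G h))" using h \<phi>_in_B by simp
      show "\<phi> (ginv G h) (\<phi> h b) \<in> B (ginv G (ginv G k))"
        using h b by (simp add: \<phi>_ginv_B)
    qed (use h in auto)
    then show ?thesis using h by (simp add: ginv_cmp[symmetric] cmp_closed)
  qed
  have cl: "cmp G h k \<in> carrier G" using h by (rule cmp_closed)
  \<comment> \<open>\<open>f\<close> and \<open>f'\<close> are the identities of the two
    intersections. Fact \<open>1\<close> says that \<open>f'\<close> absorbs into
    \<open>\<phi> h f\<close>, fact \<open>2\<close> the converse; as the two commute, they are
    equal.\<close>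
  define f where "f = e (ginv G h) * e k"
  define f' where "f' = e h * e (cmp G h k)"
  have f: "f \<in> B (ginv G h)" "f \<in> B k" "f \<in> A" "f' \<in> B h" "f' \<in> B (cmp G h k)" "f' \<in> A"
    unfolding f_def f'_def using h cl by (auto simp: mult_in_B e_in_B)
  have 1: "\<phi> h f * f' = \<phi> h f"
    using step[OF h f(1,2)] \<phi>_in_B[OF h(1) f(3)] B_absorb h cl
    by (simp add: f'_def mult.assoc[symmetric])
  have "\<phi> (ginv G h) f' \<in> B k"
    using step[of "ginv G h" "cmp G h k" f'] f h cl by (simp add: tgt_cmp)
  moreover have "\<phi> (ginv G h) f' \<in> B (ginv G h)"
    using \<phi>_in_B[of "ginv G h" f'] f h by simp
  ultimately have "\<phi> (ginv G h) f' * f = \<phi> (ginv G h) f'"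
    using B_absorb h by (simp add: f_def mult.assoc[symmetric])
  then have "\<phi> h (\<phi> (ginv G h) f') * \<phi> h f = \<phi> h (\<phi> (ginv G h) f')"
    using f h by (simp flip: \<phi>_mult)
  moreover have "\<phi> h (\<phi> (ginv G h) f') = f'"
    using \<phi>_ginv_B[of "ginv G h" f'] f h by simp
  ultimately have 2: "f' * \<phi> h f = f'" by simp
  have "f' * \<phi> h f = \<phi> h f * f'"
    using f h cl unfolding f'_def by (intro e_e_central) auto
  with 1 2 have "\<phi> h f = f'" by simp
  moreover have "\<phi> h f = \<phi> h (e k)"
    using \<phi>_restrict[of h "e k"] h e_central[of "ginv G h" "e k"] by (simp add: f_def)
  ultimately show ?thesis by (simp add: f'_def)
qed

text \<open>The extension axiom speaks only about elements whose image under h lies in the domain of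
  g. The idempotent \<open>f\<close> cuts \<open>a\<close> down to such an element without changing
  \<open>\<phi> g (\<phi> h a)\<close>; pushing \<open>f\<close> through the composite leaves the
  factor \<open>e g\<close>.\<close>

lemma \<phi>_comp:
  assumes gh: "g \<in> carrier G" "h \<in> carrier G" "src G g = tgt G h" and a: "a \<in> A"
  shows "\<phi> g (\<phi> h a) = \<phi> (cmp G g h) a * e g"
proof -
  have cl: "cmp G g h \<in> carrier G" using gh by (rule cmp_closed)
  define f where "f = e (ginv G h) * e (ginv G (cmp G g h))"
  have fA: "f \<in> A" using gh cl by (simp add: f_def)
  have f: "f = \<phi> (ginv G h) (e (ginv G g))"
    using \<phi>_idem[of "ginv G h" "ginv G g"] gh by (simp add: f_def ginv_cmp)
  have hf: "\<phi> h f = e h * e (ginv G g)"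
    using \<phi>_idem[of h "ginv G (cmp G g h)"] \<phi>_restrict[of h "e (ginv G (cmp G g h))"] gh cl
      e_central[of "ginv G h" "e (ginv G (cmp G g h))"]
    by (simp add: f_def ginv_cmp src_cmp cmp_closed tgt_cmp)
  have 1: "\<phi> h (a * f) = \<phi> h a * e (ginv G g)"
    using hf gh a fA by (simp add: \<phi>_mult mult.assoc[symmetric])
  have "\<phi> g (\<phi> h a) = \<phi> g (\<phi> h (a * f))"
    using 1 gh \<phi>_restrict by simp
  also have "\<dots> = \<phi> (cmp G g h) (a * f)"
  proof (rule \<alpha>_comp(2)[symmetric])
    show "a * f \<in> B (ginv G h)"
      using a gh cl unfolding f_def by (intro mult_in_B e_in_B) auto
    show "\<phi> h (a * f) \<in> B (ginv G g)"
      using 1 a gh by (simp add: restrict_in_B)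
  qed (use gh in auto)
  also have "\<dots> = \<phi> (cmp G g h) a * \<phi> (cmp G g h) (e (ginv G h))"
    using \<phi>_restrict[of "cmp G g h" "a * e (ginv G h)"] a gh cl by (simp add: f_def mult.assoc \<phi>_mult)
  also have "\<phi> (cmp G g h) (e (ginv G h)) = e (cmp G g h) * e g"
    using \<phi>_idem[of "cmp G g h" "ginv G h"] gh cl by (simp add: src_cmp)
  finally show ?thesis
    using a gh cl by (simp add: mult.assoc[symmetric])
qed

lemma \<phi>_ginv: "\<lbrakk>g \<in> carrier G; a \<in> A\<rbrakk> \<Longrightarrow> \<phi> (ginv G g) (\<phi> g a) = a * e (ginv G g)"
  using \<phi>_ginv_B[of g "a * e (ginv G g)"] by (simp add: \<phi>_restrict restrict_in_B)

text \<open>The product lies in both \<open>B y\<close> and \<open>B z\<close>. It is thus the sum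
  of a family supported at y and of one supported at z, and uniqueness in the direct sum makes these
  families equal.\<close>

lemma e_orth_obj:
  assumes "y \<in> objs G" "z \<in> objs G" "y \<noteq> z"
  shows "e y * e z = 0"
proof -
  let ?c = "e y * e z"
  let ?f = "\<lambda>w. \<lambda>v\<in>objs G. if v = w then ?c else 0"
  have B0: "0 \<in> B w" if "w \<in> objs G" for w
    using ideal_B[of w] that by (simp add: is_ideal_def)
  have c: "?c \<in> B y" "?c \<in> B z"
    using assms by (auto simp: mult_in_B e_in_B)
  have "?f y \<in> Pi\<^sub>E (objs G) B" "?f z \<in> Pi\<^sub>E (objs G) B"
    using c B0 by auto
  moreover have "(\<Sum>v\<in>objs G. ?f w v) = ?c" if "w \<in> objs G" for w
    using that by (simp add: sum.delta)
  moreover have "inj_on (\<lambda>f. \<Sum>v\<in>objs G. f v) (Pi\<^sub>E (objs G) B)"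
    using sum_A by (simp add: direct_sum_def bij_betw_def)
  ultimately have "?f y = ?f z"
    using assms(1,2) by (simp only: inj_on_eq_iff[symmetric])
  from fun_cong[OF this, of y] show ?thesis
    using assms by simp
qed

lemma e_orth:
  assumes "g \<in> carrier G" "h \<in> carrier G" "tgt G g \<noteq> tgt G h"
  shows "e g * e h = 0"
proof -
  have "e g * e h = e g * e (tgt G g) * (e h * e (tgt G h))"
    using assms by simp
  also have "\<dots> = e g * (e (tgt G g) * e (tgt G h)) * e h"
    using assms e_central[of "tgt G h" "e h"] by (simp only: mult.assoc e_closed tgt_in_objs objsD)
  also have "\<dots> = 0"
    using e_orth_obj[of "tgt G g" "tgt G h"] assms by simp
  finally show ?thesis .
qed

lemma B_orth:
  assumes "g \<in> carrier G" "h \<in> carrier G" "tgt G g \<noteq> tgt G h" "a \<in> B g" "b \<in> B h"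
  shows "a * b = 0"
proof -
  have "a * b = a * e g * (b * e h)" using assms by (simp add: B_absorb)
  also have "\<dots> = a * b * (e g * e h)"
    using e_central[of g b] assms B_sub_A by (metis mult.assoc)
  finally show ?thesis using e_orth assms by simp
qed

text \<open>Terms indexed by non-composable pairs vanish by this, so sums can be extended to all of
  \<open>carrier G\<close> or cut down again as convenient.\<close>

lemma \<phi>_orth:
  assumes "g \<in> carrier G" "h \<in> carrier G" "src G g \<noteq> tgt G h" "b \<in> B h"
  shows "\<phi> g b = 0"
proof -
  have "b * e (ginv G g) = 0"
    using B_orth[of h "ginv G g" b "e (ginv G g)"] assms by (auto simp: e_in_B)
  then show ?thesis using \<phi>_restrict[of g b] assms by simp
qed

text \<open>By orthogonality, multiplying by \<open>e z\<close> reads off the component of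
  \<open>a\<close> in \<open>B z\<close>.\<close>

lemma sum_e_obj:
  assumes "a \<in> A"
  shows "(\<Sum>y\<in>objs G. a * e y) = a"
proof -
  obtain f where f: "f \<in> Pi\<^sub>E (objs G) B" "a = (\<Sum>y\<in>objs G. f y)"
    using sum_A assms unfolding direct_sum_def bij_betw_def by (metis (no_types, lifting) imageE)
  have "a * e z = f z" if z: "z \<in> objs G" for z
  proof -
    have "f y * e z = (if y = z then f z else 0)" if y: "y \<in> objs G" for y
      using f y z B_orth[of y z "f y" "e z"] B_absorb[of z "f z"] by (auto simp: e_in_B)
    then show ?thesis
      using z by (simp add: f sum_distrib_right sum.delta)
  qed
  with f show ?thesis by simp
qed

lemma eq_if_eq_on_objs:
  assumes "a \<in> A" "b \<in> A" "\<And>y. y \<in> objs G \<Longrightarrow> a * e y = b * e y"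
  shows "a = b"
  using sum_e_obj[OF assms(1)] sum_e_obj[OF assms(2)] assms(3) by (metis (no_types, lifting) sum.cong)

lemma unity_A: "is_unity A (\<Sum>y\<in>objs G. e y)"
  using sum_e_obj by (auto simp: is_unity_def sum_distrib_left sum_distrib_right e_central)

end

section \<open>The partial skew groupoid ring\<close>

context groupoid
begin

section \<open>Reindexing sums over morphisms\<close>

definition into :: "'g \<Rightarrow> 'g set" where
  "into z = {g \<in> carrier G. tgt G g = z}"

lemma self_in_into: "g \<in> carrier G \<Longrightarrow> g \<in> into (tgt G g)"
  and tgt_in_into: "g \<in> carrier G \<Longrightarrow> tgt G g \<in> into (tgt G g)"
  by (simp_all add: into_def tgt_closed tgt_tgt)

lemma sum_into_cmp:
  assumes "g \<in> carrier G"
  shows "(\<Sum>m\<in>into (tgt G g). F m) = (\<Sum>h\<in>into (src G g). F (cmp G g h))"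
  by (rule sum.reindex_bij_witness[of _ "cmp G g" "cmp G (ginv G g)"])
    (use assms in \<open>auto simp: into_def cmp_closed tgt_cmp\<close>)

text \<open>Pairs (k, g) with a common target correspond to composable pairs (g, h) by k = gh. This
  turns a sum of convolution products into a double sum over composable pairs.\<close>

lemma sum_swap_into_tgt:
  assumes "finite (carrier G)"
  shows "(\<Sum>k\<in>carrier G. \<Sum>g\<in>into (tgt G k). F k g) = (\<Sum>g\<in>carrier G. \<Sum>h\<in>into (src G g). F (cmp G g h) g)"
proof -
  have "(\<Sum>k\<in>carrier G. \<Sum>g\<in>into (tgt G k). F k g) = (\<Sum>g\<in>carrier G. \<Sum>k\<in>into (tgt G g). F k g)"
    using sum.swap_restrict[OF assms assms, of F "\<lambda>k g. tgt G g = tgt G k"]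
    by (simp add: into_def eq_commute)
  then show ?thesis by (simp add: sum_into_cmp)
qed

lemma sum_ginv: "(\<Sum>g\<in>carrier G. F (ginv G g)) = (\<Sum>g\<in>carrier G. F g)"
  by (rule sum.reindex_bij_witness[of _ "ginv G" "ginv G"]) auto

lemma sum_out_cmp:
  assumes "g \<in> carrier G"
  shows "(\<Sum>k\<in>{k \<in> carrier G. src G k = src G g}. F k) = (\<Sum>l\<in>{l \<in> carrier G. src G l = tgt G g}. F (cmp G l g))"
  by (rule sum.reindex_bij_witness[of _ "\<lambda>l. cmp G l g" "\<lambda>k. cmp G k (ginv G g)"])
    (use assms in \<open>auto simp: cmp_closed src_cmp\<close>)

end

context unital_action
begin

lemma sum_only_into:
  assumes "\<And>g. \<lbrakk>g \<in> carrier G; tgt G g \<noteq> z\<rbrakk> \<Longrightarrow> F g = 0"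
  shows "(\<Sum>g\<in>carrier G. F g) = (\<Sum>g\<in>into z. F g)"
  by (rule sum.mono_neutral_right) (use assms finite_G in \<open>auto simp: into_def\<close>)

lemma sum_only_out:
  assumes "\<And>g. \<lbrakk>g \<in> carrier G; src G g \<noteq> z\<rbrakk> \<Longrightarrow> F g = 0"
  shows "(\<Sum>g\<in>carrier G. F g) = (\<Sum>g\<in>{g \<in> carrier G. src G g = z}. F g)"
  by (rule sum.mono_neutral_right) (use assms finite_G in auto)

lemma B_add: "\<lbrakk>g \<in> carrier G; a \<in> B g; b \<in> B g\<rbrakk> \<Longrightarrow> a + b \<in> B g"
  using ideal_B is_ideal_addD by blast

lemma B_0: "g \<in> carrier G \<Longrightarrow> 0 \<in> B g"
  using ideal_B by (auto simp: is_ideal_def)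

lemma B_uminus: "\<lbrakk>g \<in> carrier G; a \<in> B g\<rbrakk> \<Longrightarrow> - a \<in> B g"
  using ideal_B[of g] B_0[of g] unfolding is_ideal_def by (metis diff_0)

lemma B_sum: "\<lbrakk>g \<in> carrier G; \<And>i. i \<in> J \<Longrightarrow> f i \<in> B g\<rbrakk> \<Longrightarrow> sum f J \<in> B g"
  by (induction J rule: infinite_finite_induct) (auto simp: B_0 B_add)

text \<open>Since \<open>b = b * e h\<close>, the image picks up the factor
  \<open>e (cmp G g h)\<close> from \<open>\<phi>_idem\<close>. This places convolution products in
  the right ideal.\<close>

lemma \<phi>_in_B_cmp:
  assumes "g \<in> carrier G" "h \<in> carrier G" "src G g = tgt G h" "b \<in> B h"
  shows "\<phi> g b \<in> B (cmp G g h)"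
proof -
  have "b \<in> A" using assms B_sub_A by blast
  have "\<phi> g b = \<phi> g (b * e h)" using assms by (simp add: B_absorb)
  also have "\<dots> = \<phi> g b * e (cmp G g h)"
    using assms \<open>b \<in> A\<close> by (simp add: \<phi>_mult \<phi>_idem mult.assoc[symmetric])
  finally show ?thesis
    using assms \<open>b \<in> A\<close> restrict_in_B[of "cmp G g h" "\<phi> g b"] by (simp add: cmp_closed)
qed

lemma B_mult_e: "\<lbrakk>g \<in> carrier G; a \<in> B g; b \<in> A\<rbrakk> \<Longrightarrow> a * b * e g = a * b"
  by (simp add: B_absorb mult_in_B)

text \<open>The factor \<open>e g\<close> left by \<open>\<phi>_comp\<close> is absorbed by
  \<open>b\<close>. Composition is needed in this form in the skew ring, whose coefficients at g lie
  in \<open>B g\<close>.\<close>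

lemma \<phi>_comp_B:
  assumes "g \<in> carrier G" "h \<in> carrier G" "src G g = tgt G h" "a \<in> A" "b \<in> B g"
  shows "b * \<phi> g (\<phi> h a) = b * \<phi> (cmp G g h) a"
  using assms by (simp add: \<phi>_comp mult.assoc[symmetric] B_mult_e cmp_closed)

section \<open>Invariants and the trace\<close>

lemma invariants_iff: "a \<in> invariants G A \<alpha> \<longleftrightarrow> a \<in> A \<and> (\<forall>g\<in>carrier G. \<phi> g a = a * e g)"
  by (simp add: invariants_def)

lemma \<phi>_mult_invariant:
  assumes "g \<in> carrier G" "a \<in> A" "r \<in> invariants G A \<alpha>"
  shows "\<phi> g (r * a) = r * \<phi> g a" "\<phi> g (a * r) = \<phi> g a * r"
proof -
  have r: "r \<in> A" "\<phi> g r = r * e g" using assms by (auto simp: invariants_iff)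
  have "\<phi> g (r * a) = r * (e g * \<phi> g a)" "\<phi> g (a * r) = \<phi> g a * r * e g"
    using assms r by (simp_all add: \<phi>_mult mult.assoc)
  then show "\<phi> g (r * a) = r * \<phi> g a" "\<phi> g (a * r) = \<phi> g a * r"
    using assms r by (simp_all add: e_central B_mult_e \<phi>_in_B)
qed

lemma tr_closed [simp]: "a \<in> A \<Longrightarrow> tr G \<alpha> a \<in> A"
  by (simp add: tr_def)

lemma tr_add: "\<lbrakk>a \<in> A; b \<in> A\<rbrakk> \<Longrightarrow> tr G \<alpha> (a + b) = tr G \<alpha> a + tr G \<alpha> b"
  by (simp add: tr_def \<phi>_add sum.distrib)

lemma tr_e:
  assumes "k \<in> carrier G" "a \<in> A"
  shows "tr G \<alpha> a * e k = (\<Sum>g\<in>into (tgt G k). \<phi> g a) * e k"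
proof -
  have "tr G \<alpha> a * e k = (\<Sum>g\<in>carrier G. \<phi> g a * e k)"
    by (simp add: tr_def sum_distrib_right)
  also have "\<dots> = (\<Sum>g\<in>into (tgt G k). \<phi> g a * e k)"
    by (rule sum_only_into) (use assms in \<open>auto intro!: B_orth[where h=k] simp: \<phi>_in_B e_in_B\<close>)
  finally show ?thesis by (simp add: sum_distrib_right)
qed

text \<open>\<open>\<phi> k\<close> carries the terms with target \<open>src G k\<close> onto those
  with target \<open>tgt G k\<close>, up to \<open>e k\<close>, and kills all others.\<close>

lemma tr_invariant:
  assumes a: "a \<in> A"
  shows "tr G \<alpha> a \<in> invariants G A \<alpha>"
proof -
  have "\<phi> k (tr G \<alpha> a) = tr G \<alpha> a * e k" if k: "k \<in> carrier G" for k
  proof -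
    have "\<phi> k (tr G \<alpha> a) = (\<Sum>g\<in>carrier G. \<phi> k (\<phi> g a))"
      using a k by (simp add: tr_def \<phi>_sum)
    also have "\<dots> = (\<Sum>g\<in>into (src G k). \<phi> k (\<phi> g a))"
      using a k \<phi>_orth[of k _ "\<phi> _ a"] by (intro sum_only_into) (auto simp: \<phi>_in_B)
    also have "\<dots> = (\<Sum>g\<in>into (src G k). \<phi> (cmp G k g) a * e k)"
      using a k by (intro sum.cong refl \<phi>_comp) (auto simp: into_def)
    also have "\<dots> = tr G \<alpha> a * e k"
      using a k by (simp add: tr_e sum_into_cmp sum_distrib_right)
    finally show ?thesis .
  qed
  then show ?thesis using a by (simp add: invariants_iff)
qed

text \<open>Each k with source \<open>tgt G g\<close> has the form l g^-1 for a unique l with source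
  \<open>src G g\<close>, and the term at k is then \<open>\<phi> l (\<phi> (ginv G g) c)\<close>.
  This makes \<Gamma> balanced.\<close>

lemma tr_\<phi>:
  assumes "g \<in> carrier G" "c \<in> A"
  shows "tr G \<alpha> (\<phi> (ginv G g) c) = tr G \<alpha> (c * e g)"
proof -
  have "tr G \<alpha> (c * e g) = (\<Sum>k\<in>{k \<in> carrier G. src G k = tgt G g}. \<phi> k (c * e g))"
    unfolding tr_def by (rule sum_only_out) (use assms in \<open>auto intro!: \<phi>_orth[where h=g] simp: restrict_in_B\<close>)
  also have "\<dots> = (\<Sum>k\<in>{k \<in> carrier G. src G k = src G (ginv G g)}. \<phi> k (c * e g))"
    using assms by simp
  also have "\<dots> = (\<Sum>l\<in>{l \<in> carrier G. src G l = src G g}. \<phi> (cmp G l (ginv G g)) (c * e g))"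
    using assms by (subst sum_out_cmp) simp_all
  also have "\<dots> = (\<Sum>l\<in>{l \<in> carrier G. src G l = src G g}. \<phi> l (\<phi> (ginv G g) c))"
  proof (rule sum.cong[OF refl])
    fix l assume "l \<in> {l \<in> carrier G. src G l = src G g}"
    then have l: "l \<in> carrier G" "src G l = src G g" by auto
    then have cl: "cmp G l (ginv G g) \<in> carrier G" using assms by (simp add: cmp_closed)
    have "\<phi> (cmp G l (ginv G g)) (c * e g)
        = \<phi> (cmp G l (ginv G g)) c * (e (cmp G l (ginv G g)) * e l)"
      using \<phi>_idem[of "cmp G l (ginv G g)" g] l cl assms by (simp add: \<phi>_mult src_cmp)
    also have "\<dots> = \<phi> l (\<phi> (ginv G g) c)"
      using l cl assms by (simp add: \<phi>_comp mult.assoc[symmetric])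
    finally show "\<phi> (cmp G l (ginv G g)) (c * e g) = \<phi> l (\<phi> (ginv G g) c)" .
  qed
  also have "\<dots> = tr G \<alpha> (\<phi> (ginv G g) c)"
    unfolding tr_def using assms \<phi>_in_B[of "ginv G g" c]
    by (intro sum_only_out[symmetric] \<phi>_orth[of _ "ginv G g"]) auto
  finally show ?thesis ..
qed

abbreviation "\<A>inv \<equiv> invariants G A \<alpha>"
abbreviation "R0 \<equiv> inv_ring G A \<alpha>"
abbreviation "S0 \<equiv> skew_ring G \<alpha>"
abbreviation "U0 \<equiv> left_inv_bimodule G A \<alpha>"
abbreviation "V0 \<equiv> right_inv_bimodule G A \<alpha>"

lemma inv_closed [simp]:
  "0 \<in> \<A>inv" "\<lbrakk>a \<in> \<A>inv; b \<in> \<A>inv\<rbrakk> \<Longrightarrow> a + b \<in> \<A>inv" "\<lbrakk>a \<in> \<A>inv; b \<in> \<A>inv\<rbrakk> \<Longrightarrow> a * b \<in> \<A>inv"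
  "a \<in> \<A>inv \<Longrightarrow> - a \<in> \<A>inv"
proof -
  show add: "a + b \<in> \<A>inv" if "a \<in> \<A>inv" "b \<in> \<A>inv" for a b
    using that by (auto simp: invariants_iff \<phi>_add distrib_right)
  show "a * b \<in> \<A>inv" if "a \<in> \<A>inv" "b \<in> \<A>inv"
  proof -
    have "a \<in> A" "b \<in> A" using that by (auto simp: invariants_iff)
    then show ?thesis
      using that \<phi>_mult_invariant(1)[of _ b a] by (auto simp: invariants_iff mult.assoc)
  qed
  show "- a \<in> \<A>inv" if "a \<in> \<A>inv"
  proof -
    have "a \<in> A" using that by (auto simp: invariants_iff)
    have "\<phi> g (- a) = - \<phi> g a" if "g \<in> carrier G" for g
      using \<phi>_add[of g a "- a"] that \<open>a \<in> A\<close> by (simp add: eq_neg_iff_add_eq_0 add.commute)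
    then show ?thesis using that by (auto simp: invariants_iff)
  qed
qed (simp add: invariants_iff)

lemma inv_sub_A [simp]: "a \<in> \<A>inv \<Longrightarrow> a \<in> A"
  by (simp add: invariants_iff)

lemma unity_A_eq: "unity A = (\<Sum>y\<in>objs G. e y)"
  using unity_A by (rule unity_eqI)

lemma unity_A_closed [simp]: "unity A \<in> A"
  and unity_A_mult [simp]: "a \<in> A \<Longrightarrow> unity A * a = a" "a \<in> A \<Longrightarrow> a * unity A = a"
  using unity_A by (auto simp: unity_A_eq is_unity_def)

lemma \<phi>_unity:
  assumes "g \<in> carrier G"
  shows "\<phi> g (unity A) = e g"
  using \<phi>_restrict[of g "unity A"] \<phi>_unit[of g] assms by simp

lemma unity_invariants: "is_unity \<A>inv (unity A)"
  using \<phi>_unity by (auto simp: is_unity_def invariants_iff)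

lemma unity_inv_eq: "unity \<A>inv = unity A"
  using unity_invariants by (rule unity_eqI)

lemma unity_A_inv [simp]: "unity A \<in> \<A>inv"
  using unity_invariants by (simp add: is_unity_def)

lemma inv_ring_simps [simp]:
  "carrier R0 = \<A>inv" "a \<otimes>\<^bsub>R0\<^esub> b = a * b" "\<one>\<^bsub>R0\<^esub> = unity A" "\<zero>\<^bsub>R0\<^esub> = 0" "a \<oplus>\<^bsub>R0\<^esub> b = a + b"
  by (simp_all add: inv_ring_def unity_inv_eq)

lemma ring_inv_ring: "ring R0"
proof (rule ringI)
  show "abelian_group R0"
  proof (rule abelian_groupI)
    fix a assume "a \<in> carrier R0"
    then show "\<exists>b\<in>carrier R0. b \<oplus>\<^bsub>R0\<^esub> a = \<zero>\<^bsub>R0\<^esub>"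
      by (intro bexI[of _ "- a"]) auto
  qed (auto simp: algebra_simps)
  show "monoid R0"
    by (rule monoidI) (auto simp: mult.assoc)
qed (auto simp: algebra_simps)

section \<open>The convolution product\<close>

lemma skew_ring_simps [simp]:
  "\<one>\<^bsub>S0\<^esub> = (\<lambda>g. if g \<in> objs G then e g else 0)" "\<zero>\<^bsub>S0\<^esub> = (\<lambda>g. 0)"
  "f \<oplus>\<^bsub>S0\<^esub> f' = (\<lambda>g. f g + f' g)"
  by (simp_all add: skew_ring_def)

lemma carrier_skew: "f \<in> carrier S0 \<longleftrightarrow> (\<forall>g\<in>carrier G. f g \<in> B g) \<and> (\<forall>g. g \<notin> carrier G \<longrightarrow> f g = 0)"
  by (simp add: skew_ring_def)

lemma skew_in_B: "\<lbrakk>f \<in> carrier S0; g \<in> carrier G\<rbrakk> \<Longrightarrow> f g \<in> B g"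
  by (simp add: carrier_skew)

lemma skew_in_A [simp]: "\<lbrakk>f \<in> carrier S0; g \<in> carrier G\<rbrakk> \<Longrightarrow> f g \<in> A"
  using skew_in_B B_sub_A by blast

text \<open>In gh = k the second factor is determined by the first as h = g^-1 k, so one summation
  index suffices.\<close>

lemma skew_mult:
  assumes "k \<in> carrier G"
  shows "(f \<otimes>\<^bsub>S0\<^esub> f') k = (\<Sum>g\<in>into (tgt G k). f g * \<phi> g (f' (cmp G (ginv G g) k)))"
  unfolding skew_ring_def
  by simp (rule sum.reindex_bij_witness[of _ "\<lambda>g. (g, cmp G (ginv G g) k)" fst];
      use assms in \<open>auto simp: into_def cmp_closed tgt_cmp\<close>)

lemma skew_mult_outside: "k \<notin> carrier G \<Longrightarrow> (f \<otimes>\<^bsub>S0\<^esub> f') k = 0"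
  unfolding skew_ring_def by simp (rule sum.neutral, auto dest: cmp_closed)

lemma skew_mult_closed:
  assumes f: "f \<in> carrier S0" "f' \<in> carrier S0"
  shows "f \<otimes>\<^bsub>S0\<^esub> f' \<in> carrier S0"
proof -
  have "f g * \<phi> g (f' (cmp G (ginv G g) k)) \<in> B k" if "k \<in> carrier G" "g \<in> into (tgt G k)" for k g
  proof -
    from that have g: "g \<in> carrier G" "tgt G g = tgt G k" by (auto simp: into_def)
    let ?h = "cmp G (ginv G g) k"
    have h: "?h \<in> carrier G" "tgt G ?h = src G g" "cmp G g ?h = k"
      using g that by (simp_all add: cmp_closed tgt_cmp)
    have "\<phi> g (f' ?h) \<in> B k"
      using \<phi>_in_B_cmp[of g ?h "f' ?h"] g h f by (simp add: skew_in_B)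
    then show ?thesis using f g that by (simp add: mult_in_B)
  qed
  then show ?thesis
    by (auto simp: carrier_skew skew_mult skew_mult_outside intro!: B_sum)
qed

lemma skew_ext:
  "\<lbrakk>f \<in> carrier S0; f' \<in> carrier S0; \<And>k. k \<in> carrier G \<Longrightarrow> f k = f' k\<rbrakk> \<Longrightarrow> f = f'"
  by (rule ext) (metis carrier_skew)

lemma skew_mult_assoc:
  assumes f: "f1 \<in> carrier S0" "f2 \<in> carrier S0" "f3 \<in> carrier S0"
  shows "(f1 \<otimes>\<^bsub>S0\<^esub> f2) \<otimes>\<^bsub>S0\<^esub> f3 = f1 \<otimes>\<^bsub>S0\<^esub> (f2 \<otimes>\<^bsub>S0\<^esub> f3)"
proof (rule skew_ext)
  fix k assume k: "k \<in> carrier G"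
  let ?J = "into (tgt G k)"
  \<comment> \<open>Both bracketings become the same double sum over g and m = gh with target
    \<open>tgt G k\<close>. The factor \<open>e g\<close> from composing \<open>\<phi> g\<close>
    with \<open>\<phi> h\<close> is absorbed by \<open>f1 g\<close>.\<close>
  have eq: "f1 g * \<phi> g ((f2 \<otimes>\<^bsub>S0\<^esub> f3) (cmp G (ginv G g) k))
      = (\<Sum>m\<in>?J. f1 g * \<phi> g (f2 (cmp G (ginv G g) m)) * \<phi> m (f3 (cmp G (ginv G m) k)))"
    if "g \<in> ?J" for g
  proof -
    from that have g: "g \<in> carrier G" "tgt G g = tgt G k" by (auto simp: into_def)
    let ?l = "cmp G (ginv G g) k"
    have l: "?l \<in> carrier G" "tgt G ?l = src G g"
      using g k by (simp_all add: cmp_closed tgt_cmp)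
    have h: "cmp G (ginv G h) ?l \<in> carrier G" "cmp G g h \<in> carrier G"
      "cmp G (ginv G h) ?l = cmp G (ginv G (cmp G g h)) k" "tgt G (cmp G (ginv G h) ?l) = src G h"
      if "h \<in> into (src G g)" for h
      using that g k l by (auto simp: into_def cmp_closed ginv_cmp cmp_assoc tgt_cmp)
    have "f1 g * \<phi> g ((f2 \<otimes>\<^bsub>S0\<^esub> f3) ?l)
        = f1 g * \<phi> g (\<Sum>h\<in>into (src G g). f2 h * \<phi> h (f3 (cmp G (ginv G h) ?l)))"
      using l by (simp add: skew_mult)
    also have "\<dots> = (\<Sum>h\<in>into (src G g). f1 g * (\<phi> g (f2 h) * \<phi> g (\<phi> h (f3 (cmp G (ginv G h) ?l)))))"
      using g f h by (subst \<phi>_sum) (auto simp: into_def \<phi>_mult sum_distrib_left)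
    also have "\<dots> = (\<Sum>h\<in>into (src G g). f1 g * \<phi> g (f2 h) * \<phi> (cmp G g h) (f3 (cmp G (ginv G h) ?l)))"
    proof (rule sum.cong[OF refl])
      fix h assume hh: "h \<in> into (src G g)"
      have "f1 g * \<phi> g (f2 h) \<in> B g"
        using f g hh by (simp add: mult_in_B skew_in_B into_def)
      then show "f1 g * (\<phi> g (f2 h) * \<phi> g (\<phi> h (f3 (cmp G (ginv G h) ?l))))
          = f1 g * \<phi> g (f2 h) * \<phi> (cmp G g h) (f3 (cmp G (ginv G h) ?l))"
        using f g hh h[OF hh] \<phi>_comp_B[of g h] by (simp add: into_def mult.assoc[symmetric])
    qed
    also have "\<dots> = (\<Sum>m\<in>?J. f1 g * \<phi> g (f2 (cmp G (ginv G g) m)) * \<phi> m (f3 (cmp G (ginv G m) k)))"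
      using g h by (simp add: sum_into_cmp[of g] flip: g(2)) (auto simp: into_def intro!: sum.cong)
    finally show ?thesis .
  qed
  have "((f1 \<otimes>\<^bsub>S0\<^esub> f2) \<otimes>\<^bsub>S0\<^esub> f3) k
      = (\<Sum>m\<in>?J. (\<Sum>g\<in>into (tgt G m). f1 g * \<phi> g (f2 (cmp G (ginv G g) m))) * \<phi> m (f3 (cmp G (ginv G m) k)))"
    using k by (simp add: skew_mult) (auto simp: into_def skew_mult intro!: sum.cong)
  also have "\<dots> = (\<Sum>m\<in>?J. \<Sum>g\<in>?J. f1 g * \<phi> g (f2 (cmp G (ginv G g) m)) * \<phi> m (f3 (cmp G (ginv G m) k)))"
    by (rule sum.cong) (auto simp: into_def sum_distrib_right)
  also have "\<dots> = (\<Sum>g\<in>?J. f1 g * \<phi> g ((f2 \<otimes>\<^bsub>S0\<^esub> f3) (cmp G (ginv G g) k)))"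
    by (subst sum.swap) (simp add: eq)
  also have "\<dots> = (f1 \<otimes>\<^bsub>S0\<^esub> (f2 \<otimes>\<^bsub>S0\<^esub> f3)) k"
    using k by (simp add: skew_mult)
  finally show "((f1 \<otimes>\<^bsub>S0\<^esub> f2) \<otimes>\<^bsub>S0\<^esub> f3) k = (f1 \<otimes>\<^bsub>S0\<^esub> (f2 \<otimes>\<^bsub>S0\<^esub> f3)) k" .
qed (use f in \<open>auto intro: skew_mult_closed\<close>)

lemma skew_one_closed: "\<one>\<^bsub>S0\<^esub> \<in> carrier S0"
  by (auto simp: carrier_skew e_in_B B_0)

lemma finite_into: "finite (into z)"
  using finite_G by (rule finite_subset[rotated]) (auto simp: into_def)

lemma skew_one_left:
  assumes f: "f \<in> carrier S0"
  shows "\<one>\<^bsub>S0\<^esub> \<otimes>\<^bsub>S0\<^esub> f = f"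
proof (rule skew_ext)
  fix k assume k: "k \<in> carrier G"
  have "(\<one>\<^bsub>S0\<^esub> \<otimes>\<^bsub>S0\<^esub> f) k = (\<Sum>g\<in>into (tgt G k). if g = tgt G k then f k else 0)"
    unfolding skew_mult[OF k]
  proof (rule sum.cong[OF refl])
    fix g assume g: "g \<in> into (tgt G k)"
    show "\<one>\<^bsub>S0\<^esub> g * \<phi> g (f (cmp G (ginv G g) k)) = (if g = tgt G k then f k else 0)"
    proof (cases "g \<in> objs G")
      case True
      then have "g = tgt G k" using g by (auto simp: into_def)
      moreover have "f k * e (tgt G k) = f k"
        using skew_in_B[OF f k] k e_tgt[OF k] B_absorb[of k "f k"] by (metis mult.assoc)
      ultimately show ?thesis
        using k f by (simp add: tgt_cmp_id \<phi>_obj e_central)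
    next
      case False
      then have "g \<noteq> tgt G k" using k by auto
      with False show ?thesis by simp
    qed
  qed
  also have "\<dots> = f k"
    using k finite_into[of "tgt G k"] tgt_in_into[of k] by simp
  finally show "(\<one>\<^bsub>S0\<^esub> \<otimes>\<^bsub>S0\<^esub> f) k = f k" .
qed (use f skew_one_closed skew_mult_closed in \<open>auto simp del: skew_ring_simps\<close>)

lemma skew_one_right:
  assumes f: "f \<in> carrier S0"
  shows "f \<otimes>\<^bsub>S0\<^esub> \<one>\<^bsub>S0\<^esub> = f"
proof (rule skew_ext)
  fix k assume k: "k \<in> carrier G"
  have "(f \<otimes>\<^bsub>S0\<^esub> \<one>\<^bsub>S0\<^esub>) k = (\<Sum>g\<in>into (tgt G k). if g = k then f k else 0)"
    unfolding skew_mult[OF k]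
  proof (rule sum.cong[OF refl])
    fix g assume "g \<in> into (tgt G k)"
    then have g: "g \<in> carrier G" "tgt G g = tgt G k" by (auto simp: into_def)
    show "f g * \<phi> g (\<one>\<^bsub>S0\<^esub> (cmp G (ginv G g) k)) = (if g = k then f k else 0)"
    proof (cases "g = k")
      case True
      have "\<phi> k (e (src G k)) = e k"
        using k \<phi>_idem[of k "src G k"] by (simp add: tgt_src cmp_src)
      then show ?thesis
        using True k f by (simp add: ginv_cmp_self B_absorb skew_in_B)
    next
      case False
      have "cmp G (ginv G g) k \<notin> objs G"
      proof
        assume obj: "cmp G (ginv G g) k \<in> objs G"
        have "cmp G (ginv G g) k = src G g"
          using objsD(3)[OF obj] g k by (simp add: tgt_cmp)
        then have "cmp G g (src G g) = k"
          using cmp_cancel_ginv[of g k] g k by simp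
        then show False using False g by (simp add: cmp_src)
      qed
      then show ?thesis using False g by simp
    qed
  qed
  also have "\<dots> = f k"
    using k finite_into[of "tgt G k"] self_in_into[of k] by simp
  finally show "(f \<otimes>\<^bsub>S0\<^esub> \<one>\<^bsub>S0\<^esub>) k = f k" .
qed (use f skew_one_closed skew_mult_closed in \<open>auto simp del: skew_ring_simps\<close>)

lemma skew_add_closed: "\<lbrakk>f \<in> carrier S0; f' \<in> carrier S0\<rbrakk> \<Longrightarrow> (\<lambda>g. f g + f' g) \<in> carrier S0"
  by (auto simp: carrier_skew B_add)

lemma into_shift:
  assumes "k \<in> carrier G" "g \<in> into (tgt G k)"
  shows "g \<in> carrier G" "cmp G (ginv G g) k \<in> carrier G" "src G g = tgt G (cmp G (ginv G g) k)"
    "cmp G g (cmp G (ginv G g) k) = k"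
  using assms by (auto simp: into_def cmp_closed tgt_cmp)

lemma ring_skew_ring: "ring S0"
proof (rule ringI)
  show "abelian_group S0"
  proof (rule abelian_groupI)
    fix f assume f: "f \<in> carrier S0"
    then show "\<exists>f'\<in>carrier S0. f' \<oplus>\<^bsub>S0\<^esub> f = \<zero>\<^bsub>S0\<^esub>"
      by (intro bexI[of _ "\<lambda>g. - f g"]) (auto simp: carrier_skew B_uminus)
  qed (auto simp: carrier_skew B_add B_0 algebra_simps)
  show "monoid S0"
    by (rule monoidI)
      (use skew_mult_closed skew_one_closed skew_mult_assoc skew_one_left skew_one_right in blast)+
  fix f1 f2 f3 assume f: "f1 \<in> carrier S0" "f2 \<in> carrier S0" "f3 \<in> carrier S0"
  show "(f1 \<oplus>\<^bsub>S0\<^esub> f2) \<otimes>\<^bsub>S0\<^esub> f3 = f1 \<otimes>\<^bsub>S0\<^esub> f3 \<oplus>\<^bsub>S0\<^esub> f2 \<otimes>\<^bsub>S0\<^esub> f3"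
    using f by (intro skew_ext)
      (auto simp: skew_mult_closed skew_add_closed skew_mult distrib_right sum.distrib)
  show "f3 \<otimes>\<^bsub>S0\<^esub> (f1 \<oplus>\<^bsub>S0\<^esub> f2) = f3 \<otimes>\<^bsub>S0\<^esub> f1 \<oplus>\<^bsub>S0\<^esub> f3 \<otimes>\<^bsub>S0\<^esub> f2"
    using f by (intro skew_ext)
      (auto simp: skew_mult_closed skew_add_closed skew_mult distrib_left \<phi>_add into_shift
        sum.distrib[symmetric] intro!: sum.cong)
qed

end

section \<open>The Morita context of a partial action\<close>

text \<open>\<open>partial_galois\<close> indexes its sums from 1, whereas list positions start at
  0.\<close>

lemma sum_nth_pred: "(\<Sum>i=1..length ys. F (ys ! (i - 1))) = (\<Sum>p\<leftarrow>ys. F p)"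
  for F :: "'c \<Rightarrow> 'd::comm_monoid_add"
  by (simp add: sum_list_sum_nth sum.atLeast1_atMost_eq atLeast0LessThan)

context unital_action
begin

lemma left_bimodule_simps [simp]:
  "carrier U0 = A" "\<zero>\<^bsub>U0\<^esub> = 0" "a \<oplus>\<^bsub>U0\<^esub> b = a + b" "lact U0 r a = r * a"
  by (simp_all add: left_inv_bimodule_def)

lemma right_bimodule_simps [simp]:
  "carrier V0 = A" "\<zero>\<^bsub>V0\<^esub> = 0" "a \<oplus>\<^bsub>V0\<^esub> b = a + b" "ract V0 a r = a * r"
  "lact V0 f a = (\<Sum>g\<in>carrier G. f g * \<phi> g a)"
  by (simp_all add: right_inv_bimodule_def)

text \<open>The definition applies the partial map itself; as \<open>b * f g\<close> lies in its
  domain \<open>B g\<close>, the total map gives the same value.\<close>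

lemma left_bimodule_ract [simp]:
  assumes "f \<in> carrier S0" "b \<in> A"
  shows "ract U0 b f = (\<Sum>g\<in>carrier G. \<phi> (ginv G g) (b * f g))"
  unfolding left_inv_bimodule_def using assms
  by (auto simp: \<phi>_eq mult_in_B skew_in_B intro!: sum.cong)

lemma abelian_group_left: "abelian_group U0"
proof (rule abelian_groupI)
  fix a assume "a \<in> carrier U0"
  then show "\<exists>b\<in>carrier U0. b \<oplus>\<^bsub>U0\<^esub> a = \<zero>\<^bsub>U0\<^esub>"
    by (intro bexI[of _ "- a"]) auto
qed (auto simp: algebra_simps)

lemma abelian_group_right: "abelian_group V0"
proof (rule abelian_groupI)
  fix a assume "a \<in> carrier V0"
  then show "\<exists>b\<in>carrier V0. b \<oplus>\<^bsub>V0\<^esub> a = \<zero>\<^bsub>V0\<^esub>"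
    by (intro bexI[of _ "- a"]) auto
qed (auto simp: algebra_simps)

lemma ract_assoc_left:
  assumes f: "f \<in> carrier S0" "f' \<in> carrier S0" and b: "b \<in> A"
  shows "ract U0 b (f \<otimes>\<^bsub>S0\<^esub> f') = ract U0 (ract U0 b f) f'"
proof -
  have cl: "cmp G g h \<in> carrier G" if "g \<in> carrier G" "h \<in> into (src G g)" for g h
    using that by (auto simp: into_def cmp_closed)
  \<comment> \<open>With k = gh, the argument on the left lies in \<open>B g\<close>, so its image
    under k^-1 lies in the ideal of k^-1 g = h^-1. That image absorbs \<open>e (ginv G h)\<close>,
    exactly the factor by which \<phi> at h^-1 g^-1 differs from the composite of the two
    maps.\<close>
  have summand: "\<phi> (ginv G (cmp G g h)) (b * (f g * \<phi> g (f' h))) = \<phi> (ginv G h) (\<phi> (ginv G g) (b * f g) * f' h)"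
    if g: "g \<in> carrier G" and "h \<in> into (src G g)" for g h
  proof -
    have h: "h \<in> carrier G" "tgt G h = src G g" using that by (auto simp: into_def)
    let ?k = "cmp G g h" and ?c = "b * (f g * \<phi> g (f' h))"
    have k: "?k \<in> carrier G" using g h by (simp add: cmp_closed)
    have cA: "?c \<in> A" and "b * f g \<in> A" using f b g h by auto
    have "?c \<in> B ?k"
      using \<phi>_in_B_cmp[of g h "f' h"] f b g h k by (intro mult_in_B) (auto simp: skew_in_B)
    then have "\<phi> (ginv G ?k) ?c \<in> B (cmp G (ginv G ?k) g)"
    proof -
      have "?c = b * f g * \<phi> g (f' h)" by (simp add: mult.assoc)
      also have "\<dots> \<in> B g" using f b g h by (intro mult_in_B) (auto simp: skew_in_B)
      finally show ?thesis
        using \<phi>_in_B_cmp[of "ginv G ?k" g ?c] g h k by (simp add: tgt_cmp)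
    qed
    moreover have "cmp G (ginv G ?k) g = ginv G h"
      using g h by (simp add: ginv_cmp cmp_assoc ginv_cmp_self cmp_obj_right)
    ultimately have "\<phi> (ginv G ?k) ?c = \<phi> (ginv G ?k) ?c * e (ginv G h)"
      using h by (simp add: B_absorb)
    also have "\<dots> = \<phi> (ginv G h) (\<phi> (ginv G g) ?c)"
      using g h cA by (simp add: \<phi>_comp ginv_cmp)
    also have "\<phi> (ginv G g) ?c = \<phi> (ginv G g) (b * f g) * (f' h * e (ginv G g))"
      using g h f b \<open>b * f g \<in> A\<close> by (simp add: \<phi>_mult \<phi>_ginv mult.assoc)
    also have "\<dots> = \<phi> (ginv G g) (b * f g) * f' h"
      using B_mult_e[of "ginv G g" "\<phi> (ginv G g) (b * f g)" "f' h"] g h f \<open>b * f g \<in> A\<close>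
      by (simp add: \<phi>_in_B mult.assoc)
    finally show ?thesis .
  qed
  have "ract U0 b (f \<otimes>\<^bsub>S0\<^esub> f')
      = (\<Sum>k\<in>carrier G. \<phi> (ginv G k) (b * (\<Sum>g\<in>into (tgt G k). f g * \<phi> g (f' (cmp G (ginv G g) k)))))"
    using f b by (simp add: skew_mult_closed skew_mult)
  also have "\<dots> = (\<Sum>k\<in>carrier G. \<Sum>g\<in>into (tgt G k). \<phi> (ginv G k) (b * (f g * \<phi> g (f' (cmp G (ginv G g) k)))))"
    using f b by (intro sum.cong refl, subst \<phi>_sum[symmetric]) (auto simp: sum_distrib_left into_shift)
  also have "\<dots> = (\<Sum>g\<in>carrier G. \<Sum>h\<in>into (src G g). \<phi> (ginv G (cmp G g h)) (b * (f g * \<phi> g (f' h))))"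
    by (simp add: sum_swap_into_tgt[OF finite_G]) (auto simp: into_def intro!: sum.cong)
  also have "\<dots> = (\<Sum>g\<in>carrier G. \<Sum>h\<in>into (src G g). \<phi> (ginv G h) (\<phi> (ginv G g) (b * f g) * f' h))"
    using summand by simp
  also have "\<dots> = (\<Sum>g\<in>carrier G. \<Sum>h\<in>carrier G. \<phi> (ginv G h) (\<phi> (ginv G g) (b * f g) * f' h))"
  proof (rule sum.cong[OF refl], rule sum_only_into[symmetric])
    fix g h assume gh: "g \<in> carrier G" "h \<in> carrier G" "tgt G h \<noteq> src G g"
    then have "\<phi> (ginv G g) (b * f g) * f' h = 0"
      using f b by (intro B_orth[of "ginv G g" h]) (auto simp: \<phi>_in_B skew_in_B)
    then show "\<phi> (ginv G h) (\<phi> (ginv G g) (b * f g) * f' h) = 0"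
      using gh by simp
  qed
  also have "\<dots> = (\<Sum>h\<in>carrier G. \<Sum>g\<in>carrier G. \<phi> (ginv G h) (\<phi> (ginv G g) (b * f g) * f' h))"
    by (rule sum.swap)
  also have "\<dots> = (\<Sum>h\<in>carrier G. \<phi> (ginv G h) ((\<Sum>g\<in>carrier G. \<phi> (ginv G g) (b * f g)) * f' h))"
    using f b by (simp add: \<phi>_sum sum_distrib_right)
  also have "\<dots> = ract U0 (ract U0 b f) f'"
    using f b by simp
  finally show ?thesis .
qed

lemma lact_assoc_right:
  assumes f: "f \<in> carrier S0" "f' \<in> carrier S0" and b: "b \<in> A"
  shows "lact V0 (f \<otimes>\<^bsub>S0\<^esub> f') b = lact V0 f (lact V0 f' b)"
proof -
  have "lact V0 (f \<otimes>\<^bsub>S0\<^esub> f') b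
      = (\<Sum>k\<in>carrier G. \<Sum>g\<in>into (tgt G k). f g * \<phi> g (f' (cmp G (ginv G g) k)) * \<phi> k b)"
    by (simp add: skew_mult sum_distrib_right)
  also have "\<dots> = (\<Sum>g\<in>carrier G. \<Sum>h\<in>into (src G g). f g * \<phi> g (f' h) * \<phi> (cmp G g h) b)"
    by (simp add: sum_swap_into_tgt[OF finite_G]) (auto simp: into_def intro!: sum.cong)
  also have "\<dots> = (\<Sum>g\<in>carrier G. \<Sum>h\<in>into (src G g). f g * \<phi> g (f' h * \<phi> h b))"
  proof (intro sum.cong refl)
    fix g h assume g: "g \<in> carrier G" and "h \<in> into (src G g)"
    then have h: "h \<in> carrier G" "src G g = tgt G h" by (auto simp: into_def)
    have "f g * \<phi> g (f' h) \<in> B g"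
      using f g h by (simp add: mult_in_B skew_in_B)
    then show "f g * \<phi> g (f' h) * \<phi> (cmp G g h) b = f g * \<phi> g (f' h * \<phi> h b)"
      using \<phi>_comp_B[of g h b "f g * \<phi> g (f' h)"] f b g h by (simp add: \<phi>_mult mult.assoc)
  qed
  also have "\<dots> = (\<Sum>g\<in>carrier G. \<Sum>h\<in>carrier G. f g * \<phi> g (f' h * \<phi> h b))"
  proof (rule sum.cong[OF refl], rule sum_only_into[symmetric])
    fix g h assume "g \<in> carrier G" "h \<in> carrier G" "tgt G h \<noteq> src G g"
    then show "f g * \<phi> g (f' h * \<phi> h b) = 0"
      using \<phi>_orth[of g h "f' h * \<phi> h b"] f b by (simp add: mult_in_B skew_in_B)
  qed
  also have "\<dots> = lact V0 f (lact V0 f' b)"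
    using f b by (simp add: \<phi>_sum sum_distrib_left)
  finally show ?thesis .
qed

lemma sum_restrict_objs: "(\<Sum>g\<in>carrier G. if g \<in> objs G then F g else 0) = (\<Sum>y\<in>objs G. F y)"
proof -
  have "(\<Sum>g\<in>carrier G. if g \<in> objs G then F g else 0) = (\<Sum>g\<in>carrier G \<inter> objs G. F g)"
    using finite_G by (simp add: sum.inter_restrict)
  also have "carrier G \<inter> objs G = objs G" by auto
  finally show ?thesis .
qed

lemma lact_one_right:
  assumes "b \<in> A"
  shows "lact V0 \<one>\<^bsub>S0\<^esub> b = b"
proof -
  have "e g * (b * e g) = b * e g" if "g \<in> objs G" for g
    using that assms e_central[of g "b * e g"] by (simp add: mult.assoc)
  then have "lact V0 \<one>\<^bsub>S0\<^esub> b = (\<Sum>g\<in>carrier G. if g \<in> objs G then b * e g else 0)"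
    using assms by (auto intro!: sum.cong simp: \<phi>_obj)
  then show ?thesis using assms by (simp add: sum_restrict_objs sum_e_obj)
qed

lemma ract_one_left:
  assumes "b \<in> A"
  shows "ract U0 b \<one>\<^bsub>S0\<^esub> = b"
proof -
  have "ract U0 b \<one>\<^bsub>S0\<^esub> = (\<Sum>g\<in>carrier G. if g \<in> objs G then b * e g else 0)"
    using assms skew_one_closed by (auto intro!: sum.cong simp: \<phi>_obj mult.assoc)
  then show ?thesis using assms by (simp add: sum_restrict_objs sum_e_obj)
qed

lemma bimodule_left: "bimodule R0 S0 U0"
proof -
  interpret R: ring R0 by (rule ring_inv_ring)
  interpret S: ring S0 by (rule ring_skew_ring)
  interpret M: abelian_group U0 by (rule abelian_group_left)
  show ?thesis
  proof (intro bimodule.intro bimodule_axioms.intro R.ring_axioms S.ring_axioms M.abelian_group_axioms)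
    fix s s' u assume "s \<in> carrier S0" "s' \<in> carrier S0" "u \<in> carrier U0"
    then show "ract U0 u (s \<oplus>\<^bsub>S0\<^esub> s') = ract U0 u s \<oplus>\<^bsub>U0\<^esub> ract U0 u s'"
      by (simp add: skew_add_closed distrib_left \<phi>_add sum.distrib)
  next
    fix s u u' assume "s \<in> carrier S0" "u \<in> carrier U0" "u' \<in> carrier U0"
    then show "ract U0 (u \<oplus>\<^bsub>U0\<^esub> u') s = ract U0 u s \<oplus>\<^bsub>U0\<^esub> ract U0 u' s"
      by (simp add: distrib_right \<phi>_add sum.distrib)
  next
    fix s s' u assume "s \<in> carrier S0" "s' \<in> carrier S0" "u \<in> carrier U0"
    then show "ract U0 u (s \<otimes>\<^bsub>S0\<^esub> s') = ract U0 (ract U0 u s) s'"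
      using ract_assoc_left[of s s' u] by simp
  next
    fix u assume "u \<in> carrier U0"
    then show "ract U0 u \<one>\<^bsub>S0\<^esub> = u" using ract_one_left[of u] by simp
  next
    fix r s u assume "r \<in> carrier R0" "s \<in> carrier S0" "u \<in> carrier U0"
    then show "ract U0 (lact U0 r u) s = lact U0 r (ract U0 u s)"
      by (simp add: \<phi>_mult_invariant mult.assoc sum_distrib_left)
  qed (auto simp: algebra_simps)
qed

lemma bimodule_right: "bimodule S0 R0 V0"
proof -
  interpret R: ring R0 by (rule ring_inv_ring)
  interpret S: ring S0 by (rule ring_skew_ring)
  interpret M: abelian_group V0 by (rule abelian_group_right)
  show ?thesis
  proof (intro bimodule.intro bimodule_axioms.intro R.ring_axioms S.ring_axioms M.abelian_group_axioms)
    fix s s' u assume "s \<in> carrier S0" "s' \<in> carrier S0" "u \<in> carrier V0"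
    then show "lact V0 (s \<oplus>\<^bsub>S0\<^esub> s') u = lact V0 s u \<oplus>\<^bsub>V0\<^esub> lact V0 s' u"
      by (simp add: distrib_right sum.distrib)
  next
    fix s u u' assume "s \<in> carrier S0" "u \<in> carrier V0" "u' \<in> carrier V0"
    then show "lact V0 s (u \<oplus>\<^bsub>V0\<^esub> u') = lact V0 s u \<oplus>\<^bsub>V0\<^esub> lact V0 s u'"
      by (simp add: \<phi>_add distrib_left sum.distrib)
  next
    fix s s' u assume "s \<in> carrier S0" "s' \<in> carrier S0" "u \<in> carrier V0"
    then show "lact V0 (s \<otimes>\<^bsub>S0\<^esub> s') u = lact V0 s (lact V0 s' u)"
      using lact_assoc_right[of s s' u] by simp
  next
    fix u assume "u \<in> carrier V0"
    then show "lact V0 \<one>\<^bsub>S0\<^esub> u = u" using lact_one_right[of u] by simp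
  next
    fix s r u assume "s \<in> carrier S0" "r \<in> carrier R0" "u \<in> carrier V0"
    then show "ract V0 (lact V0 s u) r = lact V0 s (ract V0 u r)"
      by (simp add: \<phi>_mult_invariant mult.assoc sum_distrib_right)
  qed (auto simp: algebra_simps)
qed

sublocale inv_skew: tensor_pair S0 U0 V0
  using bimodule.ract_closed[OF bimodule_left] bimodule.lact_closed[OF bimodule_right]
  by (intro tensor_pair.intro tensor_pair_axioms.intro abelian_group_left abelian_group_right) blast+

sublocale skew_inv: tensor_pair R0 V0 U0
  using bimodule.ract_closed[OF bimodule_right] bimodule.lact_closed[OF bimodule_left]
  by (intro tensor_pair.intro tensor_pair_axioms.intro abelian_group_left abelian_group_right) blast+

abbreviation "\<Gamma> \<equiv> Gamma_map G A \<alpha>"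
abbreviation "\<Gamma>' \<equiv> Gamma'_map G \<alpha>"
abbreviation "T0 \<equiv> tensor S0 U0 V0"
abbreviation "T0' \<equiv> tensor R0 V0 U0"
abbreviation "gam' a b \<equiv> (\<lambda>g. if g \<in> carrier G then a * \<phi> g b else 0)"

text \<open>In the summand at g, \<open>b\<close> is drawn into \<open>\<phi> (ginv G g)\<close> as
  \<open>\<phi> g b\<close>; the trace then removes the outer \<open>\<phi> (ginv G g)\<close> by
  \<open>tr_\<phi>\<close>.\<close>

lemma tr_balanced:
  assumes s: "s \<in> carrier S0" and ab: "a \<in> A" "b \<in> A"
  shows "tr G \<alpha> (ract U0 a s * b) = tr G \<alpha> (a * lact V0 s b)"
proof -
  have tr_sum: "tr G \<alpha> (\<Sum>g\<in>J. F g) = (\<Sum>g\<in>J. tr G \<alpha> (F g))" if "\<And>g. g \<in> J \<Longrightarrow> F g \<in> A" for J F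
    unfolding tr_def using that by (subst sum.swap) (simp add: \<phi>_sum)
  have "tr G \<alpha> (\<phi> (ginv G g) (a * s g) * b) = tr G \<alpha> (a * s g * \<phi> g b)" if g: "g \<in> carrier G" for g
  proof -
    have "\<phi> (ginv G g) (a * s g) * b = \<phi> (ginv G g) (a * s g) * b * e (ginv G g)"
      using s ab g by (intro B_mult_e[symmetric]) (auto simp del: \<phi>_closed intro: \<phi>_in_B)
    also have "\<dots> = \<phi> (ginv G g) (a * s g * \<phi> g b)"
      using \<phi>_mult[of "ginv G g" "a * s g" "\<phi> g b"] s ab g by (simp add: \<phi>_ginv mult.assoc[symmetric])
    finally have "\<phi> (ginv G g) (a * s g) * b = \<phi> (ginv G g) (a * s g * \<phi> g b)" .
    then show ?thesis using tr_\<phi>[of g "a * s g * \<phi> g b"] s ab g by (simp add: mult.assoc)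
  qed
  then show ?thesis
    using s ab by (simp add: sum_distrib_left sum_distrib_right tr_sum mult.assoc)
qed

lemma comm_group_R: "comm_group (add_monoid R0)"
  by (rule abelian_group.a_comm_group[OF ring.is_abelian_group[OF ring_inv_ring]])

lemma comm_group_S: "comm_group (add_monoid S0)"
  by (rule abelian_group.a_comm_group[OF ring.is_abelian_group[OF ring_skew_ring]])

lemma
  shows Gamma_hom: "\<Gamma> \<in> hom T0 (add_monoid R0)"
    and Gamma_tens [simp]: "\<lbrakk>a \<in> A; b \<in> A\<rbrakk> \<Longrightarrow> \<Gamma> (tens S0 U0 V0 a b) = tr G \<alpha> (a * b)"
proof -
  have *: "tr G \<alpha> (a * b) \<in> carrier (add_monoid R0)" if "a \<in> carrier U0" "b \<in> carrier V0" for a b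
    using that by (simp add: tr_invariant)
  have **: "tr G \<alpha> ((a \<oplus>\<^bsub>U0\<^esub> a') * b) = tr G \<alpha> (a * b) \<otimes>\<^bsub>add_monoid R0\<^esub> tr G \<alpha> (a' * b)"
    if "a \<in> carrier U0" "a' \<in> carrier U0" "b \<in> carrier V0" for a a' b
    using that by (simp add: distrib_right tr_add)
  have ***: "tr G \<alpha> (a * (b \<oplus>\<^bsub>V0\<^esub> b')) = tr G \<alpha> (a * b) \<otimes>\<^bsub>add_monoid R0\<^esub> tr G \<alpha> (a * b')"
    if "a \<in> carrier U0" "b \<in> carrier V0" "b' \<in> carrier V0" for a b b'
    using that by (simp add: distrib_left tr_add)
  have ****: "tr G \<alpha> (ract U0 a s * b) = tr G \<alpha> (a * lact V0 s b)"
    if "a \<in> carrier U0" "s \<in> carrier S0" "b \<in> carrier V0" for a s b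
    using that tr_balanced[of s a b] by (simp only: left_bimodule_simps right_bimodule_simps)
  note lift = inv_skew.tensor_lift_hom[OF comm_group_R * ** *** ****]
    inv_skew.tensor_lift_tens[OF comm_group_R * ** *** ****]
  show "\<Gamma> \<in> hom T0 (add_monoid R0)"
    unfolding Gamma_map_def tensor_map_eq_lift by (rule lift(1))
  show "\<Gamma> (tens S0 U0 V0 a b) = tr G \<alpha> (a * b)" if "a \<in> A" "b \<in> A"
    unfolding Gamma_map_def tensor_map_eq_lift by (rule lift(2)) (use that in auto)
qed

lemma gam'_closed: "\<lbrakk>a \<in> A; b \<in> A\<rbrakk> \<Longrightarrow> gam' a b \<in> carrier S0"
  by (auto simp: carrier_skew mult_in_B \<phi>_in_B)

lemma
  shows Gamma'_hom: "\<Gamma>' \<in> hom T0' (add_monoid S0)"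
    and Gamma'_tens [simp]: "\<lbrakk>a \<in> A; b \<in> A\<rbrakk> \<Longrightarrow> \<Gamma>' (tens R0 V0 U0 a b) = gam' a b"
proof -
  have *: "gam' a b \<in> carrier (add_monoid S0)" if "a \<in> carrier V0" "b \<in> carrier U0" for a b
    using that gam'_closed by simp
  have **: "gam' (a \<oplus>\<^bsub>V0\<^esub> a') b = gam' a b \<otimes>\<^bsub>add_monoid S0\<^esub> gam' a' b"
    if "a \<in> carrier V0" "a' \<in> carrier V0" "b \<in> carrier U0" for a a' b
    using that by (auto simp: distrib_right)
  have ***: "gam' a (b \<oplus>\<^bsub>U0\<^esub> b') = gam' a b \<otimes>\<^bsub>add_monoid S0\<^esub> gam' a b'"
    if "a \<in> carrier V0" "b \<in> carrier U0" "b' \<in> carrier U0" for a b b'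
    using that by (auto simp: distrib_left \<phi>_add)
  have ****: "gam' (ract V0 a r) b = gam' a (lact U0 r b)"
    if "a \<in> carrier V0" "r \<in> carrier R0" "b \<in> carrier U0" for a r b
    using that by (auto simp: \<phi>_mult_invariant mult.assoc)
  note lift = skew_inv.tensor_lift_hom[OF comm_group_S * ** *** ****]
    skew_inv.tensor_lift_tens[OF comm_group_S * ** *** ****]
  show "\<Gamma>' \<in> hom T0' (add_monoid S0)"
    unfolding Gamma'_map_def tensor_map_eq_lift by (rule lift(1))
  show "\<Gamma>' (tens R0 V0 U0 a b) = gam' a b" if "a \<in> A" "b \<in> A"
    unfolding Gamma'_map_def tensor_map_eq_lift by (rule lift(2)) (use that in auto)
qed

lemma gam'_left:
  assumes s: "s \<in> carrier S0" and ab: "a \<in> A" "b \<in> A"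
  shows "gam' (lact V0 s a) b = s \<otimes>\<^bsub>S0\<^esub> gam' a b"
proof (rule skew_ext)
  have la: "lact V0 s a \<in> A" using s ab by simp
  show "gam' (lact V0 s a) b \<in> carrier S0" by (rule gam'_closed[OF la ab(2)])
  show "s \<otimes>\<^bsub>S0\<^esub> gam' a b \<in> carrier S0" by (rule skew_mult_closed[OF s gam'_closed[OF ab]])
  fix k assume k: "k \<in> carrier G"
  have "gam' (lact V0 s a) b k = (\<Sum>g\<in>carrier G. s g * \<phi> g a * \<phi> k b)"
    using k by (simp add: sum_distrib_right)
  also have "\<dots> = (\<Sum>g\<in>into (tgt G k). s g * \<phi> g a * \<phi> k b)"
    using s ab k by (intro sum_only_into B_orth[where h=k]) (auto simp: mult_in_B skew_in_B \<phi>_in_B)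
  also have "\<dots> = (\<Sum>g\<in>into (tgt G k). s g * \<phi> g (gam' a b (cmp G (ginv G g) k)))"
  proof (rule sum.cong[OF refl])
    fix g assume g: "g \<in> into (tgt G k)"
    note sh = into_shift[OF k g]
    let ?h = "cmp G (ginv G g) k"
    have "s g * \<phi> g a \<in> B g" using s ab sh by (simp add: mult_in_B skew_in_B)
    then have "s g * \<phi> g a * \<phi> g (\<phi> ?h b) = s g * \<phi> g a * \<phi> k b"
      using \<phi>_comp_B[of g ?h b "s g * \<phi> g a"] sh ab by simp
    then show "s g * \<phi> g a * \<phi> k b = s g * \<phi> g (gam' a b ?h)"
      using sh ab by (simp add: \<phi>_mult mult.assoc)
  qed
  also have "\<dots> = (s \<otimes>\<^bsub>S0\<^esub> gam' a b) k"
    using k by (simp add: skew_mult)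
  finally show "gam' (lact V0 s a) b k = (s \<otimes>\<^bsub>S0\<^esub> gam' a b) k" .
qed

lemma gam'_right:
  assumes s: "s \<in> carrier S0" and ab: "a \<in> A" "b \<in> A"
  shows "gam' a (ract U0 b s) = gam' a b \<otimes>\<^bsub>S0\<^esub> s"
proof (rule skew_ext)
  have rb: "ract U0 b s \<in> A" using s ab by simp
  show "gam' a (ract U0 b s) \<in> carrier S0" by (rule gam'_closed[OF ab(1) rb])
  show "gam' a b \<otimes>\<^bsub>S0\<^esub> s \<in> carrier S0" by (rule skew_mult_closed[OF gam'_closed[OF ab] s])
  fix k assume k: "k \<in> carrier G"
  have bs: "b * s l \<in> B l" "b * s l \<in> A" if "l \<in> carrier G" for l
    using that s ab by (auto intro: mult_in_B simp: skew_in_B)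
  have "\<phi> k (ract U0 b s) = (\<Sum>l\<in>carrier G. \<phi> k (\<phi> (ginv G l) (b * s l)))"
    using s ab k by (simp add: \<phi>_sum)
  also have "\<dots> = (\<Sum>l\<in>{l \<in> carrier G. src G l = src G k}. \<phi> k (\<phi> (ginv G l) (b * s l)))"
  proof (rule sum_only_out)
    fix l assume "l \<in> carrier G" "src G l \<noteq> src G k"
    then show "\<phi> k (\<phi> (ginv G l) (b * s l)) = 0"
      using \<phi>_orth[of k "ginv G l"] \<phi>_in_B[of "ginv G l" "b * s l"] bs k by simp
  qed
  \<comment> \<open>The substitution is g = k l^-1, hence l = g^-1 k. The value of
    \<open>\<phi> g\<close> on \<open>b * s l\<close> lies in \<open>B k\<close>, which absorbs the
    factor \<open>e k\<close> from \<open>\<phi>_comp\<close>.\<close>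
  also have "\<dots> = (\<Sum>g\<in>into (tgt G k). \<phi> g (b * s (cmp G (ginv G g) k)))"
  proof (rule sum.reindex_bij_witness[of _ "\<lambda>g. cmp G (ginv G g) k" "\<lambda>l. cmp G k (ginv G l)"])
    fix l assume "l \<in> {l \<in> carrier G. src G l = src G k}"
    then have l: "l \<in> carrier G" "src G l = src G k" by auto
    have cl: "cmp G k (ginv G l) \<in> carrier G" "src G (cmp G k (ginv G l)) = tgt G l"
      using l k by (auto simp: cmp_closed src_cmp)
    show kl: "cmp G (ginv G (cmp G k (ginv G l))) k = l"
      using l k by (simp add: ginv_cmp cmp_assoc ginv_cmp_self cmp_obj_right)
    show "cmp G k (ginv G l) \<in> into (tgt G k)"
      using l k by (simp add: into_def cmp_closed tgt_cmp)
    have "\<phi> (cmp G k (ginv G l)) (b * s l) \<in> B (cmp G (cmp G k (ginv G l)) l)"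
      using \<phi>_in_B_cmp[OF cl(1) l(1) cl(2) bs(1)[OF l(1)]] .
    then have "\<phi> (cmp G k (ginv G l)) (b * s l) \<in> B k"
      using l k by simp
    then have "\<phi> (cmp G k (ginv G l)) (b * s l) * e k = \<phi> (cmp G k (ginv G l)) (b * s l)"
      using k by (simp add: B_absorb)
    then show "\<phi> (cmp G k (ginv G l)) (b * s (cmp G (ginv G (cmp G k (ginv G l))) k)) = \<phi> k (\<phi> (ginv G l) (b * s l))"
      using l k bs(2)[OF l(1)] by (simp add: kl \<phi>_comp)
  next
    fix g assume "g \<in> into (tgt G k)"
    then have g: "g \<in> carrier G" "tgt G g = tgt G k" by (auto simp: into_def)
    then show "cmp G (ginv G g) k \<in> {l \<in> carrier G. src G l = src G k}"
      using k by (auto simp: cmp_closed src_cmp)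
    show "cmp G k (ginv G (cmp G (ginv G g) k)) = g"
      using g k by (simp add: ginv_cmp)
  qed
  finally have eq: "\<phi> k (ract U0 b s) = (\<Sum>g\<in>into (tgt G k). \<phi> g (b * s (cmp G (ginv G g) k)))" .
  have "gam' a (ract U0 b s) k = (\<Sum>g\<in>into (tgt G k). a * \<phi> g (b * s (cmp G (ginv G g) k)))"
    using k eq by (simp only: sum_distrib_left if_True)
  also have "\<dots> = (gam' a b \<otimes>\<^bsub>S0\<^esub> s) k"
    unfolding skew_mult[OF k] using s ab into_shift[OF k]
    by (intro sum.cong refl) (simp add: \<phi>_mult mult.assoc)
  finally show "gam' a (ract U0 b s) k = (gam' a b \<otimes>\<^bsub>S0\<^esub> s) k" .
qed

text \<open>This is the compatibility law u \<Gamma>'(v (x) u') = \<Gamma>(u (x) v) u'. The inverse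
  undoes \<open>\<phi> g\<close> on \<open>u'\<close> up to an idempotent already contained in the
  other factor, and inversion permutes the morphisms.\<close>

lemma ract_gam':
  assumes "u \<in> A" "v \<in> A" "u' \<in> A"
  shows "ract U0 u (gam' v u') = tr G \<alpha> (u * v) * u'"
proof -
  have "ract U0 u (gam' v u') = (\<Sum>g\<in>carrier G. \<phi> (ginv G g) (u * v * \<phi> g u'))"
    using assms gam'_closed by (simp add: mult.assoc)
  also have "\<dots> = (\<Sum>g\<in>carrier G. \<phi> (ginv G g) (u * v) * u')"
  proof (rule sum.cong[OF refl])
    fix g assume "g \<in> carrier G"
    then show "\<phi> (ginv G g) (u * v * \<phi> g u') = \<phi> (ginv G g) (u * v) * u'"
      using B_mult_e[of "ginv G g" "\<phi> (ginv G g) (u * v)" u'] assms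
      by (simp add: \<phi>_mult[of _ "u * v"] \<phi>_ginv \<phi>_in_B mult.assoc[symmetric])
  qed
  also have "\<dots> = tr G \<alpha> (u * v) * u'"
    by (simp add: tr_def sum_distrib_right sum_ginv[of "\<lambda>g. \<phi> g (u * v) * u'"])
  finally show ?thesis .
qed

lemma morita_context: "morita_context R0 S0 U0 V0 \<Gamma> \<Gamma>'"
proof (intro morita_context.intro morita_context_axioms.intro bimodule_left bimodule_right
    Gamma_hom Gamma'_hom)
  fix r u v assume ruv: "r \<in> carrier R0" "u \<in> carrier U0" "v \<in> carrier V0"
  then have r: "r \<in> \<A>inv" "r \<in> A" and uv: "u \<in> A" "v \<in> A" by auto
  have tr1: "tr G \<alpha> (r * (u * v)) = r * tr G \<alpha> (u * v)" "tr G \<alpha> (u * v * r) = tr G \<alpha> (u * v) * r"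
    using r uv by (simp_all add: tr_def \<phi>_mult_invariant sum_distrib_left sum_distrib_right)
  then show "\<Gamma> (tens S0 U0 V0 (lact U0 r u) v) = r \<otimes>\<^bsub>R0\<^esub> \<Gamma> (tens S0 U0 V0 u v)"
    and "\<Gamma> (tens S0 U0 V0 u (ract V0 v r)) = \<Gamma> (tens S0 U0 V0 u v) \<otimes>\<^bsub>R0\<^esub> r"
    using r uv by (simp_all add: mult.assoc)
next
  fix s u v assume suv: "s \<in> carrier S0" "u \<in> carrier U0" "v \<in> carrier V0"
  have "lact V0 s v \<in> A" "ract U0 u s \<in> A" using suv by auto
  then show "\<Gamma>' (tens R0 V0 U0 (lact V0 s v) u) = s \<otimes>\<^bsub>S0\<^esub> \<Gamma>' (tens R0 V0 U0 v u)"
    and "\<Gamma>' (tens R0 V0 U0 v (ract U0 u s)) = \<Gamma>' (tens R0 V0 U0 v u) \<otimes>\<^bsub>S0\<^esub> s"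
    using suv gam'_left[of s v u] gam'_right[of s v u]
    by (simp_all only: Gamma'_tens left_bimodule_simps(1) right_bimodule_simps(1))
next
  fix u v u' assume "u \<in> carrier U0" "v \<in> carrier V0" "u' \<in> carrier U0"
  then show "ract U0 u (\<Gamma>' (tens R0 V0 U0 v u')) = lact U0 (\<Gamma> (tens S0 U0 V0 u v)) u'"
    using ract_gam'[of u v u'] by (simp del: left_bimodule_ract)
next
  fix v u v' assume "v \<in> carrier V0" "u \<in> carrier U0" "v' \<in> carrier V0"
  then show "ract V0 v (\<Gamma> (tens S0 U0 V0 u v')) = lact V0 (\<Gamma>' (tens R0 V0 U0 v u)) v'"
    by (simp add: tr_def \<phi>_mult sum_distrib_left mult.assoc)
qed

sublocale M: morita_context R0 S0 U0 V0 \<Gamma> \<Gamma>'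
  by (rule morita_context)

text \<open>Lists replace the indexed families of \<open>partial_galois\<close>: appending two lists
  adds tensors, and concatenation collects copies over all objects.\<close>

definition galois_coords :: "('a \<times> 'a) list \<Rightarrow> bool" where
  "galois_coords xs \<longleftrightarrow> set xs \<subseteq> A \<times> A \<and>
     (\<forall>g\<in>carrier G. (\<Sum>(a, b)\<leftarrow>xs. a * \<phi> g b) = (if g \<in> objs G then e g else 0))"

lemma partial_galois_iff_list: "partial_galois G A \<alpha> \<longleftrightarrow> (\<exists>xs. galois_coords xs)"
proof
  assume "partial_galois G A \<alpha>"
  then show "\<exists>xs. galois_coords xs"
    unfolding partial_galois_def
  proof (elim exE conjE)
    fix r :: nat and a b :: "nat \<Rightarrow> 'a"
    assume "\<forall>i\<in>{1..r}. a i \<in> A \<and> b i \<in> A"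
      "\<forall>g\<in>carrier G. (\<Sum>i=1..r. a i * \<phi> g (b i)) = (if g \<in> objs G then e g else 0)"
    then have "galois_coords (map (\<lambda>i. (a i, b i)) [1..<Suc r])"
      unfolding galois_coords_def
      by (auto simp: o_def interv_sum_list_conv_sum_set_nat atLeastLessThanSuc_atLeastAtMost
          simp del: upt_Suc)
    then show ?thesis ..
  qed
next
  assume "\<exists>xs. galois_coords xs"
  then obtain xs where xs: "galois_coords xs" ..
  \<comment> \<open>The pair of zeros changes no sum and makes the length at least 1, as
    \<open>partial_galois\<close> requires.\<close>
  let ?ys = "(0, 0) # xs"
  have ys: "galois_coords ?ys"
    using xs by (simp add: galois_coords_def)
  let ?a = "\<lambda>i. fst (?ys ! (i - 1))" and ?b = "\<lambda>i. snd (?ys ! (i - 1))"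
  have "?ys ! (i - 1) \<in> A \<times> A" if "i \<in> {1..length ?ys}" for i
    using ys that nth_mem[of "i - 1" ?ys] unfolding galois_coords_def by fastforce
  moreover have "(\<Sum>i=1..length ?ys. ?a i * \<phi> g (?b i)) = (\<Sum>(a, b)\<leftarrow>?ys. a * \<phi> g b)" for g
    using sum_nth_pred[of "\<lambda>p. fst p * \<phi> g (snd p)" ?ys] by (simp only: case_prod_beta')
  ultimately show "partial_galois G A \<alpha>"
    unfolding partial_galois_def using ys
    by (intro exI[of _ "length ?ys"] exI[of _ ?a] exI[of _ ?b] conjI)
      (auto simp: galois_coords_def mem_Times_iff simp del: sum.atLeast1_atMost_eq)
qed

text \<open>Every tensor is a sum of elementary ones, hence given by a list of pairs. That the
  identity of the skew ring is attained then reads literally as the condition in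
  \<open>galois_coords\<close>.\<close>

lemma Gamma'_image:
  "\<Gamma>' ` carrier T0' = (\<lambda>xs g. if g \<in> carrier G then (\<Sum>(a, b)\<leftarrow>xs. a * \<phi> g b) else 0) ` {xs. set xs \<subseteq> A \<times> A}"
    (is "_ = ?f ` ?L")
proof (intro equalityI subsetI)
  fix y assume "y \<in> \<Gamma>' ` carrier T0'"
  then obtain X where X: "X \<in> carrier T0'" and y: "y = \<Gamma>' X" by blast
  from X have "\<Gamma>' X \<in> ?f ` ?L"
  proof (induction rule: skew_inv.tensor_induct)
    case (tens u v)
    then show ?case by (intro image_eqI[of _ _ "[(u, v)]"]) auto
  next
    case (mult X Y)
    then obtain xs ys where "xs \<in> ?L" "ys \<in> ?L" "\<Gamma>' X = ?f xs" "\<Gamma>' Y = ?f ys" by blast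
    then show ?case
      using hom_mult[OF Gamma'_hom mult(1,2)] by (intro image_eqI[of _ _ "xs @ ys"]) auto
  qed
  with y show "y \<in> ?f ` ?L" by simp
next
  interpret T: comm_group T0' by (rule skew_inv.comm_group_tensor)
  fix y assume "y \<in> ?f ` ?L"
  then obtain xs where "set xs \<subseteq> A \<times> A" "y = ?f xs" by blast
  moreover from this(1) have "?f xs \<in> \<Gamma>' ` carrier T0'"
  proof (induction xs)
    case Nil
    have "\<Gamma>' \<one>\<^bsub>T0'\<^esub> = (\<lambda>g. 0)"
      using hom_one[OF Gamma'_hom T.is_group] comm_group_S by (simp add: comm_group_def)
    also have "\<dots> = ?f []"
      by (rule ext) simp
    finally have "\<Gamma>' \<one>\<^bsub>T0'\<^esub> = ?f []" .
    then show ?case by (rule image_eqI[OF sym T.one_closed])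
  next
    case (Cons p xs)
    then obtain a b X where p: "p = (a, b)" "a \<in> A" "b \<in> A" and X: "X \<in> carrier T0'" "\<Gamma>' X = ?f xs"
      by auto
    have "?f (p # xs) = \<Gamma>' (tens R0 V0 U0 a b \<otimes>\<^bsub>T0'\<^esub> X)"
      using p X hom_mult[OF Gamma'_hom, of "tens R0 V0 U0 a b" X] skew_inv.tens_closed[of a b] by auto
    then show ?case
      using p X skew_inv.tens_closed[of a b] by (simp only:) (intro imageI T.m_closed; simp)
  qed
  ultimately show "y \<in> \<Gamma>' ` carrier T0'" by simp
qed

lemma partial_galois_iff: "partial_galois G A \<alpha> \<longleftrightarrow> \<one>\<^bsub>S0\<^esub> \<in> \<Gamma>' ` carrier T0'"
  unfolding partial_galois_iff_list galois_coords_def Gamma'_image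
  by (auto simp: image_iff fun_eq_iff)

text \<open>Additivity of the trace merges the traces of the products of a sum of tensors into one;
  conversely the trace of \<open>a\<close> comes from a (x) 1.\<close>

lemma Gamma_image: "\<Gamma> ` carrier T0 = tr G \<alpha> ` A"
proof (intro equalityI subsetI)
  fix y assume "y \<in> \<Gamma> ` carrier T0"
  then obtain X where X: "X \<in> carrier T0" and y: "y = \<Gamma> X" by blast
  from X have "\<Gamma> X \<in> tr G \<alpha> ` A"
  proof (induction rule: inv_skew.tensor_induct)
    case (tens u v)
    then show ?case by simp
  next
    case (mult X Y)
    then obtain a b where "a \<in> A" "b \<in> A" "\<Gamma> X = tr G \<alpha> a" "\<Gamma> Y = tr G \<alpha> b" by blast
    then show ?case
      using hom_mult[OF Gamma_hom mult(1,2)] by (intro image_eqI[of _ _ "a + b"]) (auto simp: tr_add)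
  qed
  with y show "y \<in> tr G \<alpha> ` A" by simp
next
  fix y assume "y \<in> tr G \<alpha> ` A"
  then obtain a where "a \<in> A" "y = tr G \<alpha> a" by blast
  then show "y \<in> \<Gamma> ` carrier T0"
    using inv_skew.tens_closed[of a "unity A"] by (intro image_eqI[of _ _ "tens S0 U0 V0 a (unity A)"]) auto
qed

theorem galois_iff_strict:
  "partial_galois G A \<alpha> \<and> tr G \<alpha> ` A = \<A>inv \<longleftrightarrow> galois_morita_strict G A \<alpha>"
proof -
  have "tr G \<alpha> ` A = \<A>inv \<longleftrightarrow> \<one>\<^bsub>R0\<^esub> \<in> \<Gamma> ` carrier T0"
    using M.mu_surj_if_one unity_A_inv by (auto simp: Gamma_image)
  then show ?thesis
    unfolding galois_morita_strict_def M.strict_iff partial_galois_iff by blast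
qed

end

section \<open>Reduction to the isotropy group\<close>

lemma isotropy_simps [simp]:
  "carrier (isotropy G x) = homset G x x" "src (isotropy G x) = src G" "tgt (isotropy G x) = tgt G"
  "cmp (isotropy G x) = cmp G"
  by (simp_all add: isotropy_def)

context groupoid
begin

lemma in_homset [simp]: "g \<in> homset G y z \<longleftrightarrow> g \<in> carrier G \<and> src G g = y \<and> tgt G g = z"
  by (simp add: homset_def)

lemma groupoid_isotropy:
  assumes x: "x \<in> objs G"
  shows "groupoid (isotropy G x)"
proof (rule groupoid.intro)
  show "\<exists>h\<in>carrier (isotropy G x). src (isotropy G x) h = tgt (isotropy G x) g \<and>
      tgt (isotropy G x) h = src (isotropy G x) g \<and> cmp (isotropy G x) h g = src (isotropy G x) g \<and>
      cmp (isotropy G x) g h = tgt (isotropy G x) g"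
    if "g \<in> carrier (isotropy G x)" for g
    using that by (intro bexI[of _ "ginv G g"]) (auto simp: ginv_cmp_self cmp_ginv_self)
qed (use x in \<open>auto simp: cmp_closed src_cmp tgt_cmp cmp_obj_left cmp_obj_right cmp_assoc\<close>)

text \<open>\<open>ginv\<close> is a description relative to the carrier, so its value has to be
  compared after shrinking the carrier.\<close>

lemma ginv_isotropy:
  assumes "x \<in> objs G" "h \<in> homset G x x"
  shows "ginv (isotropy G x) h = ginv G h"
  by (rule groupoid.ginv_unique[OF groupoid_isotropy[OF assms(1)]])
    (use assms in \<open>auto simp: ginv_cmp_self\<close>)

lemma objs_isotropy: "x \<in> objs G \<Longrightarrow> objs (isotropy G x) = {x}"
  by (auto simp: objs_def simp del: objsD)

end

text \<open>The isotropy group has a single object, so this is its decomposition hypothesis.\<close>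

lemma direct_sum_singleton: "direct_sum {i} X (X i)"
  unfolding direct_sum_def
proof (rule bij_betw_imageI)
  show "inj_on (\<lambda>f. \<Sum>j\<in>{i}. f j) (Pi\<^sub>E {i} X)"
    by (rule inj_onI, rule PiE_ext) auto
  show "(\<lambda>f. \<Sum>j\<in>{i}. f j) ` Pi\<^sub>E {i} X = X i"
  proof (intro equalityI subsetI)
    fix a assume "a \<in> X i"
    then show "a \<in> (\<lambda>f. \<Sum>j\<in>{i}. f j) ` Pi\<^sub>E {i} X"
      by (intro image_eqI[of _ _ "\<lambda>j\<in>{i}. a"]) auto
  qed auto
qed

locale tau_global_action = unital_action G A \<alpha>
  for G :: "('g, 'm) groupoid_scheme" and A :: "'a::ring set" and \<alpha> :: "'g \<Rightarrow> 'a \<rightharpoonup> 'a" +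
  fixes x :: 'g and \<tau> :: "'g \<Rightarrow> 'g"
  assumes x_obj [simp]: "x \<in> objs G"
    and transversal: "transversal G x \<tau>"
    and tau_global: "tau_global G x \<tau> \<alpha>"
begin

abbreviation "H \<equiv> isotropy G x"

text \<open>\<open>act\<close> sees the groupoid only through \<open>ginv\<close>; hence one family
  \<phi> serves both groupoids and their traces can be compared term by term.\<close>

lemma act_isotropy [simp]: "h \<in> homset G x x \<Longrightarrow> act H \<alpha> h = \<phi> h"
  by (simp add: fun_eq_iff act_def ginv_isotropy)

lemma unital_action_isotropy: "unital_action H (B x) \<alpha>"
proof (intro unital_action.intro unital_action_axioms.intro groupoid_isotropy x_obj)
  show "finite (carrier H)"
    using finite_G by (rule finite_subset[rotated]) auto
  show "is_ideal (B x) (B x)"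
    using ideal_B[of x] B_sub_A[of x] by (auto simp: is_ideal_def)
  moreover have "is_ideal (B h) (B x)" if "h \<in> carrier G" "src G h = x" "tgt G h = x" for h
  proof -
    have "is_ideal (B h) (B (tgt G h))"
      using action that unfolding partial_action_def by blast
    then show ?thesis using that by simp
  qed
  ultimately show "partial_action H (B x) \<alpha>"
    using action by (auto simp: partial_action_def objs_isotropy ginv_isotropy)
  show "direct_sum (objs H) B (B x)"
    unfolding objs_isotropy[OF x_obj] by (rule direct_sum_singleton)
qed (auto intro: unital)

sublocale X: unital_action H "B x" \<alpha>
  by (rule unital_action_isotropy)

section \<open>Strict composition along the transversal\<close>

lemma \<tau>_simps [simp]:
  assumes "y \<in> objs G"
  shows "\<tau> y \<in> carrier G" "src G (\<tau> y) = x" "tgt G (\<tau> y) = y"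
  using transversal assms by (auto simp: transversal_def)

lemma \<tau>_x [simp]: "\<tau> x = x"
  using transversal by (simp add: transversal_def)

lemma B_\<tau>: "y \<in> objs G \<Longrightarrow> B (\<tau> y) = B y" "y \<in> objs G \<Longrightarrow> B (ginv G (\<tau> y)) = B x"
  using tau_global by (auto simp: tau_global_def)

lemma e_\<tau> [simp]: "y \<in> objs G \<Longrightarrow> e (\<tau> y) = e y" "y \<in> objs G \<Longrightarrow> e (ginv G (\<tau> y)) = e x"
  by (simp_all add: idem_def B_\<tau>)

lemma \<phi>_e_src [simp]: "g \<in> carrier G \<Longrightarrow> \<phi> g (e (src G g)) = e g"
  using \<phi>_idem[of g "src G g"] by (simp add: tgt_src cmp_src)

lemma \<phi>_e_tgt:
  assumes "g \<in> carrier G" "a \<in> A"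
  shows "\<phi> g a * e (tgt G g) = \<phi> g a"
proof -
  have "\<phi> g a * e (tgt G g) = \<phi> g a * (e g * e (tgt G g))"
    using assms by (simp only: mult.assoc[symmetric] \<phi>_e)
  then show ?thesis using assms by simp
qed

text \<open>By \<open>\<phi>_idem\<close>,
  \<open>\<phi> g (e (\<tau> y)) = e g * e (cmp G g (\<tau> y))\<close>. Globality turns
  \<open>e (\<tau> y)\<close> into \<open>e y\<close>, whose image is \<open>e g\<close>; so
  \<open>e g\<close> is below the other idempotent. Composing back with the inverse of
  \<open>\<tau> y\<close> gives the reverse inequality.\<close>

lemma e_cmp_\<tau>:
  assumes "g \<in> carrier G" "src G g = y"
  shows "e (cmp G g (\<tau> y)) = e g"
proof -
  let ?k = "cmp G g (\<tau> y)"
  have y: "y \<in> objs G" using assms by auto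
  have k: "?k \<in> carrier G" "src G ?k = x" using assms y by (simp_all add: cmp_closed src_cmp)
  have "e g = e g * e ?k"
    using \<phi>_idem[of g "\<tau> y"] \<phi>_e_src[of g] assms y by simp
  moreover have "e ?k = e ?k * e g"
    using \<phi>_idem[of ?k "ginv G (\<tau> y)"] \<phi>_e_src[of ?k] assms y k by simp
  ultimately show ?thesis
    using e_central[of g "e ?k"] assms k by simp
qed

lemma e_cmp_ginv_\<tau>:
  assumes "h \<in> carrier G" "src G h = x" "y \<in> objs G"
  shows "e (cmp G h (ginv G (\<tau> y))) = e h"
  using e_cmp_\<tau>[of "cmp G h (ginv G (\<tau> y))" y] assms by (simp add: cmp_closed src_cmp)

lemma \<phi>_\<tau>_right:
  assumes "g \<in> carrier G" "src G g = y" "a \<in> A"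
  shows "\<phi> g (\<phi> (\<tau> y) a) = \<phi> (cmp G g (\<tau> y)) a"
proof -
  have "y \<in> objs G" using assms by auto
  then show ?thesis
    using \<phi>_comp[of g "\<tau> y" a] e_cmp_\<tau>[of g y] \<phi>_e[of "cmp G g (\<tau> y)" a] assms by (simp add: cmp_closed)
qed

lemma \<phi>_ginv_\<tau>_right:
  assumes "h \<in> carrier G" "src G h = x" "y \<in> objs G" "a \<in> A"
  shows "\<phi> h (\<phi> (ginv G (\<tau> y)) a) = \<phi> (cmp G h (ginv G (\<tau> y))) a"
  using \<phi>_comp[of h "ginv G (\<tau> y)" a] e_cmp_ginv_\<tau>[of h y] \<phi>_e[of "cmp G h (ginv G (\<tau> y))" a] assms
  by (simp add: cmp_closed)

lemma \<phi>_\<tau>_left: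
  assumes "h \<in> carrier G" "tgt G h = x" "y \<in> objs G" "a \<in> A"
  shows "\<phi> (\<tau> y) (\<phi> h a) = \<phi> (cmp G (\<tau> y) h) a"
proof -
  let ?k = "cmp G (\<tau> y) h"
  have k: "?k \<in> carrier G" "tgt G ?k = y" using assms by (simp_all add: cmp_closed tgt_cmp)
  then show ?thesis
    using \<phi>_comp[of "\<tau> y" h a] \<phi>_e_tgt[of ?k a] assms by simp
qed

lemma loop_at_simps:
  assumes "g \<in> carrier G"
  shows "loop_at G \<tau> g \<in> carrier G" "src G (loop_at G \<tau> g) = x" "tgt G (loop_at G \<tau> g) = x"
    "cmp G (\<tau> (tgt G g)) (loop_at G \<tau> g) = cmp G g (\<tau> (src G g))"
  using assms by (simp_all add: loop_at_def cmp_closed src_cmp tgt_cmp cmp_assoc)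

lemma \<phi>_via_loop:
  assumes "g \<in> carrier G" "a \<in> A"
  shows "\<phi> g (\<phi> (\<tau> (src G g)) a) = \<phi> (\<tau> (tgt G g)) (\<phi> (loop_at G \<tau> g) a)"
  using assms loop_at_simps[of g] by (simp add: \<phi>_\<tau>_right \<phi>_\<tau>_left)

text \<open>This matches the two Kronecker conditions: an endomorphism is an identity exactly when
  its conjugate at \<open>x\<close> is.\<close>

lemma loop_at_eq_x_iff:
  assumes "g \<in> carrier G" "tgt G g = src G g"
  shows "loop_at G \<tau> g = x \<longleftrightarrow> g \<in> objs G"
proof
  assume "loop_at G \<tau> g = x"
  then have "cmp G g (\<tau> (src G g)) = \<tau> (src G g)"
    using loop_at_simps(4)[of g] assms by (simp add: cmp_obj_right)
  then have "g = cmp G (\<tau> (src G g)) (ginv G (\<tau> (src G g)))"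
    using cmp_cmp_ginv[of g "\<tau> (src G g)"] assms by simp
  also have "\<dots> = src G g"
    using assms by (simp add: cmp_ginv_self)
  finally show "g \<in> objs G" using assms src_in_objs by metis
next
  assume "g \<in> objs G"
  then show "loop_at G \<tau> g = x"
    by (simp add: loop_at_def cmp_obj_right ginv_cmp_self)
qed

section \<open>Transport of Galois coordinates\<close>

lemma \<phi>_sum_list:
  "\<lbrakk>g \<in> carrier G; \<And>p. p \<in> set xs \<Longrightarrow> F p \<in> A\<rbrakk> \<Longrightarrow> \<phi> g (\<Sum>p\<leftarrow>xs. F p) = (\<Sum>p\<leftarrow>xs. \<phi> g (F p))"
proof (induction xs)
  case (Cons p xs)
  have "F q \<in> A" if "q \<in> set xs" for q
    using Cons.prems that by simp
  then have "(\<Sum>p\<leftarrow>xs. F p) \<in> A"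
    by (induction xs) auto
  with Cons show ?case by (simp add: \<phi>_add)
qed simp

text \<open>For a loop h at \<open>x\<close>, \<open>\<phi> h (b * e x) = \<phi> h b\<close>; as
  \<open>e x\<close> is central, cutting down all pairs only multiplies the sum by
  \<open>e x\<close>.\<close>

lemma galois_coords_isotropy:
  assumes "galois_coords xs"
  shows "X.galois_coords (map (\<lambda>(a, b). (a * e x, b * e x)) xs)"
proof -
  have xs: "set xs \<subseteq> A \<times> A"
    and sum: "(\<Sum>(a, b)\<leftarrow>xs. a * \<phi> h b) = (if h \<in> objs G then e h else 0)" if "h \<in> carrier G" for h
    using assms that by (auto simp: galois_coords_def)
  have "(\<Sum>(a, b)\<leftarrow>xs. a * e x * \<phi> h (b * e x)) = (if h = x then e x else 0)"
    if h: "h \<in> homset G x x" for h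
  proof -
    have "(\<Sum>(a, b)\<leftarrow>xs. a * e x * \<phi> h (b * e x)) = (\<Sum>(a, b)\<leftarrow>xs. a * \<phi> h b * e x)"
    proof (rule arg_cong[of _ _ sum_list], rule map_cong[OF refl], clarify)
      fix a b assume "(a, b) \<in> set xs"
      then have ab: "a \<in> A" "b \<in> A" using xs[OF x_obj[THEN objsD(1)]] by auto
      have "\<phi> h (b * e x) = \<phi> h b"
        using h ab \<phi>_e_src[of h] by (simp add: \<phi>_mult)
      then show "a * e x * \<phi> h (b * e x) = a * \<phi> h b * e x"
        using h ab by (simp add: mult.assoc e_central)
    qed
    also have "\<dots> = (\<Sum>(a, b)\<leftarrow>xs. a * \<phi> h b) * e x"
      by (simp add: sum_list_mult_const[symmetric] case_prod_beta')
    also have "\<dots> = (if h = x then e x else 0)"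
      using h sum[of h] by auto
    finally show ?thesis .
  qed
  moreover have "(a * e x, b * e x) \<in> B x \<times> B x" if "(a, b) \<in> set xs" for a b
    using xs[of x] that by (auto simp: restrict_in_B)
  ultimately show ?thesis
    unfolding X.galois_coords_def
    by (auto simp: objs_isotropy o_def case_prod_beta')
qed

text \<open>At g only the block of pairs at y = \<open>src G g\<close> = \<open>tgt G g\<close>
  contributes. There conjugation turns the sum into the image under \<open>\<phi> (\<tau> y)\<close>
  of the sum for the loop of g.\<close>

lemma galois_coords_spread:
  assumes xs: "X.galois_coords xs" and ys: "set ys = objs G" "distinct ys"
  shows "galois_coords (concat (map (\<lambda>y. map (\<lambda>(a, b). (\<phi> (\<tau> y) a, \<phi> (\<tau> y) b)) xs) ys))"
    (is "galois_coords ?zs")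
proof -
  have BA: "a \<in> A" if "a \<in> B x" for a using that B_sub_A[of x] by simp
  have in_A: "a \<in> A \<and> b \<in> A" if "(a, b) \<in> set xs" for a b
    using xs that BA by (auto simp: X.galois_coords_def)
  have sum: "(\<Sum>(a, b)\<leftarrow>xs. a * \<phi> h b) = (if h = x then e x else 0)" if "h \<in> homset G x x" for h
    using xs that by (auto simp: X.galois_coords_def objs_isotropy)
  have "(\<Sum>(a, b)\<leftarrow>?zs. a * \<phi> g b) = (if g \<in> objs G then e g else 0)" if g: "g \<in> carrier G" for g
  proof -
    let ?s = "src G g"
    let ?F = "\<lambda>y. \<Sum>(a, b)\<leftarrow>xs. \<phi> (\<tau> y) a * \<phi> g (\<phi> (\<tau> y) b)"
    \<comment> \<open>If y is not the source of g, \<open>\<phi> g\<close> kills the second entry;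
      if it is the source but not the target, the two factors lie in orthogonal ideals.\<close>
    have zero: "?F y = 0" if y: "y \<in> objs G" "y \<noteq> ?s \<or> tgt G g \<noteq> y" for y
    proof -
      have "\<phi> (\<tau> y) a * \<phi> g (\<phi> (\<tau> y) b) = 0" if "(a, b) \<in> set xs" for a b
      proof (cases "y = ?s")
        case False
        then have "\<phi> g (\<phi> (\<tau> y) b) = 0"
          using y g in_A[OF that] by (intro \<phi>_orth[of g "\<tau> y"]) (auto simp: \<phi>_in_B)
        then show ?thesis by simp
      next
        case True
        then show ?thesis
          using y g in_A[OF that] by (intro B_orth[of "\<tau> y" g]) (auto simp: \<phi>_in_B)
      qed
      then have "?F y = (\<Sum>p\<leftarrow>xs. 0)"
        by (intro arg_cong[of _ _ sum_list] map_cong refl) auto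
      then show ?thesis by simp
    qed
    have "(\<Sum>(a, b)\<leftarrow>?zs. a * \<phi> g b) = (\<Sum>y\<leftarrow>ys. ?F y)"
      by (induction ys) (simp_all add: o_def case_prod_beta')
    also have "\<dots> = (\<Sum>y\<in>objs G. ?F y)"
      using ys by (simp add: sum_list_distinct_conv_sum_set)
    also have "\<dots> = (\<Sum>y\<in>objs G. if y = ?s then ?F ?s else 0)"
      using zero by (intro sum.cong) auto
    also have "\<dots> = ?F ?s"
      using g by simp
    also have "\<dots> = (if g \<in> objs G then e g else 0)"
    proof (cases "tgt G g = ?s")
      case False
      then show ?thesis using zero[of ?s] g by auto
    next
      case True
      let ?h = "loop_at G \<tau> g"
      note h = loop_at_simps[OF g]
      have "?F ?s = (\<Sum>(a, b)\<leftarrow>xs. \<phi> (\<tau> ?s) (a * \<phi> ?h b))"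
        using in_A g h True
        by (intro arg_cong[of _ _ sum_list] map_cong refl) (auto simp: \<phi>_via_loop \<phi>_mult)
      also have "\<dots> = \<phi> (\<tau> ?s) (\<Sum>(a, b)\<leftarrow>xs. a * \<phi> ?h b)"
        using in_A g h by (subst \<phi>_sum_list) (auto simp: case_prod_beta')
      also have "\<dots> = (if ?h = x then \<phi> (\<tau> ?s) (e x) else 0)"
        using sum[of ?h] h g by auto
      also have "\<dots> = (if g \<in> objs G then e g else 0)"
        using loop_at_eq_x_iff[OF g True] \<phi>_e_src[of "\<tau> ?s"] g by auto
      finally show ?thesis .
    qed
    finally show ?thesis .
  qed
  then show ?thesis
    using in_A ys unfolding galois_coords_def by auto
qed

lemma partial_galois_isotropy_iff: "partial_galois G A \<alpha> \<longleftrightarrow> partial_galois H (B x) \<alpha>"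
  using galois_coords_isotropy galois_coords_spread finite_distinct_list[OF finite_objs]
  unfolding partial_galois_iff_list X.partial_galois_iff_list by blast

section \<open>Comparison of the traces\<close>

lemma invariant_determined:
  assumes c: "c \<in> \<A>inv" and d: "d \<in> \<A>inv" and eq: "c * e x = d * e x"
  shows "c = d"
proof (rule eq_if_eq_on_objs)
  fix y assume y: "y \<in> objs G"
  \<comment> \<open>Globality identifies \<open>e y\<close> with \<open>e (\<tau> y)\<close>, and
    invariance at \<open>\<tau> y\<close> gives
    \<open>a * e (\<tau> y) = \<phi> (\<tau> y) a\<close>; only the part of \<open>a\<close> at
    \<open>x\<close> matters here.\<close>
  have "a * e y = \<phi> (\<tau> y) (a * e x)" if "a \<in> \<A>inv" for a
    using that y \<phi>_restrict[of "\<tau> y" a] by (simp add: invariants_iff)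
  then show "c * e y = d * e y" using c d eq by simp
qed (use c d in auto)

lemma tr_e_x: "a \<in> A \<Longrightarrow> tr G \<alpha> a * e x = (\<Sum>g\<in>into x. \<phi> g a)"
proof -
  assume a: "a \<in> A"
  have "\<phi> g a * e x = \<phi> g a" if "g \<in> into x" for g
    using that a \<phi>_e_tgt[of g a] by (auto simp: into_def)
  then show ?thesis using tr_e[of x a] a by (simp add: sum_distrib_right)
qed

text \<open>The component of an invariant at \<open>x\<close> is the isotropy trace of some
  \<open>a\<close> in \<open>B x\<close>. On this \<open>a\<close> the two traces agree at
  \<open>x\<close>, because morphisms into \<open>x\<close> from other objects kill it, and the
  component at \<open>x\<close> decides.\<close>

lemma tr_onto_if_isotropy:
  assumes onto: "tr H \<alpha> ` B x = invariants H (B x) \<alpha>"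
  shows "tr G \<alpha> ` A = \<A>inv"
proof (intro equalityI subsetI)
  fix c assume c: "c \<in> \<A>inv"
  then have cA: "c \<in> A" by simp
  have "\<phi> h (c * e x) = c * e x * e h" if h: "h \<in> homset G x x" for h
    using h c cA \<phi>_e_src[of h] e_tgt[of h] e_central[of x "e h"]
    by (simp add: \<phi>_mult invariants_iff mult.assoc)
  then have "c * e x \<in> invariants H (B x) \<alpha>"
    using cA by (simp add: X.invariants_iff restrict_in_B)
  then obtain a where a: "a \<in> B x" "c * e x = tr H \<alpha> a"
    using onto by (metis (no_types, lifting) imageE)
  have aA: "a \<in> A" using a(1) B_sub_A[of x] by simp
  have "tr G \<alpha> a * e x = (\<Sum>g\<in>into x. \<phi> g a)"
    using aA by (rule tr_e_x)
  also have "\<dots> = (\<Sum>g\<in>homset G x x. \<phi> g a)"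
  proof (rule sum.mono_neutral_right[OF finite_into])
    show "\<forall>g\<in>into x - homset G x x. \<phi> g a = 0"
      using a by (auto simp: into_def intro!: \<phi>_orth[of _ x])
  qed (auto simp: into_def)
  also have "\<dots> = c * e x"
    using a by (simp add: tr_def)
  finally have "tr G \<alpha> a = c"
    using invariant_determined[OF tr_invariant[OF aA] c] by simp
  then show "c \<in> tr G \<alpha> ` A" using aA by blast
qed (auto simp: tr_invariant)

text \<open>On invariants of the isotropy group this inverts restriction to the component at
  \<open>x\<close>: \<open>invariant_determined\<close> leaves no other choice for the component at
  y than \<open>\<phi> (\<tau> y) c\<close>.\<close>

definition spread :: "'a \<Rightarrow> 'a" where
  "spread c = (\<Sum>y\<in>objs G. \<phi> (\<tau> y) c)"

lemma spread_e:
  assumes "c \<in> A" "g \<in> carrier G"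
  shows "spread c * e g = \<phi> (\<tau> (tgt G g)) c * e g"
proof -
  have "spread c * e g = (\<Sum>y\<in>objs G. if y = tgt G g then \<phi> (\<tau> (tgt G g)) c * e g else 0)"
    unfolding spread_def sum_distrib_right
  proof (rule sum.cong[OF refl])
    fix y assume "y \<in> objs G"
    then show "\<phi> (\<tau> y) c * e g = (if y = tgt G g then \<phi> (\<tau> (tgt G g)) c * e g else 0)"
      using assms B_orth[of "\<tau> y" g "\<phi> (\<tau> y) c" "e g"] by (simp add: \<phi>_in_B e_in_B)
  qed
  then show ?thesis using assms by simp
qed

lemma \<phi>_spread:
  assumes "c \<in> A" "g \<in> carrier G"
  shows "\<phi> g (spread c) = \<phi> (\<tau> (tgt G g)) (\<phi> (loop_at G \<tau> g) c)"
proof -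
  have "\<phi> g (spread c) = (\<Sum>y\<in>objs G. if y = src G g then \<phi> g (\<phi> (\<tau> (src G g)) c) else 0)"
  proof -
    have "\<phi> g (spread c) = (\<Sum>y\<in>objs G. \<phi> g (\<phi> (\<tau> y) c))"
      using assms by (simp add: spread_def \<phi>_sum)
    also have "\<dots> = (\<Sum>y\<in>objs G. if y = src G g then \<phi> g (\<phi> (\<tau> (src G g)) c) else 0)"
    proof (rule sum.cong[OF refl])
      fix y assume "y \<in> objs G"
      then show "\<phi> g (\<phi> (\<tau> y) c) = (if y = src G g then \<phi> g (\<phi> (\<tau> (src G g)) c) else 0)"
        using assms \<phi>_orth[of g "\<tau> y" "\<phi> (\<tau> y) c"] by (simp add: \<phi>_in_B)
    qed
    finally show ?thesis .
  qed
  then show ?thesis using assms \<phi>_via_loop[of g c] by simp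
qed

lemma spread_invariant:
  assumes c: "c \<in> invariants H (B x) \<alpha>"
  shows "spread c \<in> \<A>inv"
proof -
  have cB: "c \<in> B x" and ch: "\<And>h. h \<in> homset G x x \<Longrightarrow> \<phi> h c = c * e h"
    using c by (auto simp: X.invariants_iff)
  have cA: "c \<in> A" using cB B_sub_A[of x] by simp
  have "\<phi> g (spread c) = spread c * e g" if g: "g \<in> carrier G" for g
  proof -
    note h = loop_at_simps[OF g]
    let ?t = "\<tau> (tgt G g)" and ?h = "loop_at G \<tau> g"
    \<comment> \<open>The composite of \<open>?t\<close> with \<open>?h\<close> is g composed with
      the transversal element at its source, and its idempotent is \<open>e g\<close> by
      \<open>e_cmp_\<tau>\<close>.\<close>
    have "\<phi> ?t (e ?h) = e (tgt G g) * e g"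
      using \<phi>_idem[of ?t ?h] g h e_cmp_\<tau>[of g] by simp
    then have "\<phi> ?t (c * e ?h) = \<phi> ?t c * e (tgt G g) * e g"
      using g h cA by (simp add: \<phi>_mult mult.assoc)
    also have "\<phi> ?t c * e (tgt G g) = \<phi> ?t c"
      using g cA \<phi>_e[of ?t c] by simp
    finally show ?thesis
      using g h cA ch[of ?h] by (simp add: \<phi>_spread spread_e)
  qed
  moreover have "spread c \<in> A" using cA by (simp add: spread_def)
  ultimately show ?thesis by (simp add: invariants_iff)
qed

text \<open>Every morphism into \<open>x\<close> is uniquely \<open>h\<tau>\<^sub>y\<inverse>\<close>, so the part of the trace at \<open>x\<close> is a trace of
  the isotropy group.\<close>

lemma sum_into_x:
  assumes a: "a \<in> A"
  shows "(\<Sum>g\<in>into x. \<phi> g a) = tr H \<alpha> (\<Sum>y\<in>objs G. \<phi> (ginv G (\<tau> y)) a)"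
proof -
  have "tr H \<alpha> (\<Sum>y\<in>objs G. \<phi> (ginv G (\<tau> y)) a)
      = (\<Sum>h\<in>homset G x x. \<Sum>y\<in>objs G. \<phi> (cmp G h (ginv G (\<tau> y))) a)"
    using a by (simp add: tr_def \<phi>_sum \<phi>_ginv_\<tau>_right)
  also have "\<dots> = (\<Sum>(h, y)\<in>homset G x x \<times> objs G. \<phi> (cmp G h (ginv G (\<tau> y))) a)"
    by (rule sum.cartesian_product)
  also have "\<dots> = (\<Sum>g\<in>into x. \<phi> g a)"
  proof (rule sum.reindex_bij_witness[of _ "\<lambda>g. (cmp G g (\<tau> (src G g)), src G g)"
        "\<lambda>(h, y). cmp G h (ginv G (\<tau> y))"])
    fix p assume "p \<in> homset G x x \<times> objs G"
    then obtain h y where "p = (h, y)" "h \<in> carrier G" "src G h = x" "tgt G h = x" "y \<in> objs G"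
      by auto
    then show "(cmp G (case p of (h, y) \<Rightarrow> cmp G h (ginv G (\<tau> y)))
          (\<tau> (src G (case p of (h, y) \<Rightarrow> cmp G h (ginv G (\<tau> y))))),
        src G (case p of (h, y) \<Rightarrow> cmp G h (ginv G (\<tau> y)))) = p"
      and "(case p of (h, y) \<Rightarrow> cmp G h (ginv G (\<tau> y))) \<in> into x"
      by (simp_all add: into_def src_cmp tgt_cmp cmp_closed)
  qed (auto simp: into_def cmp_closed src_cmp tgt_cmp)
  finally show ?thesis ..
qed

text \<open>Surjectivity for \<open>G\<close> is applied to \<open>spread c\<close>, whose component
  at \<open>x\<close> is \<open>c\<close>. The part at \<open>x\<close> of a trace of
  \<open>a\<close> is the isotropy trace of the sum of all components of \<open>a\<close> brought
  back to \<open>x\<close>.\<close>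

lemma isotropy_tr_onto:
  assumes onto: "tr G \<alpha> ` A = \<A>inv"
  shows "tr H \<alpha> ` B x = invariants H (B x) \<alpha>"
proof (intro equalityI subsetI)
  fix c assume c: "c \<in> invariants H (B x) \<alpha>"
  then have cB: "c \<in> B x" by (simp add: X.invariants_iff)
  then have cA: "c \<in> A" using B_sub_A[of x] by simp
  obtain a where a: "a \<in> A" "tr G \<alpha> a = spread c"
    using spread_invariant[OF c] onto by (metis (no_types, lifting) imageE)
  have "c = spread c * e x"
    using cA cB by (simp add: spread_e \<phi>_obj B_absorb)
  also have "\<dots> = tr H \<alpha> (\<Sum>y\<in>objs G. \<phi> (ginv G (\<tau> y)) a)"
    using tr_e_x[of a] a by (simp add: sum_into_x)
  finally show "c \<in> tr H \<alpha> ` B x"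
  proof (rule image_eqI)
    show "(\<Sum>y\<in>objs G. \<phi> (ginv G (\<tau> y)) a) \<in> B x"
    proof (rule B_sum)
      fix y assume "y \<in> objs G"
      then show "\<phi> (ginv G (\<tau> y)) a \<in> B x"
        using a \<phi>_in_B[of "ginv G (\<tau> y)" a] by (simp add: B_\<tau>)
    qed simp
  qed
next
  fix c assume "c \<in> tr H \<alpha> ` B x"
  then show "c \<in> invariants H (B x) \<alpha>" by (auto intro: X.tr_invariant)
qed

theorem galois_isotropy_iff:
  "partial_galois G A \<alpha> \<and> tr G \<alpha> ` A = \<A>inv \<longleftrightarrow>
    partial_galois H (B x) \<alpha> \<and> tr H \<alpha> ` B x = invariants H (B x) \<alpha>"
  using partial_galois_isotropy_iff tr_onto_if_isotropy isotropy_tr_onto by blast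

end

section \<open>Lifted partial actions\<close>

lemma dom_pid [simp]: "dom (pid R) = R"
  and ran_pid [simp]: "ran (pid R) = R"
  by (auto simp: pid_def restrict_map_def ran_def dom_def)

lemma pid_eq_Some [simp]: "pid R a = Some b \<longleftrightarrow> a \<in> R \<and> b = a"
  by (auto simp: pid_def restrict_map_def)

lemma pinv_eq_Some:
  assumes "inj_on f (dom f)"
  shows "pinv f b = Some a \<longleftrightarrow> f a = Some b"
proof -
  have "(THE a. f a = Some b) = a" if "f a = Some b" for a
    using that assms by (intro the_equality) (auto simp: inj_on_def dom_def)
  then show ?thesis
    by (auto simp: pinv_def ran_def)
qed

lemma prng_iso_inj_on:
  assumes "prng_iso f R S"
  shows "inj_on f (dom f)"
proof (rule inj_onI)
  fix a b assume "a \<in> dom f" "b \<in> dom f" "f a = f b"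
  then show "a = b"
    using assms unfolding prng_iso_def bij_betw_def inj_on_def by metis
qed

lemma prng_isoD:
  assumes "prng_iso f R S"
  shows "dom f = R" "inj_on (\<lambda>a. the (f a)) R" "(\<lambda>a. the (f a)) ` R = S"
    "\<lbrakk>a \<in> R; b \<in> R\<rbrakk> \<Longrightarrow> the (f (a + b)) = the (f a) + the (f b)"
    "\<lbrakk>a \<in> R; b \<in> R\<rbrakk> \<Longrightarrow> the (f (a * b)) = the (f a) * the (f b)"
    "a \<in> R \<Longrightarrow> f a = Some (the (f a))"
  using assms by (auto simp: prng_iso_def bij_betw_def)

lemma is_ideal_image:
  assumes f: "prng_iso f R S" and R: "is_ideal R R" and J: "is_ideal J R"
  shows "is_ideal ((\<lambda>a. the (f a)) ` J) S"
proof -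
  let ?f = "\<lambda>a. the (f a)"
  have sub: "J \<subseteq> R" and J0: "0 \<in> J" using J by (auto simp: is_ideal_def)
  have diff: "?f (a - b) = ?f a - ?f b" if "a \<in> R" "b \<in> R" for a b
    using prng_isoD(4)[OF f, of "a - b" b] that R by (simp add: is_ideal_def)
  have "0 = ?f 0" using diff[of 0 0] sub J0 by auto
  then have "0 \<in> ?f ` J" using J0 by blast
  moreover have "?f a - ?f b \<in> ?f ` J" if "a \<in> J" "b \<in> J" for a b
    using that sub J diff[of a b] by (metis image_eqI is_ideal_def subsetD)
  moreover have "s * ?f a \<in> ?f ` J \<and> ?f a * s \<in> ?f ` J" if s: "s \<in> S" and "a \<in> J" for s a
  proof -
    obtain r where r: "r \<in> R" "s = ?f r" using s prng_isoD(3)[OF f] by blast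
    then have "r * a \<in> J" "a * r \<in> J" using J that by (auto simp: is_ideal_def)
    then show ?thesis
      using r that sub prng_isoD(5)[OF f, of r a] prng_isoD(5)[OF f, of a r] by (metis image_eqI subsetD)
  qed
  ultimately show ?thesis
    using sub prng_isoD(3)[OF f] by (auto simp: is_ideal_def)
qed

lemma is_unity_image:
  assumes f: "prng_iso f R S" and "J \<subseteq> R" and "is_unity J u"
  shows "is_unity ((\<lambda>a. the (f a)) ` J) (the (f u))"
proof -
  have u: "u \<in> J" "\<And>a. a \<in> J \<Longrightarrow> u * a = a \<and> a * u = a"
    using assms by (auto simp: is_unity_def)
  have "the (f u) * the (f a) = the (f a) \<and> the (f a) * the (f u) = the (f a)" if "a \<in> J" for a
    using prng_isoD(5)[OF f, of u a] prng_isoD(5)[OF f, of a u] u assms(2) that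
    by (simp add: subset_eq)
  then show ?thesis
    using u(1) by (simp add: is_unity_def)
qed

text \<open>Here the datum is shown to supply a partial action with unital ideals. Globality makes
  every \<open>\<gamma>\<tau> y\<close> an isomorphism from \<open>I x\<close> onto
  \<open>I y\<close>, so \<beta> at g is a conjugate of the isotropy action at the loop of
  g.\<close>

locale lifted_datum = groupoid G for G :: "('g, 'm) groupoid_scheme" +
  fixes x :: 'g and \<tau> :: "'g \<Rightarrow> 'g" and A :: "'a::ring set" and I :: "'g \<Rightarrow> 'a set"
    and \<gamma>\<tau> \<gamma>x :: "'g \<Rightarrow> 'a \<rightharpoonup> 'a"
  assumes x_obj [simp]: "x \<in> objs G"
    and transversal: "transversal G x \<tau>"
    and datum: "datum G x \<tau> A I \<gamma>\<tau> \<gamma>x"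
    and global: "tau_global G x \<tau> (lifted G \<tau> I \<gamma>\<tau> \<gamma>x)"
begin

abbreviation "\<beta> \<equiv> lifted G \<tau> I \<gamma>\<tau> \<gamma>x"
abbreviation "l \<equiv> loop_at G \<tau>"

lemma \<tau>_simps [simp]:
  assumes "y \<in> objs G"
  shows "\<tau> y \<in> carrier G" "src G (\<tau> y) = x" "tgt G (\<tau> y) = y"
  using transversal assms by (auto simp: transversal_def)

lemma \<tau>_x [simp]: "\<tau> x = x"
  using transversal by (simp add: transversal_def)

lemma loop_closed [simp]:
  assumes "g \<in> carrier G"
  shows "l g \<in> carrier G" "src G (l g) = x" "tgt G (l g) = x"
  using assms by (simp_all add: loop_at_def cmp_closed src_cmp tgt_cmp)

lemma loop_obj [simp]: "y \<in> objs G \<Longrightarrow> l y = x"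
  by (simp add: loop_at_def cmp_obj_right ginv_cmp_self)

lemma loop_\<tau>:
  assumes "y \<in> objs G"
  shows "l (\<tau> y) = x" "l (ginv G (\<tau> y)) = x"
  using assms by (simp_all add: loop_at_def ginv_cmp_self cmp_obj_left cmp_obj_right)

lemma loop_ginv:
  assumes "g \<in> carrier G"
  shows "l (ginv G g) = ginv G (l g)"
  using assms by (simp add: loop_at_def ginv_cmp cmp_closed src_cmp tgt_cmp cmp_assoc)

text \<open>Forming loops is a functor to the isotropy group; composition for \<beta> is thereby
  reduced to composition for \<open>\<gamma>x\<close>.\<close>

lemma loop_cmp:
  assumes "g \<in> carrier G" "h \<in> carrier G" "src G g = tgt G h"
  shows "l (cmp G g h) = cmp G (l g) (l h)"
  using assms by (simp add: loop_at_def cmp_closed src_cmp tgt_cmp cmp_assoc)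

lemma \<gamma>x_x: "\<gamma>x x = pid (I x)" and \<gamma>\<tau>_x: "\<gamma>\<tau> x = pid (I x)"
  and I_ideal: "y \<in> objs G \<Longrightarrow> is_ideal (I y) A"
  and \<gamma>\<tau>_iso: "y \<in> objs G \<Longrightarrow> prng_iso (\<gamma>\<tau> y) (dom (\<gamma>\<tau> y)) (ran (\<gamma>\<tau> y))"
  and \<gamma>\<tau>_dom_sub: "y \<in> objs G \<Longrightarrow> dom (\<gamma>\<tau> y) \<subseteq> I x"
  using datum by (auto simp: datum_def is_ideal_def)

lemma \<gamma>x_action: "partial_action (isotropy G x) (I x) \<gamma>x"
  using datum by (simp add: datum_def group_partial_action_def)

lemma \<gamma>x_ideal:
  assumes "h \<in> homset G x x"
  shows "is_ideal (ran (\<gamma>x h)) (I x)"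
proof -
  have "is_ideal (ran (\<gamma>x h)) (ran (\<gamma>x (tgt G h)))"
    using \<gamma>x_action assms unfolding partial_action_def by simp
  then show ?thesis using assms by (simp add: \<gamma>x_x)
qed

lemma \<gamma>x_iso:
  assumes "h \<in> homset G x x"
  shows "prng_iso (\<gamma>x h) (ran (\<gamma>x (ginv G h))) (ran (\<gamma>x h))"
proof -
  have "prng_iso (\<gamma>x h) (ran (\<gamma>x (ginv (isotropy G x) h))) (ran (\<gamma>x h))"
    using \<gamma>x_action assms unfolding partial_action_def isotropy_simps by blast
  then show ?thesis by (simp only: ginv_isotropy[OF x_obj assms])
qed

lemma \<gamma>x_comp:
  assumes "g \<in> homset G x x" "h \<in> homset G x x"
  shows "(\<gamma>x g \<circ>\<^sub>m \<gamma>x h) \<subseteq>\<^sub>m \<gamma>x (cmp G g h)"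
  using \<gamma>x_action assms unfolding partial_action_def by simp

lemma \<gamma>\<tau>_inj: "y \<in> objs G \<Longrightarrow> inj_on (\<gamma>\<tau> y) (dom (\<gamma>\<tau> y))"
  using \<gamma>\<tau>_iso prng_iso_inj_on by blast

lemma \<beta>_obj: "y \<in> objs G \<Longrightarrow> \<beta> y = pid (I y)"
  by (simp add: lifted_def)

lemma \<beta>_nonobj_Some:
  assumes "g \<in> carrier G" "g \<notin> objs G"
  shows "\<beta> g b = Some c \<longleftrightarrow>
    (\<exists>a a'. \<gamma>\<tau> (src G g) a = Some b \<and> \<gamma>x (l g) a = Some a' \<and> \<gamma>\<tau> (tgt G g) a' = Some c)"
  using assms by (auto simp: lifted_def map_comp_Some_iff pinv_eq_Some \<gamma>\<tau>_inj)

text \<open>Globality is a hypothesis on \<beta>, not on the datum. The loops of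
  \<open>\<tau> y\<close> and of its inverse are \<open>x\<close>, where the datum consists of
  identity maps, so \<beta> there is \<open>\<gamma>\<tau> y\<close> or its inverse. The case y = x
  is separate because \<beta> has its own clause on objects.\<close>

lemma \<gamma>\<tau>_ran_dom:
  assumes y: "y \<in> objs G"
  shows "ran (\<gamma>\<tau> y) = I y" "dom (\<gamma>\<tau> y) = I x"
proof -
  have "ran (\<gamma>\<tau> y) = I y \<and> dom (\<gamma>\<tau> y) = I x"
  proof (cases "y = x")
    case True
    then show ?thesis by (simp add: \<gamma>\<tau>_x)
  next
    case False
    then have nonobj: "\<tau> y \<notin> objs G" "ginv G (\<tau> y) \<notin> objs G"
      using y objsD(2,3) \<tau>_simps[OF y] by (metis, metis ginv_closed src_ginv tgt_ginv)
    have "c \<in> ran (\<beta> (\<tau> y)) \<longleftrightarrow> c \<in> ran (\<gamma>\<tau> y)" for c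
      using y \<gamma>\<tau>_dom_sub[OF y] nonobj
      by (auto simp: ran_def \<beta>_nonobj_Some loop_\<tau> \<gamma>x_x \<gamma>\<tau>_x)
    moreover have "c \<in> ran (\<beta> (ginv G (\<tau> y))) \<longleftrightarrow> c \<in> dom (\<gamma>\<tau> y)" for c
      using y \<gamma>\<tau>_dom_sub[OF y] nonobj
      by (auto simp: ran_def \<beta>_nonobj_Some loop_\<tau> \<gamma>x_x \<gamma>\<tau>_x)
    moreover have "ran (\<beta> (ginv G (\<tau> y))) = I x" "ran (\<beta> (\<tau> y)) = I y"
      using global y by (simp_all add: tau_global_def \<beta>_obj)
    ultimately show ?thesis by blast
  qed
  then show "ran (\<gamma>\<tau> y) = I y" "dom (\<gamma>\<tau> y) = I x" by auto
qed

definition f\<tau> :: "'g \<Rightarrow> 'a \<Rightarrow> 'a" where "f\<tau> y a = the (\<gamma>\<tau> y a)"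

lemma f\<tau>_iso: "y \<in> objs G \<Longrightarrow> prng_iso (\<gamma>\<tau> y) (I x) (I y)"
  using \<gamma>\<tau>_iso[of y] by (simp add: \<gamma>\<tau>_ran_dom)

lemma f\<tau>_simps:
  assumes "y \<in> objs G"
  shows "inj_on (f\<tau> y) (I x)" "f\<tau> y ` I x = I y"
    "\<lbrakk>a \<in> I x; b \<in> I x\<rbrakk> \<Longrightarrow> f\<tau> y (a + b) = f\<tau> y a + f\<tau> y b"
    "\<lbrakk>a \<in> I x; b \<in> I x\<rbrakk> \<Longrightarrow> f\<tau> y (a * b) = f\<tau> y a * f\<tau> y b"
    "\<gamma>\<tau> y a = Some b \<longleftrightarrow> a \<in> I x \<and> b = f\<tau> y a"
  using prng_isoD[OF f\<tau>_iso[OF assms]] unfolding f\<tau>_def by (blast, blast, blast, blast, force)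

lemma J_sub: "h \<in> homset G x x \<Longrightarrow> ran (\<gamma>x h) \<subseteq> I x"
  using \<gamma>x_ideal by (simp add: is_ideal_def)

definition fx :: "'g \<Rightarrow> 'a \<Rightarrow> 'a" where "fx h a = the (\<gamma>x h a)"

lemma fx_simps:
  assumes "h \<in> homset G x x"
  shows "inj_on (fx h) (ran (\<gamma>x (ginv G h)))" "fx h ` ran (\<gamma>x (ginv G h)) = ran (\<gamma>x h)"
    "\<lbrakk>a \<in> ran (\<gamma>x (ginv G h)); b \<in> ran (\<gamma>x (ginv G h))\<rbrakk> \<Longrightarrow> fx h (a + b) = fx h a + fx h b"
    "\<lbrakk>a \<in> ran (\<gamma>x (ginv G h)); b \<in> ran (\<gamma>x (ginv G h))\<rbrakk> \<Longrightarrow> fx h (a * b) = fx h a * fx h b"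
    "\<gamma>x h a = Some b \<longleftrightarrow> a \<in> ran (\<gamma>x (ginv G h)) \<and> b = fx h a"
  using prng_isoD[OF \<gamma>x_iso[OF assms]] unfolding fx_def by (blast, blast, blast, blast, force)

text \<open>One formula for both clauses of \<open>lifted\<close>: at an object the loop is
  \<open>x\<close>, \<open>fx x\<close> is the identity on \<open>I x\<close>, and conjugating it
  gives the identity of \<open>I y\<close>.\<close>

lemma \<beta>_Some:
  assumes g: "g \<in> carrier G"
  shows "\<beta> g b = Some b' \<longleftrightarrow>
    (\<exists>a\<in>ran (\<gamma>x (ginv G (l g))). b = f\<tau> (src G g) a \<and> b' = f\<tau> (tgt G g) (fx (l g) a))"
proof (cases "g \<in> objs G")
  case True
  have "fx x a = a" if "a \<in> I x" for a
    using that by (simp add: fx_def \<gamma>x_x pid_def)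
  then show ?thesis
    using True f\<tau>_simps(2)[OF True] by (auto simp: \<beta>_obj \<gamma>x_x)
next
  case False
  have l: "l g \<in> homset G x x" "ginv G (l g) \<in> homset G x x" using g by auto
  have "fx (l g) a \<in> I x" "a \<in> I x" if "a \<in> ran (\<gamma>x (ginv G (l g)))" for a
    using fx_simps(2)[OF l(1)] J_sub[OF l(1)] J_sub[OF l(2)] that by blast+
  then show ?thesis
    using g False by (auto simp: \<beta>_nonobj_Some f\<tau>_simps(5) fx_simps(5)[OF l(1)])
qed

lemma ran_\<beta>:
  assumes g: "g \<in> carrier G"
  shows "ran (\<beta> g) = f\<tau> (tgt G g) ` ran (\<gamma>x (l g))"
proof -
  have "l g \<in> homset G x x" using g by simp
  from fx_simps(2)[OF this] show ?thesis
    by (force simp: ran_def[of "\<beta> g"] \<beta>_Some[OF g])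
qed

lemma dom_\<beta>:
  assumes g: "g \<in> carrier G"
  shows "dom (\<beta> g) = f\<tau> (src G g) ` ran (\<gamma>x (ginv G (l g)))"
  by (force simp: dom_def \<beta>_Some[OF g])

lemma \<beta>_f\<tau>:
  assumes "g \<in> carrier G" "a \<in> ran (\<gamma>x (ginv G (l g)))"
  shows "\<beta> g (f\<tau> (src G g) a) = Some (f\<tau> (tgt G g) (fx (l g) a))"
  using assms by (auto simp: \<beta>_Some)

lemma I_x_ring: "is_ideal (I x) (I x)"
  using I_ideal[OF x_obj] by (auto simp: is_ideal_def)

lemma \<beta>_iso:
  assumes g: "g \<in> carrier G"
  shows "prng_iso (\<beta> g) (ran (\<beta> (ginv G g))) (ran (\<beta> g))"
proof -
  let ?J = "ran (\<gamma>x (ginv G (l g)))" and ?s = "src G g" and ?t = "tgt G g"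
  have l: "l g \<in> homset G x x" "ginv G (l g) \<in> homset G x x" using g by auto
  have J: "?J \<subseteq> I x" and K: "ran (\<gamma>x (l g)) \<subseteq> I x" using J_sub l by blast+
  have dJ: "fx (l g) a \<in> I x" if "a \<in> ?J" for a
    using fx_simps(2)[OF l(1)] K that by blast
  have R: "ran (\<beta> (ginv G g)) = f\<tau> ?s ` ?J"
    using g by (simp add: ran_\<beta> loop_ginv)
  have "inj_on (\<lambda>b. the (\<beta> g b)) (f\<tau> ?s ` ?J)"
  proof (rule inj_onI)
    fix b b' assume "b \<in> f\<tau> ?s ` ?J" "b' \<in> f\<tau> ?s ` ?J" and eq: "the (\<beta> g b) = the (\<beta> g b')"
    then obtain a a' where a: "a \<in> ?J" "b = f\<tau> ?s a" "a' \<in> ?J" "b' = f\<tau> ?s a'" by blast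
    then have "f\<tau> ?t (fx (l g) a) = f\<tau> ?t (fx (l g) a')"
      using eq g by (simp add: \<beta>_f\<tau>)
    then have "fx (l g) a = fx (l g) a'"
      using f\<tau>_simps(1)[of ?t] g dJ a by (auto simp: inj_on_def)
    then show "b = b'"
      using fx_simps(1)[OF l(1)] a by (auto simp: inj_on_def)
  qed
  moreover have "(\<lambda>b. the (\<beta> g b)) ` f\<tau> ?s ` ?J = ran (\<beta> g)"
    using fx_simps(2)[OF l(1)] g by (force simp: ran_\<beta> image_image \<beta>_f\<tau>)
  moreover have "the (\<beta> g (b + b')) = the (\<beta> g b) + the (\<beta> g b') \<and>
      the (\<beta> g (b * b')) = the (\<beta> g b) * the (\<beta> g b')" if "b \<in> f\<tau> ?s ` ?J" "b' \<in> f\<tau> ?s ` ?J" for b b'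
  proof -
    obtain a a' where a: "a \<in> ?J" "b = f\<tau> ?s a" "a' \<in> ?J" "b' = f\<tau> ?s a'" using \<open>b \<in> _\<close> \<open>b' \<in> _\<close> by blast
    have J': "is_ideal ?J (I x)" using \<gamma>x_ideal l by blast
    have closed: "a + a' \<in> ?J" "a * a' \<in> ?J"
      using is_ideal_addD[OF J'] J' J a by (auto simp: is_ideal_def)
    have "a \<in> I x" "a' \<in> I x" using a J by blast+
    then have "b + b' = f\<tau> ?s (a + a')" "b * b' = f\<tau> ?s (a * a')"
      using a g f\<tau>_simps(3,4)[of ?s a a'] by auto
    moreover have "f\<tau> ?t (fx (l g) (a + a')) = f\<tau> ?t (fx (l g) a) + f\<tau> ?t (fx (l g) a')"
      "f\<tau> ?t (fx (l g) (a * a')) = f\<tau> ?t (fx (l g) a) * f\<tau> ?t (fx (l g) a')"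
      using a g f\<tau>_simps(3,4)[of ?t] dJ fx_simps(3,4)[OF l(1)] by auto
    ultimately show ?thesis using a g closed by (simp add: \<beta>_f\<tau>)
  qed
  ultimately show ?thesis
    using g R by (simp add: prng_iso_def bij_betw_def dom_\<beta>)
qed

lemma \<beta>_comp:
  assumes gh: "g \<in> carrier G" "h \<in> carrier G" "src G g = tgt G h"
  shows "(\<beta> g \<circ>\<^sub>m \<beta> h) \<subseteq>\<^sub>m \<beta> (cmp G g h)"
  unfolding map_le_def
proof
  fix b assume "b \<in> dom (\<beta> g \<circ>\<^sub>m \<beta> h)"
  then obtain b' b'' where b: "\<beta> h b = Some b'" "\<beta> g b' = Some b''"
    by (auto simp: map_comp_Some_iff)
  have l: "l g \<in> homset G x x" "l h \<in> homset G x x" "ginv G (l g) \<in> homset G x x"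
    "l (cmp G g h) \<in> homset G x x"
    using gh by (auto simp: cmp_closed)
  obtain a where a: "a \<in> ran (\<gamma>x (ginv G (l h)))" "b = f\<tau> (src G h) a" "b' = f\<tau> (tgt G h) (fx (l h) a)"
    using b(1) gh by (auto simp: \<beta>_Some)
  obtain a' where a': "a' \<in> ran (\<gamma>x (ginv G (l g)))" "b' = f\<tau> (src G g) a'" "b'' = f\<tau> (tgt G g) (fx (l g) a')"
    using b(2) gh by (auto simp: \<beta>_Some)
  have "fx (l h) a \<in> I x" using a fx_simps(2)[OF l(2)] J_sub[OF l(2)] by blast
  moreover have "a' \<in> I x" using a' J_sub[OF l(3)] by blast
  \<comment> \<open>Both elements represent \<open>b'\<close> at the common object
    \<open>src G g = tgt G h\<close>, where \<open>f\<tau>\<close> is injective; so the two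
    conjugates can be composed at \<open>x\<close>.\<close>
  ultimately have "a' = fx (l h) a"
    using a a' gh f\<tau>_simps(1)[of "src G g"] by (auto simp: inj_on_def)
  then have "\<gamma>x (l h) a = Some a'" "\<gamma>x (l g) a' = Some (fx (l g) a')"
    using a a' l fx_simps(5) by blast+
  then have "(\<gamma>x (l g) \<circ>\<^sub>m \<gamma>x (l h)) a = Some (fx (l g) a')"
    by (simp add: map_comp_def)
  then have "\<gamma>x (l (cmp G g h)) a = Some (fx (l g) a')"
    using \<gamma>x_comp[OF l(1,2)] gh unfolding map_le_def by (metis domI loop_cmp)
  then have "a \<in> ran (\<gamma>x (ginv G (l (cmp G g h))))" "fx (l g) a' = fx (l (cmp G g h)) a"
    using fx_simps(5)[OF l(4)] by blast+
  then have "\<beta> (cmp G g h) b = Some b''"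
    using a a' gh by (auto simp: \<beta>_Some cmp_closed src_cmp tgt_cmp)
  then show "(\<beta> g \<circ>\<^sub>m \<beta> h) b = \<beta> (cmp G g h) b"
    using b by (simp add: map_comp_def)
qed

lemma partial_action_lifted: "partial_action G A \<beta>"
  unfolding partial_action_def
proof (intro conjI ballI impI)
  fix g assume g: "g \<in> carrier G"
  show "is_ideal (ran (\<beta> (tgt G g))) A"
    using g by (simp add: \<beta>_obj I_ideal)
  have "is_ideal (f\<tau> (tgt G g) ` ran (\<gamma>x (l g))) (I (tgt G g))"
    unfolding f\<tau>_def using g by (intro is_ideal_image[OF f\<tau>_iso I_x_ring] \<gamma>x_ideal) auto
  then show "is_ideal (ran (\<beta> g)) (ran (\<beta> (tgt G g)))"
    using g by (simp add: \<beta>_obj ran_\<beta>)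
  show "prng_iso (\<beta> g) (ran (\<beta> (ginv G g))) (ran (\<beta> g))"
    using g by (rule \<beta>_iso)
qed (simp_all add: \<beta>_obj \<beta>_comp)

lemma unital_lifted:
  assumes "gamma_unital G x I \<gamma>x" and g: "g \<in> carrier G"
  shows "unital_ring (ran (\<beta> g))"
proof -
  have l: "l g \<in> homset G x x" using g by simp
  then obtain u where "is_unity (ran (\<gamma>x (l g))) u"
    using assms(1) unfolding gamma_unital_def unital_partial_action_def isotropy_simps by blast
  then have "is_unity (f\<tau> (tgt G g) ` ran (\<gamma>x (l g))) (f\<tau> (tgt G g) u)"
    unfolding f\<tau>_def using g J_sub[OF l] by (intro is_unity_image[OF f\<tau>_iso]) auto
  then show ?thesis using g by (auto simp: unital_ring_def ran_\<beta>)
qed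

end

theorem theorem7p6:
  fixes G :: "('g, 'm) groupoid_scheme"
    and x :: 'g
    and \<tau> :: "'g \<Rightarrow> 'g"
    and A :: "'a::ring set"
    and I :: "'g \<Rightarrow> 'a set"
    and \<gamma>\<tau> \<gamma>x \<beta> :: "'g \<Rightarrow> 'a \<rightharpoonup> 'a"
  assumes "groupoid G" and "finite (carrier G)" and "connected_groupoid G"
    and "x \<in> objs G"
    and "transversal G x \<tau>"
    and "A = UNIV"
    and "datum G x \<tau> A I \<gamma>\<tau> \<gamma>x"
    and "\<beta> = lifted G \<tau> I \<gamma>\<tau> \<gamma>x"
    and "tau_global G x \<tau> \<beta>"
    and "gamma_unital G x I \<gamma>x"
    and "direct_sum (objs G) I A"
    and "direct_sum (objs G) (\<lambda>y. ran (\<beta> y)) A"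
    and "Gx = isotropy G x"
    and "Bx = ran (\<beta> x)"
  shows "(partial_galois G A \<beta> \<and> tr G \<beta> ` A = invariants G A \<beta>
           \<longleftrightarrow> galois_morita_strict G A \<beta>) \<and>
         (galois_morita_strict G A \<beta> \<longleftrightarrow> galois_morita_strict Gx Bx \<beta>) \<and>
         (galois_morita_strict Gx Bx \<beta>
           \<longleftrightarrow> partial_galois Gx Bx \<beta> \<and> tr Gx \<beta> ` Bx = invariants Gx Bx \<beta>)"
proof -
  interpret L: lifted_datum G x \<tau> A I \<gamma>\<tau> \<gamma>x
    using assms by (intro lifted_datum.intro lifted_datum_axioms.intro) auto
  interpret B: tau_global_action G A \<beta> x \<tau>
  proof (intro tau_global_action.intro tau_global_action_axioms.intro unital_action.intro
      unital_action_axioms.intro)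
    show "is_ideal A A"
      using assms by (simp add: is_ideal_def)
    show "partial_action G A \<beta>"
      using assms L.partial_action_lifted by simp
    show "unital_ring (ran (\<beta> g))" if "g \<in> carrier G" for g
      using assms L.unital_lifted[OF _ that] by simp
  qed (use assms in simp_all)
  \<comment> \<open>The equivalence of the two strictness statements goes through their Galois
    counterparts, which are compared by \<open>galois_isotropy_iff\<close>.\<close>
  show ?thesis
    using B.galois_iff_strict B.X.galois_iff_strict B.galois_isotropy_iff assms(13,14) by blast
qed

end
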